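(* Let $\mathbb F\in\{\mathbb R,\mathbb C\}$ and let $A,B,C\in \mathbf{Gr}_{n,k}(\mathbb F)$ lie within a metric ball $\mathcal B\subset \mathbf{Gr}_{n,k}(\mathbb F)$ of radius less than $\rho_{\mathbb F}$. Then $$d(A\sharp_t B,\ A\sharp_t C)\ \ge\ t\, d(B,C)\qquad\text{for all } t\in[0,1].$$
   Context: For $\mathbb F=\mathbb C$, $\mathbf{Gr}_{n,k}(\mathbb C)=\{P\in\mathbb C^{n\times n}: P^2=P,\ P^*=P,\ \operatorname{rank}P=k\}$, a compact submanifold of the real vector space of $n\times n$ Hermitian matrices; for $\mathbb F=\mathbb R$, $\mathbf{Gr}_{n,k}(\mathbb R)=\{P\in\mathbb R^{n\times n}: P^2=P,\ P^\top=P,\ \operatorname{rank}P=k\}$, a compact submanifold of the space of real symmetric $n\times n$ matrices. It carries the Riemannian metric induced by the Frobenius inner product, $\langle X,Y\rangle_P=\operatorname{tr}(XY)$ for $X,Y\in T_P\mathbf{Gr}_{n,k}(\mathbb F)$. $d$ denotes the Riemannian distance and $\mathrm{Exp}_P$ the Riemannian exponential map at $P$. Let $R_P$ be the injectivity radius at $P$ (the largest $R>0$ such that $\mathrm{Exp}_P$ is a diffeomorphism from the open ball of radius $R$ about $0$ in $T_P\mathbf{Gr}_{n,k}(\mathbb F)$ onto its image), $r_{\mathbb F}=\min_P R_P>0$, and let $\delta_{\mathbb F}$ be the maximum of the sectional curvatures of $\mathbf{Gr}_{n,k}(\mathbb F)$. Put $$\rho_{\mathbb F}=\min\left\{\frac{r_{\mathbb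 F}}{2},\ \frac{\pi}{2\,\delta_{\mathbb F}^{1/2}}\right\}.$$ Convention: the second term is $+\infty$ if the manifold has no tangent 2-planes (dimension at most 1), and $R_P=+\infty$ if the manifold is a single point. It is known that every metric ball $\mathcal B$ of radius less than $\rho_{\mathbb F}$ is strongly convex: for any $P,Q\in\mathcal B$ there is a unique minimizing geodesic from $P$ to $Q$ in $\mathbf{Gr}_{n,k}(\mathbb F)$, and it lies entirely in $\mathcal B$. For $P,Q\in\mathcal B$, $\overrightarrow{PQ}=\mathrm{Exp}_P^{-1}Q\in T_P\mathbf{Gr}_{n,k}(\mathbb F)$ denotes the initial tangent vector of this geodesic (the unique vector of norm less than $r_{\mathbb F}$ with $\mathrm{Exp}_P(\overrightarrow{PQ})=Q$). For $t\in[0,1]$, the $t$-geometric mean is $P\sharp_tQ=\mathrm{Exp}_P(t\,\overrightarrow{PQ})$, the point at parameter $t$ on the geodesic from $P$ to $Q$. *)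

theory Defs
  imports "HOL-Analysis.Analysis"
begin

section \<open>Smooth maps\<close>

text \<open>For open \<open>S\<close> in a finite-dimensional space: \<open>f\<close> has continuous partial derivatives up to
  order \<open>k\<close> on \<open>S\<close>. Iterating directional derivatives keeps the type of \<open>f\<close> fixed.\<close>

primrec Ck_on :: "nat \<Rightarrow> ('a::euclidean_space \<Rightarrow> 'b::euclidean_space) \<Rightarrow> 'a set \<Rightarrow> bool" where
  "Ck_on 0 f S \<longleftrightarrow> continuous_on S f"
| "Ck_on (Suc k) f S \<longleftrightarrow>
     (\<exists>f'. (\<forall>x\<in>S. (f has_derivative f' x) (at x)) \<and> (\<forall>v. Ck_on k (\<lambda>x. f' x v) S))"

text \<open>On an arbitrary set, smooth means: locally the restriction of a smooth map on an open set.\<close>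

definition smooth_on :: "'a::euclidean_space set \<Rightarrow> ('a \<Rightarrow> 'b::euclidean_space) \<Rightarrow> bool" where
  "smooth_on S f \<longleftrightarrow>
     (\<forall>x\<in>S. \<exists>U g. open U \<and> x \<in> U \<and> (\<forall>k. Ck_on k g U) \<and> (\<forall>y\<in>S \<inter> U. g y = f y))"

definition diffeo_onto_image :: "'a::euclidean_space set \<Rightarrow> ('a \<Rightarrow> 'b::euclidean_space) \<Rightarrow> bool" where
  "diffeo_onto_image S f \<longleftrightarrow> smooth_on S f \<and> inj_on f S \<and> smooth_on (f ` S) (inv_into S f)"


section \<open>Riemannian geometry of a submanifold of a Euclidean space\<close>

text \<open>Throughout, \<open>M\<close> is a submanifold of a Euclidean space and carries the metric induced by the
  ambient inner product. Its Levi-Civita connection is the tangential part of the ambient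
  derivative.\<close>

definition tangent_space :: "'a::euclidean_space set \<Rightarrow> 'a \<Rightarrow> 'a set" where
  "tangent_space M p =
     {v. \<exists>e>0. \<exists>c. smooth_on {-e<..<e} c \<and> c ` {-e<..<e} \<subseteq> M \<and> c 0 = p \<and>
           (c has_vector_derivative v) (at 0)}"

definition tangential :: "'a::euclidean_space set \<Rightarrow> 'a \<Rightarrow> 'a \<Rightarrow> 'a" where
  "tangential M p x =
     (THE y. y \<in> tangent_space M p \<and> (\<forall>z\<in>tangent_space M p. orthogonal (x - y) z))"

text \<open>The \<open>has_integral\<close> clause restricts to curves of finite length; for other curves
  \<open>integral\<close> would return the default value 0.\<close>

definition riem_dist :: "'a::euclidean_space set \<Rightarrow> 'a \<Rightarrow> 'a \<Rightarrow> real" where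
  "riem_dist M p q =
     Inf {l. \<exists>g. valid_path g \<and> path_image g \<subseteq> M \<and> pathstart g = p \<and> pathfinish g = q \<and>
           ((\<lambda>t. norm (vector_derivative g (at t within {0..1}))) has_integral l) {0..1}}"

definition riem_ball :: "'a::euclidean_space set \<Rightarrow> 'a \<Rightarrow> real \<Rightarrow> 'a set" where
  "riem_ball M p s = {q \<in> M. riem_dist M p q < s}"

text \<open>Geodesics are defined on the whole real line, which suffices for complete \<open>M\<close>.\<close>

definition geodesic :: "'a::euclidean_space set \<Rightarrow> (real \<Rightarrow> 'a) \<Rightarrow> bool" where
  "geodesic M c \<longleftrightarrow> smooth_on UNIV c \<and> range c \<subseteq> M \<and>
     (\<forall>t. tangential M (c t)
            (vector_derivative (\<lambda>s. vector_derivative c (at s)) (at t)) = 0)"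

definition riem_exp :: "'a::euclidean_space set \<Rightarrow> 'a \<Rightarrow> 'a \<Rightarrow> 'a" where
  "riem_exp M p v =
     (THE q. \<exists>c. geodesic M c \<and> c 0 = p \<and> (c has_vector_derivative v) (at 0) \<and> c 1 = q)"

definition inj_radius_at :: "'a::euclidean_space set \<Rightarrow> 'a \<Rightarrow> ereal" where
  "inj_radius_at M p =
     (SUP R \<in> {R. 0 < R \<and> diffeo_onto_image (tangent_space M p \<inter> ball 0 R) (riem_exp M p)}. ereal R)"

definition inj_radius :: "'a::euclidean_space set \<Rightarrow> ereal" where
  "inj_radius M = (INF p \<in> M. inj_radius_at M p)"

definition vector_field :: "'a::euclidean_space set \<Rightarrow> ('a \<Rightarrow> 'a) \<Rightarrow> bool" where
  "vector_field M X \<longleftrightarrow> smooth_on M X \<and> (\<forall>p\<in>M. X p \<in> tangent_space M p)"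

text \<open>The derivative of a function on \<open>M\<close> within \<open>M\<close> is unique only on tangent vectors; below
  it is applied to no others.\<close>

definition dir_deriv :: "'a::euclidean_space set \<Rightarrow> ('a \<Rightarrow> 'a) \<Rightarrow> ('a \<Rightarrow> 'a) \<Rightarrow> 'a \<Rightarrow> 'a" where
  "dir_deriv M X Y p = frechet_derivative Y (at p within M) (X p)"

definition cov_deriv :: "'a::euclidean_space set \<Rightarrow> ('a \<Rightarrow> 'a) \<Rightarrow> ('a \<Rightarrow> 'a) \<Rightarrow> 'a \<Rightarrow> 'a" where
  "cov_deriv M X Y p = tangential M p (dir_deriv M X Y p)"

definition lie_bracket :: "'a::euclidean_space set \<Rightarrow> ('a \<Rightarrow> 'a) \<Rightarrow> ('a \<Rightarrow> 'a) \<Rightarrow> 'a \<Rightarrow> 'a" where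
  "lie_bracket M X Y p = dir_deriv M X Y p - dir_deriv M Y X p"

definition curvature ::
    "'a::euclidean_space set \<Rightarrow> ('a \<Rightarrow> 'a) \<Rightarrow> ('a \<Rightarrow> 'a) \<Rightarrow> ('a \<Rightarrow> 'a) \<Rightarrow> 'a \<Rightarrow> 'a" where
  "curvature M X Y Z p =
     cov_deriv M X (cov_deriv M Y Z) p - cov_deriv M Y (cov_deriv M X Z) p
       - cov_deriv M (lie_bracket M X Y) Z p"

definition sectional_curvatures :: "'a::euclidean_space set \<Rightarrow> real set" where
  "sectional_curvatures M =
     {(curvature M X Y Y p \<bullet> X p) / ((X p \<bullet> X p) * (Y p \<bullet> Y p) - (X p \<bullet> Y p)\<^sup>2) | X Y p.
        p \<in> M \<and> vector_field M X \<and> vector_field M Y \<and> X p \<noteq> Y p \<and> independent {X p, Y p}}"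

definition max_sectional_curvature :: "'a::euclidean_space set \<Rightarrow> real" where
  "max_sectional_curvature M = Sup (sectional_curvatures M)"

definition convexity_bound :: "'a::euclidean_space set \<Rightarrow> ereal" where
  "convexity_bound M =
     min (inj_radius M / 2)
         (if \<forall>p\<in>M. dim (tangent_space M p) \<le> 1 then \<infinity>
          else ereal (pi / (2 * sqrt (max_sectional_curvature M))))"

definition riem_log :: "'a::euclidean_space set \<Rightarrow> 'a \<Rightarrow> 'a \<Rightarrow> 'a" where
  "riem_log M p q =
     (THE v. v \<in> tangent_space M p \<and> ereal (norm v) < inj_radius M \<and> riem_exp M p v = q)"

definition geom_mean :: "'a::euclidean_space set \<Rightarrow> real \<Rightarrow> 'a \<Rightarrow> 'a \<Rightarrow> 'a" where
  "geom_mean M t p q = riem_exp M p (t *\<^sub>R riem_log M p q)"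


section \<open>Grassmannians\<close>

definition Gr_real :: "nat \<Rightarrow> (real^'n^'n) set" where
  "Gr_real k = {P. P ** P = P \<and> transpose P = P \<and> rank P = k}"

definition Gr_complex :: "nat \<Rightarrow> (complex^'n^'n) set" where
  "Gr_complex k = {P. P ** P = P \<and> map_matrix cnj (transpose P) = P \<and> rank P = k}"

text \<open>On symmetric and on Hermitian matrices, hence on the tangent spaces, the ambient inner
  product is the Frobenius one.\<close>

lemma inner_symmetric_eq_trace:
  fixes X Y :: "real^'n^'n"
  assumes "transpose Y = Y"
  shows "X \<bullet> Y = trace (X ** Y)"
proof -
  have "Y $ j $ i = Y $ i $ j" for i j
    using assms by (metis transpose_def vec_lambda_beta)
  then show ?thesis
    by (simp add: inner_vec_def trace_def matrix_matrix_mult_def)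
qed

lemma inner_hermitian_eq_trace:
  fixes X Y :: "complex^'n^'n"
  assumes X: "map_matrix cnj (transpose X) = X" and Y: "map_matrix cnj (transpose Y) = Y"
  shows "of_real (X \<bullet> Y) = trace (X ** Y)"
proof -
  have Y': "cnj (Y $ i $ j) = Y $ j $ i" for i j
    by (subst (2) Y[symmetric]) (simp add: transpose_def)
  have X': "cnj (X $ i $ j) = X $ j $ i" for i j
    by (subst (2) X[symmetric]) (simp add: transpose_def)
  have tr: "trace (X ** Y) = (\<Sum>i\<in>UNIV. \<Sum>j\<in>UNIV. X $ i $ j * cnj (Y $ i $ j))"
    by (simp add: trace_def matrix_matrix_mult_def Y')
  have "cnj (trace (X ** Y)) = (\<Sum>i\<in>UNIV. \<Sum>j\<in>UNIV. X $ j $ i * Y $ i $ j)"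
    by (simp add: tr X')
  also have "\<dots> = trace (X ** Y)"
    unfolding trace_def matrix_matrix_mult_def by (subst sum.swap) simp
  finally have "Im (trace (X ** Y)) = 0"
    by (simp add: complex_eq_iff)
  moreover have "Re (trace (X ** Y)) = X \<bullet> Y"
    by (simp add: tr inner_vec_def inner_complex_def)
  ultimately show ?thesis
    by (simp add: complex_eq_iff)
qed

end

theory Submission
  imports Defs
begin

text \<open>
  The inequality is Toponogov's comparison with the Euclidean plane for triangles with minimal sides
  in nonnegative curvature.

  The geodesics are \<open>t \<mapsto> exp (t w) P exp (- t w)\<close> with \<open>w\<close> skew and anticommuting with
  \<open>S = 2 P - 1\<close>. Two facts suffice. The exponential map at every point does not increase distances:
  the curve \<open>s \<mapsto> exp (s b) exp ((1 - s) a) P (\<dots>)\<^sup>*\<close> has speed at most \<open>norm (b - a)\<close>. And any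
  two points are joined by a minimal geodesic: one takes \<open>w\<close> with \<open>exp (2 w) = T S\<close>,
  \<open>T = 2 Q - 1\<close>, and eigenvalues in \<open>[- \<i> \<pi> / 2, \<i> \<pi> / 2]\<close>. Together they
  give Stewart's inequality for a point and a geodesic, and using it twice, for the points of
  parameter \<open>t\<close> on both sides of a triangle, gives the theorem.

  Real and complex matrices are treated at once as a finite-dimensional real star algebra with a
  compatible inner product.
\<close>

section \<open>Symmetric operators\<close>

text \<open>The sign of the curvature enters as one sharp bound: the commutator of \<open>k\<close>
  with a projection has norm at most \<open>norm k\<close>. The ball enters through distances: two
  of its points are closer than twice its radius, hence closer than the injectivity radius, and then
  \<open>riem_log\<close> is the initial vector of a minimal geodesic, so both geodesics leaving A
  are minimal. The harder half is the existence of minimal geodesics, since every competing curve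
  must be bounded from below. Principal angles equal to pi/2 are the obstacle: TS has the eigenvalue
  -1 there, no function of TS is the required logarithm, and w must still be skew, anticommute with
  S and stay in the given, possibly real, algebra. Equality of ranks, in the form of equality of
  traces, supplies it. Lengths are measured in the Frobenius norm, angles on a sphere for one vector
  at a time. Letting the algebra act on itself by left multiplication and summing over an
  orthonormal basis converts one into the other; \<kappa> is the factor that this produces.\<close>

text \<open>The Rayleigh quotient attains its maximum \<open>l\<close> on the unit sphere of
  \<open>S\<close>. The residual \<open>l *\<^sub>R x - L x\<close> is orthogonal to
  \<open>x\<close>, and the first variation in its direction forces it to vanish. The invariant
  subspace \<open>S\<close> is there for the induction that splits off one eigenvector at a
  time.\<close>

lemma symmetric_eigenvector_exists:
  fixes L :: "'a::euclidean_space \<Rightarrow> 'a"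
  assumes lin: "linear L" and sym: "\<And>x y. L x \<bullet> y = x \<bullet> L y"
    and S: "subspace S" and inv: "\<And>x. x \<in> S \<Longrightarrow> L x \<in> S" and nz: "S \<noteq> {0}"
  obtains x l where "x \<in> S" "norm x = 1" "L x = l *\<^sub>R x"
proof -
  interpret L: linear L by fact
  obtain z where z: "z \<in> S" "z \<noteq> 0" using nz S subspace_0 by blast
  let ?K = "S \<inter> sphere 0 1"
  have "compact ?K" using closed_subspace[OF S] by (simp add: closed_Int_compact)
  moreover have "(1 / norm z) *\<^sub>R z \<in> ?K" using z S by (simp add: subspace_scale)
  moreover have "continuous_on ?K (\<lambda>x. L x \<bullet> x)"
    by (intro continuous_intros linear_continuous_on linear_conv_bounded_linear[THEN iffD1] lin)
  ultimately obtain x where x: "x \<in> ?K" and max: "\<And>y. y \<in> ?K \<Longrightarrow> L y \<bullet> y \<le> L x \<bullet> x"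
    using continuous_attains_sup[of ?K "\<lambda>x. L x \<bullet> x"] by blast
  define l where "l = L x \<bullet> x"
  have xS: "x \<in> S" and nx: "norm x = 1" using x by auto
  have le: "L y \<bullet> y \<le> l * (y \<bullet> y)" if "y \<in> S" for y
  proof (cases "y = 0")
    case False
    have "(1 / norm y) *\<^sub>R y \<in> ?K" using False that S by (simp add: subspace_scale)
    from max[OF this] have "(L y \<bullet> y) / (norm y)\<^sup>2 \<le> l"
      by (simp add: L.scale l_def power2_eq_square)
    then show ?thesis using False by (simp add: divide_simps dot_square_norm)
  qed simp
  define T where "T = l *\<^sub>R x - L x"
  have TS: "T \<in> S" unfolding T_def using S inv xS by (simp add: subspace_diff subspace_scale)
  have Tx: "T \<bullet> x = 0" using nx by (simp add: T_def inner_diff_left l_def dot_square_norm)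
  define q where "q = l * (T \<bullet> T) - L T \<bullet> T"
  have quad: "0 \<le> 2 * t * (T \<bullet> T) + t\<^sup>2 * q" for t
  proof -
    have "x + t *\<^sub>R T \<in> S" using S xS TS by (simp add: subspace_add subspace_scale)
    from le[OF this] have "0 \<le> l * ((x + t *\<^sub>R T) \<bullet> (x + t *\<^sub>R T)) - L (x + t *\<^sub>R T) \<bullet> (x + t *\<^sub>R T)"
      by simp
    also have "\<dots> = (l * (x \<bullet> x) - L x \<bullet> x) + 2 * t * (T \<bullet> T) + t\<^sup>2 * q"
    proof -
      have a: "L T \<bullet> x = L x \<bullet> T" using sym[of T x] by (simp add: inner_commute)
      have b: "L x \<bullet> T = l * (x \<bullet> T) - T \<bullet> T"
        by (simp add: T_def inner_diff_left inner_diff_right algebra_simps)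
      have c: "x \<bullet> T = 0" using Tx by (simp add: inner_commute)
      show ?thesis
        using a b c by (simp add: L.add L.scale inner_add_left inner_add_right q_def power2_eq_square
          distrib_left distrib_right right_diff_distrib left_diff_distrib inner_commute[of T x])
    qed
    finally show ?thesis using nx by (simp add: l_def dot_square_norm)
  qed
  have "T \<bullet> T = 0"
  proof (rule ccontr)
    assume "T \<bullet> T \<noteq> 0"
    then have pos: "T \<bullet> T > 0" by simp
    \<comment> \<open>The sign makes the linear term of \<open>quad\<close> negative; the
      denominator keeps the quadratic term at most half of it in size.\<close>
    define t where "t = - (T \<bullet> T) / (\<bar>q\<bar> + 1)"
    have "t < 0" using pos by (simp add: t_def divide_neg_pos)
    have "0 \<le> t * (2 * (T \<bullet> T) + t * q)" using quad[of t] by (simp add: algebra_simps power2_eq_square)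
    then have "2 * (T \<bullet> T) + t * q \<le> 0" using \<open>t < 0\<close> by (simp add: zero_le_mult_iff)
    moreover have "\<bar>t * q\<bar> \<le> T \<bullet> T"
      using pos by (simp add: t_def abs_mult divide_simps)
    ultimately show False using pos by linarith
  qed
  then have "L x = l *\<^sub>R x" by (simp add: T_def)
  then show ?thesis using that xS nx by blast
qed

lemma symmetric_eigenbasis_subspace:
  fixes L :: "'a::euclidean_space \<Rightarrow> 'a"
  assumes lin: "linear L" and sym: "\<And>x y. L x \<bullet> y = x \<bullet> L y"
  shows "subspace S \<Longrightarrow> (\<And>x. x \<in> S \<Longrightarrow> L x \<in> S) \<Longrightarrow>
    \<exists>B. finite B \<and> B \<subseteq> S \<and> pairwise orthogonal B \<and> (\<forall>b\<in>B. norm b = 1 \<and> (\<exists>l. L b = l *\<^sub>R b)) \<and> span B = S"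
proof (induction "dim S" arbitrary: S rule: less_induct)
  case less
  show ?case
  proof (cases "S = {0}")
    case True
    then show ?thesis by (intro exI[of _ "{}"]) auto
  next
    case False
    obtain x l where x: "x \<in> S" "norm x = 1" "L x = l *\<^sub>R x"
      using symmetric_eigenvector_exists[OF lin sym less.prems False] by blast
    let ?R = "S \<inter> {y. orthogonal x y}"
    have R: "subspace ?R" using less.prems(1) subspace_orthogonal_to_vector[of x] by (rule subspace_inter)
    have "dim ?R < dim S"
    proof (rule dim_psubset)
      have "x \<notin> ?R" using x by (auto simp: orthogonal_def dot_square_norm)
      then show "span ?R \<subset> span S" using R less.prems(1) x(1) by (metis IntD1 psubsetI span_eq_iff subsetI)
    qed
    moreover have "L y \<in> ?R" if "y \<in> ?R" for y
      using that x sym[of x y] less.prems by (auto simp: orthogonal_def)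
    ultimately obtain B where B: "finite B" "B \<subseteq> ?R" "pairwise orthogonal B"
       "\<forall>b\<in>B. norm b = 1 \<and> (\<exists>l. L b = l *\<^sub>R b)" "span B = ?R"
      using less.hyps[OF _ R] by meson
    have "span (insert x B) = S"
    proof
      show "span (insert x B) \<subseteq> S" using x B less.prems(1) by (intro span_minimal) auto
      show "S \<subseteq> span (insert x B)"
      proof
        fix y assume y: "y \<in> S"
        have "y - (x \<bullet> y) *\<^sub>R x \<in> ?R"
          using y x less.prems(1)
          by (auto simp: orthogonal_def inner_diff_right dot_square_norm subspace_diff subspace_scale)
        then have "y - (x \<bullet> y) *\<^sub>R x \<in> span B" using B by simp
        then have "y - (x \<bullet> y) *\<^sub>R x \<in> span (insert x B)"
          by (meson span_mono subset_insertI subsetD)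
        then have "y - (x \<bullet> y) *\<^sub>R x + (x \<bullet> y) *\<^sub>R x \<in> span (insert x B)"
          by (intro span_add span_scale) (auto simp: span_base)
        then show "y \<in> span (insert x B)" by simp
      qed
    qed
    moreover have "pairwise orthogonal (insert x B)"
      using B by (auto simp: pairwise_insert orthogonal_commute)
    ultimately show ?thesis using B x by (intro exI[of _ "insert x B"]) auto
  qed
qed

lemma symmetric_eigenbasis:
  fixes L :: "'a::euclidean_space \<Rightarrow> 'a"
  assumes "linear L" and "\<And>x y. L x \<bullet> y = x \<bullet> L y"
  obtains B l where "finite B" "pairwise orthogonal B" "span B = UNIV"
    "\<And>b. b \<in> B \<Longrightarrow> norm b = 1" "\<And>b. b \<in> B \<Longrightarrow> L b = l b *\<^sub>R b"
proof -
  obtain B where B: "finite B" "pairwise orthogonal B" "span B = UNIV"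
    and "\<forall>b\<in>B. norm b = 1 \<and> (\<exists>l. L b = l *\<^sub>R b)"
    using symmetric_eigenbasis_subspace[OF assms, of UNIV] by auto
  moreover then obtain l where "\<forall>b\<in>B. L b = l b *\<^sub>R b" by metis
  ultimately show ?thesis using that by blast
qed

lemma orthonormal_expand:
  fixes B :: "'a::euclidean_space set"
  assumes "finite B" "pairwise orthogonal B" "span B = UNIV" "\<And>b. b \<in> B \<Longrightarrow> norm b = 1"
  shows "(\<Sum>b\<in>B. (b \<bullet> x) *\<^sub>R b) = x"
  using orthonormal_basis_expand[OF assms(2,4) _ assms(1), of x] assms(3) unfolding inner_commute[of _ x] by simp

lemma orthonormal_parseval:
  fixes B :: "'a::euclidean_space set"
  assumes "finite B" "pairwise orthogonal B" "span B = UNIV" "\<And>b. b \<in> B \<Longrightarrow> norm b = 1"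
  shows "(\<Sum>b\<in>B. (b \<bullet> x)\<^sup>2) = (norm x)\<^sup>2"
proof -
  have "x \<bullet> x = (\<Sum>b\<in>B. (b \<bullet> x) *\<^sub>R b) \<bullet> x" using orthonormal_expand[OF assms] by simp
  then show ?thesis by (simp add: inner_sum_left power2_eq_square dot_square_norm)
qed

text \<open>Both sides are the squared Hilbert-Schmidt norm of \<open>f\<close>; passing to the
  adjoint \<open>g\<close> and back exchanges the basis. This carries \<open>sum_Basis_mul\<close>
  over to an eigenbasis.\<close>

lemma sum_norm_orthonormal_eq_Basis:
  fixes f g :: "'a::euclidean_space \<Rightarrow> 'a"
  assumes B: "finite B" "pairwise orthogonal B" "span B = UNIV" "\<And>b. b \<in> B \<Longrightarrow> norm b = 1"
    and adj: "\<And>x y. f x \<bullet> y = x \<bullet> g y"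
  shows "(\<Sum>b\<in>B. (norm (f b))\<^sup>2) = (\<Sum>b\<in>Basis. (norm (f b))\<^sup>2)"
proof -
  have par: "(norm y)\<^sup>2 = (\<Sum>c\<in>Basis. (c \<bullet> y)\<^sup>2)" for y :: 'a
    unfolding power2_norm_eq_inner by (subst euclidean_inner) (simp add: power2_eq_square inner_commute)
  have "(\<Sum>b\<in>B. (norm (f b))\<^sup>2) = (\<Sum>b\<in>B. \<Sum>c\<in>Basis. (b \<bullet> g c)\<^sup>2)"
    by (simp only: par) (simp add: adj inner_commute[of _ "f _"])
  also have "\<dots> = (\<Sum>c\<in>Basis. (norm (g c))\<^sup>2)"
    by (subst sum.swap) (simp add: orthonormal_parseval[OF B])
  also have "\<dots> = (\<Sum>c\<in>Basis. \<Sum>b\<in>Basis. (b \<bullet> g c)\<^sup>2)" by (simp only: par)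
  also have "\<dots> = (\<Sum>b\<in>Basis. (norm (f b))\<^sup>2)"
    by (subst sum.swap) (simp only: par, simp add: adj inner_commute[of _ "f _"])
  finally show ?thesis .
qed

section \<open>Finite-dimensional star algebras\<close>

text \<open>The two inner product laws make \<open>one \<bullet> x\<close> behave like a trace; for
  matrices it is the real part of the trace. \<open>prime_algebra\<close> links any two nonzero
  projections by a nonzero element. \<open>sum_Basis_mul\<close> evaluates the Hilbert-Schmidt norm
  of left multiplication; for matrices of size n the factor \<kappa> is n times the real dimension
  of the field.\<close>

locale star_algebra =
  fixes mul :: "'a::euclidean_space \<Rightarrow> 'a \<Rightarrow> 'a" (infixl "\<cdot>" 70)
    and one :: 'a
    and adj :: "'a \<Rightarrow> 'a"
    and \<kappa> :: real
  assumes bounded_bilinear_mul: "bounded_bilinear mul"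
    and mul_assoc: "x \<cdot> y \<cdot> z = x \<cdot> (y \<cdot> z)"
    and one_mul [simp]: "one \<cdot> x = x"
    and mul_one [simp]: "x \<cdot> one = x"
    and linear_adj: "linear adj"
    and adj_adj [simp]: "adj (adj x) = x"
    and adj_mul: "adj (x \<cdot> y) = adj y \<cdot> adj x"
    and inner_mul_left: "(x \<cdot> y) \<bullet> z = y \<bullet> (adj x \<cdot> z)"
    and inner_mul_right: "(x \<cdot> y) \<bullet> z = x \<bullet> (z \<cdot> adj y)"
    and prime_algebra: "(\<And>z. x \<cdot> z \<cdot> y = 0) \<Longrightarrow> x = 0 \<or> y = 0"
    and kappa_pos: "\<kappa> > 0"
    and sum_Basis_mul: "(\<Sum>b\<in>Basis. (norm (x \<cdot> b))\<^sup>2) = \<kappa> * (norm x)\<^sup>2"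
begin

sublocale mul: bounded_bilinear mul by (rule bounded_bilinear_mul)
sublocale adj: linear adj by (rule linear_adj)

lemmas alg_simps = mul_assoc mul.add_left mul.add_right mul.diff_left mul.diff_right
  mul.minus_left mul.minus_right mul.scaleR_left mul.scaleR_right
  adj.add adj.diff adj.neg adj.scale adj_mul

lemmas mul_zero [simp] = mul.zero_left mul.zero_right

lemma adj_one [simp]: "adj one = one"
  by (metis adj_adj adj_mul mul_one one_mul)

lemma inner_eq_one_inner: "x \<bullet> y = one \<bullet> (adj x \<cdot> y)"
  using inner_mul_left[of x one y] by simp

lemma inner_eq_one_inner': "x \<bullet> y = one \<bullet> (y \<cdot> adj x)"
  using inner_mul_right[of one x y] by simp

lemma one_inner_commute: "one \<bullet> (x \<cdot> y) = one \<bullet> (y \<cdot> x)"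
  using inner_eq_one_inner[of "adj x" y] inner_eq_one_inner'[of "adj x" y] by simp

lemma norm_isometry_mul: "adj u \<cdot> u = one \<Longrightarrow> norm (u \<cdot> x) = norm x"
  by (simp add: norm_eq_sqrt_inner inner_mul_left flip: mul_assoc)

lemma norm_mul_coisometry: "u \<cdot> adj u = one \<Longrightarrow> norm (x \<cdot> u) = norm x"
  by (simp add: norm_eq_sqrt_inner inner_mul_right mul_assoc)

text \<open>In finite dimension the injective left multiplication by \<open>u\<close> is onto, and a
  right inverse of \<open>u\<close> must equal its left inverse \<open>adj u\<close>.\<close>

lemma isometry_imp_coisometry:
  assumes "adj u \<cdot> u = one"
  shows "u \<cdot> adj u = one"
proof -
  have "inj (\<lambda>x. u \<cdot> x)"
    by (metis assms injI mul_assoc one_mul)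
  then have "surj (\<lambda>x. u \<cdot> x)"
    using linear_injective_imp_surjective bounded_linear.linear mul.bounded_linear_right by blast
  then obtain y where y: "u \<cdot> y = one" by (metis surjD)
  then have "y = adj u" by (metis assms mul_assoc mul_one one_mul)
  then show ?thesis using y by simp
qed

lemma bounded_linear_adj: "bounded_linear adj"
  using linear_adj linear_conv_bounded_linear by blast

section \<open>Spectral resolution of self-adjoint elements\<close>

lemma linear_mul_left: "linear (\<lambda>x. h \<cdot> x)"
  using bounded_linear.linear mul.bounded_linear_right by blast

text \<open>Left multiplication by a self-adjoint \<open>h\<close> is symmetric, so its eigenspaces
  are orthogonal. Pairing the vanishing sum of all differences with \<open>d m\<close> leaves only
  the square of its norm.\<close>

lemma spectral_unique:
  assumes h: "adj h = h" and fin: "finite \<Lambda>"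
    and q: "\<And>l. l \<in> \<Lambda> \<Longrightarrow> h \<cdot> q l = l *\<^sub>R q l" and r: "\<And>l. l \<in> \<Lambda> \<Longrightarrow> h \<cdot> r l = l *\<^sub>R r l"
    and eq: "(\<Sum>l\<in>\<Lambda>. q l) = (\<Sum>l\<in>\<Lambda>. r l)" and m: "m \<in> \<Lambda>"
  shows "q m = r m"
proof -
  define d where "d l = q l - r l" for l
  have d: "h \<cdot> d l = l *\<^sub>R d l" if "l \<in> \<Lambda>" for l
    using q r that by (simp add: d_def alg_simps scaleR_diff_right)
  have orth: "d m \<bullet> d l = 0" if "l \<in> \<Lambda>" "l \<noteq> m" for l
  proof -
    have "(h \<cdot> d m) \<bullet> d l = d m \<bullet> (h \<cdot> d l)" by (simp add: inner_mul_left h)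
    then show ?thesis using d m that by simp
  qed
  have "0 = d m \<bullet> (\<Sum>l\<in>\<Lambda>. d l)" using eq by (simp add: d_def sum_subtractf)
  also have "\<dots> = d m \<bullet> d m"
    unfolding inner_sum_right using fin m orth by (simp add: sum.remove[of _ m])
  finally show ?thesis by (simp add: d_def)
qed

text \<open>Commutation with the whole commutant of \<open>h\<close> stands for \<open>p l\<close>
  being a polynomial in \<open>h\<close>. Demanding \<open>p l \<noteq> 0\<close> makes every member
  of \<open>\<Lambda>\<close> a genuine eigenvalue, so that signs of eigenvalues can be read off
  from norms.\<close>

definition spectral_resolution :: "'a \<Rightarrow> real set \<Rightarrow> (real \<Rightarrow> 'a) \<Rightarrow> bool" where
  "spectral_resolution h \<Lambda> p \<longleftrightarrow> finite \<Lambda> \<and> (\<Sum>l\<in>\<Lambda>. p l) = one \<and>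
     (\<forall>l\<in>\<Lambda>. p l \<noteq> 0 \<and> h \<cdot> p l = l *\<^sub>R p l \<and> adj (p l) = p l \<and> p l \<cdot> p l = p l \<and>
       (\<forall>y. h \<cdot> y = y \<cdot> h \<longrightarrow> p l \<cdot> y = y \<cdot> p l) \<and> (\<forall>m\<in>\<Lambda>. l \<noteq> m \<longrightarrow> p l \<cdot> p m = 0))"

lemma spectral_resolutionD:
  assumes "spectral_resolution h \<Lambda> p" "l \<in> \<Lambda>"
  shows "p l \<noteq> 0" "h \<cdot> p l = l *\<^sub>R p l" "adj (p l) = p l" "p l \<cdot> p l = p l"
    "h \<cdot> y = y \<cdot> h \<Longrightarrow> p l \<cdot> y = y \<cdot> p l" "\<lbrakk>m \<in> \<Lambda>; l \<noteq> m\<rbrakk> \<Longrightarrow> p l \<cdot> p m = 0"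
  using assms unfolding spectral_resolution_def by blast+

lemma spectral_resolution_finite: "spectral_resolution h \<Lambda> p \<Longrightarrow> finite \<Lambda>"
  and spectral_resolution_sum: "spectral_resolution h \<Lambda> p \<Longrightarrow> (\<Sum>l\<in>\<Lambda>. p l) = one"
  unfolding spectral_resolution_def by blast+

text \<open>The spectral projections are the components of the unit in the eigenspaces of left
  multiplication by \<open>h\<close>; all their algebraic properties follow from uniqueness of components.\<close>

lemma spectral_resolution_exists:
  assumes h: "adj h = h"
  obtains \<Lambda> p where "spectral_resolution h \<Lambda> p"
proof -
  obtain B ev where B: "finite B" "pairwise orthogonal B" "span B = UNIV"
    "\<And>b. b \<in> B \<Longrightarrow> norm b = 1" "\<And>b. b \<in> B \<Longrightarrow> h \<cdot> b = ev b *\<^sub>R b"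
    using symmetric_eigenbasis[OF linear_mul_left, of h] h by (metis inner_mul_left)
  define \<Lambda> where "\<Lambda> = ev ` B"
  define p where "p l = (\<Sum>b | b \<in> B \<and> ev b = l. (b \<bullet> one) *\<^sub>R b)" for l
  have fin: "finite \<Lambda>" using B by (simp add: \<Lambda>_def)
  have hp: "h \<cdot> p l = l *\<^sub>R p l" for l
    using B by (auto simp: p_def mul.sum_right alg_simps scaleR_sum_right intro!: sum.cong)
  have sum1: "(\<Sum>l\<in>\<Lambda>. p l) = one"
  proof -
    have "(\<Sum>l\<in>\<Lambda>. p l) = (\<Sum>b\<in>B. (b \<bullet> one) *\<^sub>R b)"
      unfolding p_def \<Lambda>_def by (rule sum.image_gen[symmetric]) (fact B)
    then show ?thesis using orthonormal_expand[OF B(1-4)] by simp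
  qed
  \<comment> \<open>Since \<open>y\<close> commutes with \<open>h\<close>, both
    \<open>p l \<cdot> y\<close> and \<open>y \<cdot> p l\<close> are the component of
    \<open>y\<close> in the eigenspace of \<open>l\<close>.\<close>
  have comm: "p l \<cdot> y = y \<cdot> p l" if "l \<in> \<Lambda>" and y: "h \<cdot> y = y \<cdot> h" for l y
  proof (rule spectral_unique[OF h fin _ _ _ that(1), where q = "\<lambda>l. p l \<cdot> y" and r = "\<lambda>l. y \<cdot> p l"])
    show "h \<cdot> (p l \<cdot> y) = l *\<^sub>R (p l \<cdot> y)" for l
      using hp[of l] by (simp add: mul.scaleR_left flip: mul_assoc)
    show "h \<cdot> (y \<cdot> p l) = l *\<^sub>R (y \<cdot> p l)" for l
      using hp[of l] y by (metis mul_assoc mul.scaleR_right)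
    show "(\<Sum>l\<in>\<Lambda>. p l \<cdot> y) = (\<Sum>l\<in>\<Lambda>. y \<cdot> p l)"
      by (simp add: sum1 flip: mul.sum_left mul.sum_right)
  qed
  have hcomm: "h \<cdot> p l = p l \<cdot> h" if "l \<in> \<Lambda>" for l using comm[OF that, of h] by simp
  have adjp: "adj (p l) = p l" if "l \<in> \<Lambda>" for l
  proof (rule spectral_unique[OF h fin _ hp _ that])
    show "h \<cdot> adj (p l) = l *\<^sub>R adj (p l)" if "l \<in> \<Lambda>" for l
      using arg_cong[OF hcomm[OF that], of adj] by (simp add: hp h adj_mul adj.scale)
    show "(\<Sum>l\<in>\<Lambda>. adj (p l)) = sum p \<Lambda>" by (simp add: sum1 flip: adj.sum)
  qed
  have ortho: "p l \<cdot> p m = 0" if "l \<in> \<Lambda>" "m \<in> \<Lambda>" "l \<noteq> m" for l m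
  proof -
    have "l *\<^sub>R (p l \<cdot> p m) = h \<cdot> (p l \<cdot> p m)" using hp[of l] by (metis mul_assoc mul.scaleR_left)
    also have "\<dots> = p l \<cdot> (h \<cdot> p m)" using hcomm[OF that(1)] by (metis mul_assoc)
    also have "\<dots> = m *\<^sub>R (p l \<cdot> p m)" by (simp add: hp mul.scaleR_right)
    finally show ?thesis using that(3) by simp
  qed
  have idem: "p l \<cdot> p l = p l" if "l \<in> \<Lambda>" for l
  proof -
    have "p l = p l \<cdot> (\<Sum>m\<in>\<Lambda>. p m)" by (simp add: sum1)
    also have "\<dots> = p l \<cdot> p l"
      unfolding mul.sum_right using fin that ortho by (simp add: sum.remove[of _ l])
    finally show ?thesis by simp
  qed
  let ?\<Lambda> = "{l \<in> \<Lambda>. p l \<noteq> 0}"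
  have "(\<Sum>l\<in>?\<Lambda>. p l) = one"
    unfolding sum1[symmetric] by (rule sum.mono_neutral_left) (use fin in auto)
  moreover have "finite ?\<Lambda>" using fin by simp
  ultimately have "spectral_resolution h ?\<Lambda> p"
    unfolding spectral_resolution_def using hp comm adjp ortho idem
    by (intro conjI ballI allI impI) blast+
  then show ?thesis using that by blast
qed

lemma spectral_sum:
  assumes "spectral_resolution h \<Lambda> p"
  shows "(\<Sum>l\<in>\<Lambda>. l *\<^sub>R p l) = h"
proof -
  have "(\<Sum>l\<in>\<Lambda>. l *\<^sub>R p l) = h \<cdot> (\<Sum>l\<in>\<Lambda>. p l)"
    unfolding mul.sum_right using spectral_resolutionD(2)[OF assms] by (intro sum.cong) auto
  then show ?thesis using spectral_resolution_sum[OF assms] by simp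
qed

section \<open>Comparison of projections by partial isometries\<close>

definition projection :: "'a \<Rightarrow> bool" where
  "projection e \<longleftrightarrow> e \<cdot> e = e \<and> adj e = e"

text \<open>The trace functional is faithful on projections: trace zero forces the projection to
  vanish.\<close>

lemma projection_trace: "projection e \<Longrightarrow> one \<bullet> e = (norm e)\<^sup>2"
  using inner_eq_one_inner[of e e] by (simp add: projection_def power2_norm_eq_inner)

text \<open>Primeness gives a nonzero \<open>y\<close> with
  \<open>f2 \<cdot> y \<cdot> f1 = y\<close>. Instead of a full polar decomposition, one nonzero
  eigenvalue \<open>l\<close> of \<open>adj y \<cdot> y\<close> is enough: restricting
  \<open>y\<close> to its eigenspace and dividing by \<open>sqrt l\<close> gives a partial
  isometry.\<close>

lemma isometry_between_nonzero:
  assumes f1: "projection f1" "f1 \<noteq> 0" and f2: "projection f2" "f2 \<noteq> 0"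
  obtains w where "w \<noteq> 0" "w \<cdot> adj w \<cdot> w = w" "f2 \<cdot> w = w" "w \<cdot> f1 = w"
proof -
  obtain x where "f2 \<cdot> x \<cdot> f1 \<noteq> 0" using prime_algebra f1 f2 by blast
  define y where "y = f2 \<cdot> x \<cdot> f1"
  have y0: "y \<noteq> 0" using \<open>f2 \<cdot> x \<cdot> f1 \<noteq> 0\<close> by (simp add: y_def)
  have f1y: "y \<cdot> f1 = y" and f2y: "f2 \<cdot> y = y"
    using f1 f2 by (auto simp: y_def projection_def mul_assoc) (metis mul_assoc)
  define h where "h = adj y \<cdot> y"
  have hh: "adj h = h" by (simp add: h_def adj_mul)
  have h0: "h \<noteq> 0" using y0 inner_eq_one_inner[of y y] by (auto simp: h_def)
  obtain \<Lambda> p where sp: "spectral_resolution h \<Lambda> p" using spectral_resolution_exists[OF hh] .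
  have "\<exists>l\<in>\<Lambda>. l \<noteq> 0"
  proof (rule ccontr)
    assume "\<not> ?thesis"
    then have "(\<Sum>l\<in>\<Lambda>. l *\<^sub>R p l) = 0" by (intro sum.neutral) auto
    then show False using spectral_sum[OF sp] h0 by simp
  qed
  then obtain l where l: "l \<in> \<Lambda>" "l \<noteq> 0" by blast
  have p: "p l \<noteq> 0" "h \<cdot> p l = l *\<^sub>R p l" "adj (p l) = p l" "p l \<cdot> p l = p l" "p l \<cdot> h = h \<cdot> p l"
    using spectral_resolutionD[OF sp l(1)] by blast+
  have "l * (norm (p l))\<^sup>2 = p l \<bullet> (h \<cdot> p l)" by (simp add: p power2_norm_eq_inner)
  also have "\<dots> = (norm (y \<cdot> p l))\<^sup>2"
    by (simp add: h_def mul_assoc inner_mul_left power2_norm_eq_inner)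
  finally have "l * (norm (p l))\<^sup>2 \<ge> 0" by simp
  then have lpos: "l > 0" using p l by (simp add: zero_le_mult_iff)
  define w where "w = (1 / sqrt l) *\<^sub>R (y \<cdot> p l)"
  have "adj w \<cdot> w = (1 / l) *\<^sub>R (p l \<cdot> (h \<cdot> p l))"
    using lpos by (simp add: w_def h_def alg_simps p)
  also have "\<dots> = p l" using p(2,4) lpos by (simp add: mul.scaleR_right)
  finally have ww: "adj w \<cdot> w = p l" .
  have pf: "p l \<cdot> f1 = p l"
  proof -
    have "l *\<^sub>R (p l \<cdot> f1) = p l \<cdot> h \<cdot> f1" by (simp add: p mul.scaleR_left)
    also have "\<dots> = p l \<cdot> h" using f1y by (simp add: h_def mul_assoc)
    also have "\<dots> = l *\<^sub>R p l" by (simp add: p)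
    finally show ?thesis using l by simp
  qed
  have "w \<noteq> 0" using ww p(1) by (auto simp: adj.zero)
  moreover have "w \<cdot> adj w \<cdot> w = w" by (simp add: mul_assoc ww) (simp add: w_def alg_simps p)
  moreover have "f2 \<cdot> w = w"
    by (simp add: w_def mul.scaleR_right) (simp add: f2y flip: mul_assoc)
  moreover have "w \<cdot> f1 = w" by (simp add: w_def alg_simps pf)
  ultimately show ?thesis using that by blast
qed

text \<open>The projection \<open>adj z \<cdot> z\<close> lies below \<open>e\<close>, so its trace
  is its inner product with \<open>e\<close>. The bound makes the candidates in the next lemma a
  compact set.\<close>

lemma norm_partial_isometry:
  assumes z: "z \<cdot> adj z \<cdot> z = z" and e: "projection e" "z \<cdot> e = z"
  shows "norm z \<le> norm e"
proof -
  define f where "f = adj z \<cdot> z"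
  have ff: "f \<cdot> f = f" using z by (simp add: f_def mul_assoc)
  have adjf: "adj f = f" by (simp add: f_def adj_mul)
  have nz: "(norm z)\<^sup>2 = (norm f)\<^sup>2"
    using inner_eq_one_inner[of z z] projection_trace[of f] ff adjf
    by (simp add: f_def projection_def power2_norm_eq_inner)
  have "f \<bullet> e = one \<bullet> (f \<cdot> e)" using inner_eq_one_inner[of f e] adjf by simp
  also have "\<dots> = one \<bullet> f" using e by (simp add: f_def mul_assoc)
  also have "\<dots> = (norm f)\<^sup>2" using projection_trace[of f] ff adjf by (simp add: projection_def)
  finally have "(norm f)\<^sup>2 \<le> norm f * norm e" using norm_cauchy_schwarz[of f e] by simp
  then have "norm f \<le> norm e" by (cases "f = 0") (auto simp: power2_eq_square)
  then show ?thesis using nz by simp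
qed

text \<open>Among the partial isometries from below \<open>e1\<close> to below \<open>e2\<close> one
  of largest norm exists by compactness. If both defects \<open>f1\<close> and \<open>f2\<close>
  were nonzero, a partial isometry between them could be added; it is orthogonal to \<open>z\<close>
  and would increase the norm.\<close>

lemma partial_isometry_exists:
  assumes e1: "projection e1" and e2: "projection e2" and tr: "one \<bullet> e1 = one \<bullet> e2"
  obtains z where "adj z \<cdot> z = e1" "z \<cdot> adj z = e2" "z \<cdot> e1 = z" "e2 \<cdot> z = z"
proof -
  define K where "K = {z. z \<cdot> adj z \<cdot> z = z \<and> e2 \<cdot> z = z \<and> z \<cdot> e1 = z}"
  have "K \<subseteq> cball 0 (norm e1)" using norm_partial_isometry e1 by (auto simp: K_def)
  then have "bounded K" by (meson bounded_cball bounded_subset)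
  moreover have "closed K"
    unfolding K_def
    by (intro closed_Collect_conj closed_Collect_eq mul.continuous_on continuous_intros
        linear_continuous_on bounded_linear_adj)
  ultimately have "compact K" by (simp add: compact_eq_bounded_closed)
  moreover have "0 \<in> K" by (simp add: K_def)
  ultimately obtain z where z: "z \<in> K" and max: "\<And>y. y \<in> K \<Longrightarrow> norm y \<le> norm z"
    using continuous_attains_sup[of K norm] continuous_on_norm_id by blast
  define f1 where "f1 = e1 - adj z \<cdot> z"
  define f2 where "f2 = e2 - z \<cdot> adj z"
  have zz: "z \<cdot> (adj z \<cdot> z) = z" "e2 \<cdot> z = z" "z \<cdot> e1 = z" using z by (auto simp: K_def mul_assoc)
  have zz': "adj z \<cdot> (z \<cdot> adj z) = adj z" "adj z \<cdot> e2 = adj z" "e1 \<cdot> adj z = adj z"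
    using zz(1,2,3)[THEN arg_cong[of _ _ adj]] e1 e2 by (auto simp: adj_mul mul_assoc projection_def)
  have zz'': "z \<cdot> (adj z \<cdot> (z \<cdot> x)) = z \<cdot> x" "e2 \<cdot> (z \<cdot> x) = z \<cdot> x" "z \<cdot> (e1 \<cdot> x) = z \<cdot> x"
     "adj z \<cdot> (z \<cdot> (adj z \<cdot> x)) = adj z \<cdot> x" "adj z \<cdot> (e2 \<cdot> x) = adj z \<cdot> x" "e1 \<cdot> (adj z \<cdot> x) = adj z \<cdot> x" for x
    using zz zz' by (metis mul_assoc)+
  have p1: "projection f1" and p2: "projection f2"
    using e1 e2 by (auto simp: f1_def f2_def projection_def alg_simps zz zz' zz'')
  have trf: "one \<bullet> f1 = one \<bullet> f2"
    using tr one_inner_commute[of z "adj z"] by (simp add: f1_def f2_def inner_diff_right)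
  have "f1 = 0 \<or> f2 = 0"
  proof (rule ccontr)
    assume "\<not> (f1 = 0 \<or> f2 = 0)"
    then obtain w where w: "w \<noteq> 0" "w \<cdot> adj w \<cdot> w = w" "f2 \<cdot> w = w" "w \<cdot> f1 = w"
      using isometry_between_nonzero p1 p2 by metis
    have w1: "f1 \<cdot> adj w = adj w" using arg_cong[OF w(4), of adj] p1 by (simp add: adj_mul projection_def)
    have zf: "z \<cdot> f1 = 0" "adj z \<cdot> f2 = 0" by (auto simp: f1_def f2_def alg_simps zz zz')
    have zw: "z \<cdot> adj w = 0" using w1 zf by (metis mul_assoc mul.zero_left)
    have zw': "adj z \<cdot> w = 0" using w zf by (metis mul_assoc mul.zero_left)
    have wz: "w \<cdot> adj z = 0" using arg_cong[OF zw, of adj] by (simp add: adj_mul adj.zero)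
    have wz': "adj w \<cdot> z = 0" using arg_cong[OF zw', of adj] by (simp add: adj_mul adj.zero)
    have zwx: "z \<cdot> (adj w \<cdot> x) = 0" "adj z \<cdot> (w \<cdot> x) = 0" "w \<cdot> (adj z \<cdot> x) = 0" for x
      using zw zw' wz by (metis mul_assoc mul.zero_left)+
    have e2w: "e2 \<cdot> w = w" using w(3) by (simp add: f2_def alg_simps zw')
    have we1: "w \<cdot> e1 = w" using w(4) by (simp add: f1_def alg_simps zwx)
    have ww: "w \<cdot> (adj w \<cdot> w) = w" using w by (simp add: mul_assoc)
    have "z + w \<in> K" by (simp add: K_def alg_simps zz ww zw zw' wz wz' zwx e2w we1)
    then have "norm (z + w) \<le> norm z" by (rule max)
    moreover have "(norm (z + w))\<^sup>2 = (norm z)\<^sup>2 + (norm w)\<^sup>2"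
      using inner_eq_one_inner[of z w] zw'
      by (simp add: power2_norm_eq_inner inner_add_left inner_add_right inner_commute)
    moreover have "(norm (z + w))\<^sup>2 \<le> (norm z)\<^sup>2" using \<open>norm (z + w) \<le> norm z\<close> by (simp add: power_mono)
    ultimately show False using w(1) by simp
  qed
  \<comment> \<open>The defects have equal traces because the traces of \<open>e1\<close> and
    \<open>e2\<close> agree, so they vanish together.\<close>
  then have "f1 = 0 \<and> f2 = 0" using projection_trace p1 p2 trf by auto
  then show ?thesis using that[of z] zz by (simp add: f1_def f2_def)
qed

end

section \<open>Exponentials of skew elements\<close>

context star_algebra
begin

lemmas has_vd_mul = mul.has_vector_derivative
lemmas has_vd_adj = bounded_linear.has_vector_derivative[OF bounded_linear_adj]

lemma has_vd_mul_left:
  "(f has_vector_derivative f') F \<Longrightarrow> ((\<lambda>t. a \<cdot> f t) has_vector_derivative a \<cdot> f') F"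
  by (rule bounded_linear.has_vector_derivative[OF mul.bounded_linear_right])

lemma has_vd_mul_right:
  "(f has_vector_derivative f') F \<Longrightarrow> ((\<lambda>t. f t \<cdot> a) has_vector_derivative f' \<cdot> a) F"
  by (rule bounded_linear.has_vector_derivative[OF mul.bounded_linear_left])

lemma has_vd_zero_eq:
  fixes f :: "real \<Rightarrow> 'a"
  assumes "\<And>t. (f has_vector_derivative 0) (at t)"
  shows "f s = f t"
proof -
  obtain c where "\<And>x. x \<in> UNIV \<Longrightarrow> f x = c"
    using has_vector_derivative_zero_constant[of UNIV f] assms by blast
  then show ?thesis by simp
qed

definition flow :: "'a \<Rightarrow> (real \<Rightarrow> 'a) \<Rightarrow> bool" where
  "flow w f \<longleftrightarrow> (\<forall>t. (f has_vector_derivative w \<cdot> f t) (at t))"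

text \<open>Skewness cancels the two terms of the product rule. With \<open>f = g\<close> this is
  unitarity of the flow, with two different solutions it is uniqueness.\<close>

lemma flow_adj_mul_constant:
  assumes w: "adj w = - w" and f: "flow w f" and g: "flow w g"
  shows "adj (f t) \<cdot> g t = adj (f 0) \<cdot> g 0"
proof (rule has_vd_zero_eq)
  fix t
  have "((\<lambda>t. adj (f t) \<cdot> g t) has_vector_derivative
      adj (f t) \<cdot> (w \<cdot> g t) + adj (w \<cdot> f t) \<cdot> g t) (at t)"
    using f g by (intro has_vd_mul has_vd_adj) (auto simp: flow_def)
  then show "((\<lambda>t. adj (f t) \<cdot> g t) has_vector_derivative 0) (at t)"
    by (simp add: alg_simps w)
qed

text \<open>The map t to exp (t w), characterised by its differential equation rather than by a
  power series. For skew \<open>w\<close> a solution is written down from the spectral resolution of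
  \<open>- (w \<cdot> w)\<close>.\<close>

definition expo :: "'a \<Rightarrow> real \<Rightarrow> 'a" where
  "expo w = (SOME f. f 0 = one \<and> flow w f)"

text \<open>On the eigenspace where \<open>w\<close> squares to minus \<open>(r l)\<^sup>2\<close>
  the exponential is Euler's formula, with \<open>w\<close> divided by \<open>r l\<close> in place
  of the imaginary unit.\<close>

lemma flow_spectral:
  assumes w: "adj w = - w" and fin: "finite \<Lambda>" and sum: "(\<Sum>l\<in>\<Lambda>. p l) = one"
    and r: "\<And>l. l \<in> \<Lambda> \<Longrightarrow> w \<cdot> (w \<cdot> p l) = - ((r l)\<^sup>2 *\<^sub>R p l)"
  defines "f \<equiv> \<lambda>t. \<Sum>l\<in>\<Lambda>. cos (t * r l) *\<^sub>R p l + (sin (t * r l) / r l) *\<^sub>R (w \<cdot> p l)"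
  shows "f 0 = one" "flow w f"
proof -
  show "f 0 = one" by (simp add: f_def sum)
  \<comment> \<open>At frequency zero the quotient by \<open>r l\<close> takes the value 0. This is
    harmless because \<open>w\<close> itself kills that component, which is constant along the
    flow.\<close>
  have wp: "w \<cdot> p l = 0" if "l \<in> \<Lambda>" "r l = 0" for l
  proof -
    have "(w \<cdot> p l) \<bullet> (w \<cdot> p l) = 0"
      using r[OF that(1)] that(2) by (simp add: inner_mul_left w mul.minus_left)
    then show ?thesis by simp
  qed
  have "(f has_vector_derivative (\<Sum>l\<in>\<Lambda>. (- sin (t * r l) * r l) *\<^sub>R p l
      + cos (t * r l) *\<^sub>R (w \<cdot> p l))) (at t)" for t
    unfolding f_def
  proof (intro has_vector_derivative_sum)
    fix l assume l: "l \<in> \<Lambda>"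
    show "((\<lambda>t. cos (t * r l) *\<^sub>R p l + (sin (t * r l) / r l) *\<^sub>R (w \<cdot> p l)) has_vector_derivative
        (- sin (t * r l) * r l) *\<^sub>R p l + cos (t * r l) *\<^sub>R (w \<cdot> p l)) (at t)"
      using wp[OF l] by (cases "r l = 0") (auto intro!: derivative_eq_intros)
  qed
  moreover have "(\<Sum>l\<in>\<Lambda>. (- sin (t * r l) * r l) *\<^sub>R p l + cos (t * r l) *\<^sub>R (w \<cdot> p l)) = w \<cdot> f t" for t
    unfolding f_def mul.sum_right
  proof (intro sum.cong refl)
    fix l assume l: "l \<in> \<Lambda>"
    show "(- sin (t * r l) * r l) *\<^sub>R p l + cos (t * r l) *\<^sub>R (w \<cdot> p l)
        = w \<cdot> (cos (t * r l) *\<^sub>R p l + (sin (t * r l) / r l) *\<^sub>R (w \<cdot> p l))"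
      by (simp add: mul.add_right mul.scaleR_right r[OF l] power2_eq_square)
  qed
  ultimately show "flow w f" by (simp add: flow_def)
qed

text \<open>By skewness \<open>- (w \<cdot> w)\<close> equals \<open>adj w \<cdot> w\<close>, so its
  eigenvalues are nonnegative and their square roots serve as frequencies.\<close>

lemma
  assumes w: "adj w = - w"
  shows expo_0 [simp]: "expo w 0 = one" and flow_expo: "flow w (expo w)"
proof -
  have h: "adj (- (w \<cdot> w)) = - (w \<cdot> w)" by (simp add: alg_simps w)
  obtain \<Lambda> p where sp: "spectral_resolution (- (w \<cdot> w)) \<Lambda> p" using spectral_resolution_exists[OF h] .
  have "w \<cdot> (w \<cdot> p l) = - ((sqrt l)\<^sup>2 *\<^sub>R p l)" if l: "l \<in> \<Lambda>" for l
  proof -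
    have "w \<cdot> (w \<cdot> p l) = - (- (w \<cdot> w) \<cdot> p l)" by (simp add: alg_simps)
    then have p: "w \<cdot> (w \<cdot> p l) = - (l *\<^sub>R p l)"
      by (simp only: spectral_resolutionD(2)[OF sp l])
    have "(norm (w \<cdot> p l))\<^sup>2 = l * (norm (p l))\<^sup>2"
      by (simp add: power2_norm_eq_inner inner_mul_left w mul.minus_left p)
    then have "0 \<le> l * (norm (p l))\<^sup>2" by (metis zero_le_power2)
    then have "l \<ge> 0" using spectral_resolutionD(1)[OF sp l] by (simp add: zero_le_mult_iff)
    then show ?thesis using p by simp
  qed
  note * = flow_spectral[OF w spectral_resolution_finite[OF sp] spectral_resolution_sum[OF sp], of sqrt, OF this]
  have "\<exists>f. f 0 = one \<and> flow w f" using *(1) *(2) by (intro exI conjI)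
  from someI_ex[OF this] show "expo w 0 = one" "flow w (expo w)" unfolding expo_def by blast+
qed

lemma expo_deriv: "adj w = - w \<Longrightarrow> (expo w has_vector_derivative w \<cdot> expo w t) (at t)"
  using flow_expo by (simp add: flow_def)

lemma adj_expo_mul_expo: "adj w = - w \<Longrightarrow> adj (expo w t) \<cdot> expo w t = one"
  using flow_adj_mul_constant[OF _ flow_expo flow_expo, of w t] by simp

lemma expo_mul_adj_expo: "adj w = - w \<Longrightarrow> expo w t \<cdot> adj (expo w t) = one"
  by (simp add: adj_expo_mul_expo isometry_imp_coisometry)

text \<open>Uniqueness for the linear equation: \<open>adj (expo w t) \<cdot> f t\<close> does not
  move. The algebraic rules for \<open>expo\<close> below come from applying this to a suitable
  curve.\<close>

lemma flow_eq_expo: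
  assumes w: "adj w = - w" and f: "flow w f"
  shows "f t = expo w t \<cdot> f 0"
proof -
  have "adj (expo w t) \<cdot> f t = f 0"
    using flow_adj_mul_constant[OF w flow_expo[OF w] f, of t] by (simp add: w)
  then have "expo w t \<cdot> f 0 = expo w t \<cdot> adj (expo w t) \<cdot> f t" by (simp add: mul_assoc)
  then show ?thesis using expo_mul_adj_expo[OF w, of t] by simp
qed

lemma expo_commute:
  assumes w: "adj w = - w"
  shows "expo w t \<cdot> w = w \<cdot> expo w t"
proof -
  have "flow w (\<lambda>t. w \<cdot> expo w t)"
    unfolding flow_def
    using has_vd_mul_left[OF expo_deriv[OF w]] by blast
  from flow_eq_expo[OF w this, of t] show ?thesis by (simp add: w)
qed

lemma expo_add:
  assumes w: "adj w = - w"
  shows "expo w (s + t) = expo w s \<cdot> expo w t"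
proof -
  have "flow w (\<lambda>s. expo w (s + t))"
    unfolding flow_def
  proof
    fix s
    have "((\<lambda>s. s + t) has_vector_derivative 1) (at s)"
      by (auto intro!: derivative_eq_intros)
    from vector_diff_chain_at[OF this expo_deriv[OF w]]
    show "((\<lambda>s. expo w (s + t)) has_vector_derivative w \<cdot> expo w (s + t)) (at s)"
      by (simp add: o_def)
  qed
  from flow_eq_expo[OF w this, of s] show ?thesis by (simp only: add_0)
qed

lemma expo_minus:
  assumes w: "adj w = - w"
  shows "expo w (- t) = adj (expo w t)"
proof -
  have "expo w (- t) = adj (expo w t) \<cdot> expo w t \<cdot> expo w (- t)"
    by (simp add: adj_expo_mul_expo[OF w])
  also have "\<dots> = adj (expo w t) \<cdot> expo w (t + - t)"
    by (simp only: expo_add[OF w] mul_assoc)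
  finally show ?thesis by (simp only: add.right_inverse expo_0[OF w] mul_one)
qed

lemma expo_scale_deriv:
  assumes w: "adj w = - w"
  shows "((\<lambda>t. expo w (a * t)) has_vector_derivative a *\<^sub>R (w \<cdot> expo w (a * t))) (at t)"
proof -
  have "((\<lambda>t. a * t) has_vector_derivative a) (at t)"
    using DERIV_cmult_Id[of a t] by (simp only: has_real_derivative_iff_has_vector_derivative)
  from vector_diff_chain_at[OF this expo_deriv[OF w]] show ?thesis by (simp add: o_def)
qed

lemma expo_scale:
  assumes w: "adj w = - w"
  shows "expo (a *\<^sub>R w) t = expo w (a * t)"
proof -
  have "flow (a *\<^sub>R w) (\<lambda>t. expo w (a * t))"
    using expo_scale_deriv[OF w] by (simp add: flow_def mul.scaleR_left)
  moreover have "adj (a *\<^sub>R w) = - (a *\<^sub>R w)" by (simp add: adj.scale w)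
  ultimately show ?thesis using flow_eq_expo[of "a *\<^sub>R w" "\<lambda>t. expo w (a * t)" t] by (simp add: w)
qed

text \<open>Conjugation by \<open>s\<close> reverses the sign of \<open>w\<close> and thus the
  direction of the flow. For a reflection it turns conjugation by \<open>expo w t\<close> into left
  multiplication by its square.\<close>

lemma expo_anticommute:
  assumes w: "adj w = - w" and s: "s \<cdot> s = one" "s \<cdot> w = - (w \<cdot> s)"
  shows "s \<cdot> expo w t \<cdot> s = adj (expo w t)"
proof -
  have "flow w (\<lambda>t. s \<cdot> expo w (- t) \<cdot> s)"
    unfolding flow_def
  proof
    fix t
    have "((\<lambda>t. s \<cdot> expo w (- 1 * t) \<cdot> s) has_vector_derivative
       s \<cdot> ((- 1) *\<^sub>R (w \<cdot> expo w (- 1 * t))) \<cdot> s) (at t)"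
      by (rule has_vd_mul_right[OF has_vd_mul_left[OF expo_scale_deriv[OF w]]])
    moreover have "s \<cdot> (w \<cdot> x) = - (w \<cdot> (s \<cdot> x))" for x
      using s(2) by (metis mul_assoc mul.minus_left)
    ultimately show "((\<lambda>t. s \<cdot> expo w (- t) \<cdot> s) has_vector_derivative
        w \<cdot> (s \<cdot> expo w (- t) \<cdot> s)) (at t)"
      by (simp add: alg_simps)
  qed
  from flow_eq_expo[OF w this, of "- t"] show ?thesis by (simp add: expo_minus[OF w] w s(1))
qed

lemma expo_spectral:
  assumes "adj w = - w" "finite \<Lambda>" "(\<Sum>l\<in>\<Lambda>. p l) = one"
    and "\<And>l. l \<in> \<Lambda> \<Longrightarrow> w \<cdot> (w \<cdot> p l) = - ((r l)\<^sup>2 *\<^sub>R p l)"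
  shows "expo w t = (\<Sum>l\<in>\<Lambda>. cos (t * r l) *\<^sub>R p l + (sin (t * r l) / r l) *\<^sub>R (w \<cdot> p l))"
  using flow_eq_expo[OF assms(1) flow_spectral(2)[of w \<Lambda> p r], OF assms, of t]
  by (simp add: assms(3))

end

section \<open>Geodesics of spaces of projections\<close>

text \<open>Differentiating \<open>L (c t)\<close> gives \<open>L (A (c t))\<close>, again a linear
  image of \<open>c\<close>; hence the induction over all \<open>L\<close> at once.\<close>

lemma Ck_on_linear_ode:
  fixes c :: "real \<Rightarrow> 'a::euclidean_space" and L :: "'a \<Rightarrow> 'b::euclidean_space"
  assumes c: "\<And>t. (c has_vector_derivative A (c t)) (at t)" and A: "bounded_linear A"
    and L: "bounded_linear L"
  shows "Ck_on k (\<lambda>t. L (c t)) U"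
  using L
proof (induction k arbitrary: L)
  case 0
  have "continuous_on UNIV c"
    using c has_vector_derivative_continuous by (meson continuous_at_imp_continuous_on)
  then have "continuous_on UNIV (\<lambda>t. L (c t))"
    using 0 bounded_linear.continuous_on by blast
  then show ?case using continuous_on_subset by auto
next
  case (Suc k)
  have "((\<lambda>t. L (c t)) has_derivative (\<lambda>v. v *\<^sub>R L (A (c t)))) (at t)" for t
    using bounded_linear.has_vector_derivative[OF Suc.prems c[of t]]
    by (simp add: has_vector_derivative_def)
  moreover have "Ck_on k (\<lambda>t. v *\<^sub>R L (A (c t))) U" for v
    using Suc.IH[of "\<lambda>x. v *\<^sub>R L (A x)"] Suc.prems A
      bounded_linear_compose[OF bounded_linear_scaleR_right[of v] bounded_linear_compose[OF Suc.prems A]]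
    by simp
  ultimately show ?case
    by (auto intro!: exI[of _ "\<lambda>t v. v *\<^sub>R L (A (c t))"])
qed

lemma smooth_on_linear_ode:
  fixes c :: "real \<Rightarrow> 'a::euclidean_space"
  assumes "\<And>t. (c has_vector_derivative A (c t)) (at t)" and "bounded_linear A"
  shows "smooth_on S c"
  unfolding smooth_on_def
  using Ck_on_linear_ode[OF assms bounded_linear_ident] by (intro ballI exI[of _ UNIV] exI[of _ c]) auto

lemma has_derivative_imp_has_vd:
  fixes f :: "real \<Rightarrow> 'a::real_normed_vector"
  assumes "(f has_derivative f') F"
  shows "(f has_vector_derivative f' 1) F"
proof -
  have "f' v = v *\<^sub>R f' 1" for v
    using linear_cmul[OF has_derivative_linear[OF assms], of v 1] by (simp only: real_scaleR_def mult_1_right)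
  then have "(\<lambda>v. v *\<^sub>R f' 1) = f'" by (intro ext) (rule sym)
  then show ?thesis unfolding has_vector_derivative_def by (simp only: assms)
qed

text \<open>\<open>smooth_on\<close> only provides smooth functions agreeing with \<open>c\<close>
  near each point. Two derivatives are transferred from them to \<open>c\<close> on an open
  neighbourhood.\<close>

lemma smooth_on_UNIV_derivatives:
  fixes c :: "real \<Rightarrow> 'a::euclidean_space"
  assumes "smooth_on UNIV c"
  obtains c1 c2 where "\<And>t. (c has_vector_derivative c1 t) (at t)"
    "\<And>t. (c1 has_vector_derivative c2 t) (at t)"
proof -
  have "\<exists>d e. (c has_vector_derivative d) (at t) \<and>
      ((\<lambda>s. vector_derivative c (at s)) has_vector_derivative e) (at t)" for t
  proof -
    obtain U g where U: "open U" "t \<in> U" and g: "\<And>k. Ck_on k g U" and gc: "\<And>y. y \<in> U \<Longrightarrow> g y = c y"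
      using assms[unfolded smooth_on_def, rule_format, of t] by auto
    have "Ck_on (Suc (Suc 0)) g U" by (rule g)
    then obtain g' where g': "\<And>x. x \<in> U \<Longrightarrow> (g has_derivative g' x) (at x)"
      and g1: "Ck_on (Suc 0) (\<lambda>x. g' x 1) U" by (metis Ck_on.simps(2))
    obtain h where h: "\<And>x. x \<in> U \<Longrightarrow> ((\<lambda>x. g' x 1) has_derivative h x) (at x)"
      using g1 by auto
    have vd: "(c has_vector_derivative g' x 1) (at x)" if "x \<in> U" for x
    proof -
      have "(g has_vector_derivative g' x 1) (at x)"
        using g'[OF that] has_derivative_imp_has_vd by blast
      then show ?thesis
        by (rule has_vector_derivative_transform_within_open[OF _ U(1) that gc])
    qed
    have "((\<lambda>x. g' x 1) has_vector_derivative h t 1) (at t)"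
      using h[OF U(2)] has_derivative_imp_has_vd by blast
    then have "((\<lambda>s. vector_derivative c (at s)) has_vector_derivative h t 1) (at t)"
      by (rule has_vector_derivative_transform_within_open[OF _ U])
        (simp add: vector_derivative_at[OF vd])
    then show ?thesis using vd[OF U(2)] by blast
  qed
  then have "(c has_vector_derivative vector_derivative c (at t)) (at t)"
    "((\<lambda>s. vector_derivative c (at s)) has_vector_derivative
       vector_derivative (\<lambda>s. vector_derivative c (at s)) (at t)) (at t)" for t
    using vector_derivative_works differentiableI_vector by blast+
  then show ?thesis by (rule that)
qed

text \<open>All that is used of a Grassmannian: it consists of projections, is stable under unitary
  conjugation, and has constant trace. The last clause replaces constancy of the rank.\<close>

locale projection_space = star_algebra +
  fixes M :: "'a set"
  assumes M_projection: "P \<in> M \<Longrightarrow> projection P"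
    and M_conj: "\<lbrakk>P \<in> M; adj u \<cdot> u = one\<rbrakk> \<Longrightarrow> u \<cdot> P \<cdot> adj u \<in> M"
    and M_trace: "\<lbrakk>P \<in> M; Q \<in> M\<rbrakk> \<Longrightarrow> one \<bullet> P = one \<bullet> Q"
begin

definition refl_of :: "'a \<Rightarrow> 'a" where
  "refl_of P = 2 *\<^sub>R P - one"

lemma proj_refl_of: "P = (1/2) *\<^sub>R (refl_of P + one)"
  by (simp add: refl_of_def)

lemma adj_refl_of: "P \<in> M \<Longrightarrow> adj (refl_of P) = refl_of P"
  using M_projection[of P] by (simp add: refl_of_def projection_def adj.diff adj.scale)

lemma refl_of_sq:
  assumes "P \<in> M"
  shows "refl_of P \<cdot> refl_of P = one"
proof -
  have "P \<cdot> P = P" using M_projection[OF assms] by (simp add: projection_def)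
  then show ?thesis
    by (simp add: refl_of_def mul.diff_left mul.diff_right mul.add_left mul.add_right scaleR_2)
qed

lemma refl_of_sq': "P \<in> M \<Longrightarrow> refl_of P \<cdot> (refl_of P \<cdot> x) = x"
  by (simp add: refl_of_sq flip: mul_assoc)

lemma refl_of_conj:
  assumes "adj u \<cdot> u = one"
  shows "refl_of (u \<cdot> P \<cdot> adj u) = u \<cdot> refl_of P \<cdot> adj u"
  by (simp add: refl_of_def mul.diff_left mul.diff_right mul.scaleR_left mul.scaleR_right
      isometry_imp_coisometry[OF assms])

text \<open>Self-adjoint elements that are off-diagonal in the block decomposition given by
  \<open>P\<close>. Right multiplication by \<open>refl_of P\<close> maps them isometrically to skew
  elements anticommuting with \<open>refl_of P\<close>.\<close>

definition tspace :: "'a \<Rightarrow> 'a set" where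
  "tspace P = {v. adj v = v \<and> v \<cdot> refl_of P = - (refl_of P \<cdot> v)}"

lemma subspace_tspace: "subspace (tspace P)"
  by (auto simp: subspace_def tspace_def alg_simps adj.zero)

lemma skew_tspace: "\<lbrakk>P \<in> M; v \<in> tspace P\<rbrakk> \<Longrightarrow> adj (v \<cdot> refl_of P) = - (v \<cdot> refl_of P)"
  by (simp add: tspace_def adj_mul adj_refl_of adj.neg)

lemma norm_tspace: "P \<in> M \<Longrightarrow> norm (v \<cdot> refl_of P) = norm v"
  by (simp add: norm_mul_coisometry adj_refl_of refl_of_sq)

text \<open>The generator is \<open>v \<cdot> refl_of P\<close> because its commutator with
  \<open>P\<close> is \<open>v\<close>, which gives the initial velocity.\<close>

definition geo :: "'a \<Rightarrow> 'a \<Rightarrow> real \<Rightarrow> 'a" where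
  "geo P v t = expo (v \<cdot> refl_of P) t \<cdot> P \<cdot> adj (expo (v \<cdot> refl_of P) t)"

lemma geo_in_M: "\<lbrakk>P \<in> M; v \<in> tspace P\<rbrakk> \<Longrightarrow> geo P v t \<in> M"
  by (simp add: geo_def M_conj adj_expo_mul_expo skew_tspace)

lemma geo_0: "\<lbrakk>P \<in> M; v \<in> tspace P\<rbrakk> \<Longrightarrow> geo P v 0 = P"
  by (simp add: geo_def skew_tspace)

lemma geo_deriv:
  assumes "P \<in> M" "v \<in> tspace P"
  shows "(geo P v has_vector_derivative
    (v \<cdot> refl_of P) \<cdot> geo P v t - geo P v t \<cdot> (v \<cdot> refl_of P)) (at t)"
proof -
  let ?w = "v \<cdot> refl_of P"
  have w: "adj ?w = - ?w" using assms by (rule skew_tspace)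
  have E: "(expo ?w has_vector_derivative ?w \<cdot> expo ?w t) (at t)" by (rule expo_deriv[OF w])
  have "(geo P v has_vector_derivative expo ?w t \<cdot> P \<cdot> adj (?w \<cdot> expo ?w t)
      + (?w \<cdot> expo ?w t) \<cdot> P \<cdot> adj (expo ?w t)) (at t)"
    unfolding geo_def
    by (rule has_vd_mul[OF has_vd_mul_right[OF E] has_vd_adj[OF E]])
  moreover have "adj (?w \<cdot> expo ?w t) = - (adj (expo ?w t) \<cdot> ?w)"
    by (simp only: adj_mul[of ?w "expo ?w t"] w mul.minus_right)
  ultimately show ?thesis by (simp add: geo_def mul_assoc mul.minus_right)
qed

lemma commutator_refl:
  "x \<cdot> P - P \<cdot> x = (1/2) *\<^sub>R (x \<cdot> refl_of P - refl_of P \<cdot> x)"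
  by (simp add: refl_of_def alg_simps flip: scaleR_diff_right)

lemma half_diff_anti:
  assumes "a = - b"
  shows "(1/2) *\<^sub>R (a - b) = (a :: 'a)"
proof -
  have "a - b = 2 *\<^sub>R a" using assms by (simp add: scaleR_2)
  then show ?thesis by simp
qed

lemma tspace_commutator:
  assumes "P \<in> M" "v \<in> tspace P"
  shows "(v \<cdot> refl_of P) \<cdot> P - P \<cdot> (v \<cdot> refl_of P) = v"
proof -
  have "refl_of P \<cdot> v \<cdot> refl_of P = - (v \<cdot> refl_of P \<cdot> refl_of P)"
    using assms(2) by (simp add: tspace_def mul.minus_left)
  then show ?thesis
    unfolding commutator_refl[of "v \<cdot> refl_of P" P]
    by (simp add: mul_assoc refl_of_sq[OF assms(1)] flip: scaleR_2)
qed

lemma smooth_geo: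
  assumes "P \<in> M" "v \<in> tspace P"
  shows "smooth_on S (geo P v)"
  by (rule smooth_on_linear_ode[OF geo_deriv[OF assms]])
    (intro bounded_linear_sub mul.bounded_linear_left mul.bounded_linear_right)

text \<open>Differentiating \<open>c s \<cdot> c s = c s\<close> says that \<open>v\<close> is
  off-diagonal with respect to \<open>c t\<close>; in terms of the reflection this is
  anticommutation.\<close>

lemma velocity_in_tspace:
  assumes c: "(c has_vector_derivative v) (at t)" and U: "open U" "t \<in> U"
    and cM: "\<And>s. s \<in> U \<Longrightarrow> c s \<in> M"
  shows "v \<in> tspace (c t)"
proof -
  have "((\<lambda>s. adj (c s)) has_vector_derivative adj v) (at t)" by (rule has_vd_adj[OF c])
  then have "(c has_vector_derivative adj v) (at t)"
    by (rule has_vector_derivative_transform_within_open[OF _ U])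
      (use cM M_projection in \<open>simp add: projection_def\<close>)
  then have 1: "adj v = v" using c vector_derivative_unique_at by blast
  have "((\<lambda>s. c s \<cdot> c s) has_vector_derivative c t \<cdot> v + v \<cdot> c t) (at t)" by (rule has_vd_mul[OF c c])
  then have "(c has_vector_derivative c t \<cdot> v + v \<cdot> c t) (at t)"
    by (rule has_vector_derivative_transform_within_open[OF _ U])
      (use cM M_projection in \<open>simp add: projection_def\<close>)
  then have 2: "c t \<cdot> v + v \<cdot> c t = v" using c vector_derivative_unique_at by blast
  have "v \<cdot> refl_of (c t) + refl_of (c t) \<cdot> v = 2 *\<^sub>R (c t \<cdot> v + v \<cdot> c t) - 2 *\<^sub>R v"
    by (simp add: refl_of_def alg_simps scaleR_2 scaleR_right_distrib)
  then have "v \<cdot> refl_of (c t) + refl_of (c t) \<cdot> v = 0" by (simp add: 2)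
  then show ?thesis using 1 by (simp add: tspace_def eq_neg_iff_add_eq_0)
qed

lemma tangent_space_eq:
  assumes P: "P \<in> M"
  shows "tangent_space M P = tspace P"
proof
  show "tangent_space M P \<subseteq> tspace P"
  proof
    fix v assume "v \<in> tangent_space M P"
    then obtain e c where e: "e > 0" and c: "c ` {-e<..<e} \<subseteq> M" "c 0 = P" "(c has_vector_derivative v) (at 0)"
      unfolding tangent_space_def by blast
    have "v \<in> tspace (c 0)"
    proof (rule velocity_in_tspace[OF c(3)])
      show "open {-e<..<e}" "0 \<in> {-e<..<e}" using e by auto
      show "c s \<in> M" if "s \<in> {-e<..<e}" for s using c(1) that by blast
    qed
    then show "v \<in> tspace P" by (simp only: c(2))
  qed
  show "tspace P \<subseteq> tangent_space M P"
  proof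
    fix v assume v: "v \<in> tspace P"
    have "(geo P v has_vector_derivative v) (at 0)"
      using geo_deriv[OF P v, of 0] by (simp only: geo_0[OF P v] tspace_commutator[OF P v])
    moreover have "geo P v ` {-1<..<1} \<subseteq> M" using geo_in_M[OF P v] by blast
    moreover have "smooth_on {-1<..<1} (geo P v)" by (rule smooth_geo[OF P v])
    moreover have "geo P v 0 = P" by (rule geo_0[OF P v])
    moreover have "(0::real) < 1" by simp
    ultimately show "v \<in> tangent_space M P" unfolding tangent_space_def by blast
  qed
qed

text \<open>Since \<open>tangential\<close> is a definite description, the orthogonal decomposition
  has to be shown to exist and to be unique before anything can be said about its value.\<close>

lemma tangential_eq_0_iff:
  assumes P: "P \<in> M"
  shows "tangential M P x = 0 \<longleftrightarrow> (\<forall>z\<in>tspace P. x \<bullet> z = 0)"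
proof -
  have S: "subspace (tspace P)" by (rule subspace_tspace)
  then have sp: "span (tspace P) = tspace P" by (rule span_eq_iff[THEN iffD2])
  obtain y z where yz: "y \<in> tspace P" "\<And>w. w \<in> tspace P \<Longrightarrow> orthogonal z w" "x = y + z"
    using orthogonal_subspace_decomp_exists[of "tspace P" x] unfolding sp by blast
  have y: "y \<in> tspace P" "\<forall>w\<in>tspace P. orthogonal (x - y) w"
    using yz(1,2) unfolding yz(3) by simp_all
  have uniq: "y' = y" if y': "y' \<in> tspace P" "\<forall>z\<in>tspace P. orthogonal (x - y') z" for y'
  proof -
    have d: "y - y' \<in> tspace P" using S y(1) y'(1) by (rule subspace_diff)
    have "(x - y') \<bullet> (y - y') = 0" "(x - y) \<bullet> (y - y') = 0"
      using d y(2) y'(2) unfolding orthogonal_def by blast+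
    then have "(y - y') \<bullet> (y - y') = 0" by (simp add: inner_diff_left)
    then show ?thesis by simp
  qed
  have t: "tangential M P x = y"
    unfolding tangential_def tangent_space_eq[OF P] by (rule the_equality) (use y uniq in blast)+
  show ?thesis
  proof
    assume "tangential M P x = 0"
    then show "\<forall>z\<in>tspace P. x \<bullet> z = 0" using t y(2) by (simp add: orthogonal_def)
  next
    assume "\<forall>z\<in>tspace P. x \<bullet> z = 0"
    then have "0 = y" using uniq[of 0] subspace_0[OF S] by (simp add: orthogonal_def)
    then show "tangential M P x = 0" using t by simp
  qed
qed

section \<open>Normal vectors and the geodesic equation\<close>

lemma inner_refl_conj:
  assumes "P \<in> M"
  shows "(refl_of P \<cdot> x \<cdot> refl_of P) \<bullet> y = x \<bullet> (refl_of P \<cdot> y \<cdot> refl_of P)"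
  unfolding inner_mul_right[of "refl_of P \<cdot> x"] inner_mul_left[of "refl_of P" x]
  by (simp add: adj_refl_of[OF assms] mul_assoc)

text \<open>Conjugation by the reflection is a symmetric involution on the self-adjoint elements.
  Its -1 eigenspace is the tangent space, its +1 eigenspace the commutant of the reflection, so each
  is the orthogonal complement of the other.\<close>

lemma normal_iff_commutes:
  assumes P: "P \<in> M" and x: "adj x = x"
  shows "(\<forall>z\<in>tspace P. x \<bullet> z = 0) \<longleftrightarrow> x \<cdot> refl_of P = refl_of P \<cdot> x"
proof
  let ?R = "refl_of P"
  have Rx: "?R \<cdot> x = x \<cdot> ?R" if "?R \<cdot> x \<cdot> ?R = x" for x
    using refl_of_sq[OF P] that by (metis mul_assoc mul_one)
  {
    assume n: "\<forall>z\<in>tspace P. x \<bullet> z = 0"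
    \<comment> \<open>Twice the tangential part of \<open>x\<close>.\<close>
    let ?z = "x - ?R \<cdot> x \<cdot> ?R"
    have z: "?z \<in> tspace P"
      by (simp add: tspace_def alg_simps x adj_refl_of[OF P] refl_of_sq[OF P] refl_of_sq'[OF P])
    have RzR: "?R \<cdot> ?z \<cdot> ?R = - ?z"
      by (simp add: alg_simps refl_of_sq[OF P] refl_of_sq'[OF P])
    have "x \<bullet> ?z = 0" using n z by blast
    moreover have "(?R \<cdot> x \<cdot> ?R) \<bullet> ?z = - (x \<bullet> ?z)"
      by (simp only: inner_refl_conj[OF P] RzR inner_minus_right)
    ultimately have "?z \<bullet> ?z = 0" by (simp add: inner_diff_left)
    then show "x \<cdot> ?R = ?R \<cdot> x" using Rx[of x] by simp
  }
  {
    assume c: "x \<cdot> ?R = ?R \<cdot> x"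
    show "\<forall>z\<in>tspace P. x \<bullet> z = 0"
    proof
      fix z assume z: "z \<in> tspace P"
      have "?R \<cdot> x \<cdot> ?R = x" using c refl_of_sq[OF P] by (metis mul_assoc mul_one)
      moreover have "?R \<cdot> z \<cdot> ?R = - z"
        using z by (simp add: tspace_def mul_assoc mul.minus_right refl_of_sq'[OF P])
      ultimately have "x \<bullet> z = - (x \<bullet> z)" using inner_refl_conj[OF P, of x z] by simp
      then show "x \<bullet> z = 0" by simp
    qed
  }
qed

text \<open>The generator commutes with its own exponential, so anticommutation with the reflection
  is carried along: the same \<open>w\<close> generates the geodesic from each of its
  points.\<close>

lemma expo_tspace_commute:
  assumes P: "P \<in> M" and v: "v \<in> tspace P"
  defines "w \<equiv> v \<cdot> refl_of P"
  shows "w \<cdot> refl_of (geo P v t) = - (refl_of (geo P v t) \<cdot> w)"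
proof -
  have w: "adj w = - w" unfolding w_def using P v by (rule skew_tspace)
  have R: "refl_of (geo P v t) = expo w t \<cdot> refl_of P \<cdot> adj (expo w t)"
    unfolding geo_def w_def[symmetric] by (rule refl_of_conj[OF adj_expo_mul_expo[OF w]])
  have c: "w \<cdot> expo w t = expo w t \<cdot> w" by (simp add: expo_commute[OF w])
  have c': "adj (expo w t) \<cdot> w = w \<cdot> adj (expo w t)"
    using expo_commute[OF w, of "- t"] by (simp only: expo_minus[OF w])
  have a: "w \<cdot> refl_of P = - (refl_of P \<cdot> w)"
    using v refl_of_sq[OF P] by (simp add: w_def tspace_def mul_assoc mul.minus_left mul.minus_right refl_of_sq'[OF P])
  have "w \<cdot> refl_of (geo P v t) = w \<cdot> expo w t \<cdot> refl_of P \<cdot> adj (expo w t)" by (simp only: R mul_assoc)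
  also have "\<dots> = expo w t \<cdot> (w \<cdot> refl_of P) \<cdot> adj (expo w t)" by (simp only: c mul_assoc)
  also have "\<dots> = - (expo w t \<cdot> refl_of P \<cdot> (adj (expo w t) \<cdot> w))"
    by (simp only: a c' mul_assoc mul.minus_left mul.minus_right)
  also have "\<dots> = - (refl_of (geo P v t) \<cdot> w)" by (simp only: R mul_assoc)
  finally show ?thesis .
qed

text \<open>The acceleration is the double commutator of \<open>w\<close> with \<open>c t\<close>,
  which anticommutation reduces to \<open>2 *\<^sub>R (w \<cdot> (w \<cdot> refl_of (c t)))\<close>.
  This commutes with the reflection because \<open>w\<close> passes it twice, so it is
  normal.\<close>

lemma geodesic_geo:
  assumes P: "P \<in> M" and v: "v \<in> tspace P"
  shows "geodesic M (geo P v)"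
proof -
  define w where "w = v \<cdot> refl_of P"
  define c where "c = geo P v"
  have cM: "c t \<in> M" for t using geo_in_M[OF P v] by (simp add: c_def)
  have w: "adj w = - w" unfolding w_def using P v by (rule skew_tspace)
  have d: "(c has_vector_derivative w \<cdot> c t - c t \<cdot> w) (at t)" for t
    using geo_deriv[OF P v] by (simp add: c_def w_def)
  define d1 where "d1 t = w \<cdot> c t - c t \<cdot> w" for t
  have d2: "(d1 has_vector_derivative w \<cdot> d1 t - d1 t \<cdot> w) (at t)" for t
    unfolding d1_def
    by (intro has_vector_derivative_diff has_vd_mul_left has_vd_mul_right d)
  have v1: "vector_derivative c (at t) = d1 t" for t
    using vector_derivative_at[OF d] by (simp add: d1_def)
  have "tangential M (c t) (w \<cdot> d1 t - d1 t \<cdot> w) = 0" for t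
  proof -
    let ?R = "refl_of (c t)"
    have a: "w \<cdot> ?R = - (?R \<cdot> w)" using expo_tspace_commute[OF P v] by (simp add: w_def c_def)
    have "d1 t = w \<cdot> ?R" unfolding d1_def commutator_refl[of w "c t"] by (rule half_diff_anti[OF a])
    moreover have a': "?R \<cdot> w = - (w \<cdot> ?R)" by (simp add: a)
    ultimately have x: "w \<cdot> d1 t - d1 t \<cdot> w = 2 *\<^sub>R (w \<cdot> (w \<cdot> ?R))"
      by (simp add: mul_assoc scaleR_2 mul.minus_right)
    have a'': "?R \<cdot> (w \<cdot> x) = - (w \<cdot> (?R \<cdot> x))" for x by (metis a' mul_assoc mul.minus_left)
    have "(\<forall>z\<in>tspace (c t). (2 *\<^sub>R (w \<cdot> (w \<cdot> ?R))) \<bullet> z = 0)"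
      by (subst normal_iff_commutes[OF cM])
        (simp_all add: alg_simps w adj_refl_of[OF cM] a' a'' refl_of_sq[OF cM])
    then show ?thesis unfolding x tangential_eq_0_iff[OF cM] .
  qed
  then show ?thesis
    unfolding geodesic_def using smooth_geo[OF P v] cM
    by (auto simp: c_def[symmetric] v1 vector_derivative_at[OF d2])
qed

text \<open>Along a geodesic \<open>c\<close> the commutator of \<open>c'\<close> and \<open>c\<close> is constant, because \<open>c''\<close> is normal
  and hence commutes with \<open>c\<close>. So \<open>c\<close> solves a linear differential equation.\<close>

lemma geodesic_unique:
  assumes P: "P \<in> M" and v: "v \<in> tspace P"
    and g: "geodesic M c" and c0: "c 0 = P" and cv: "(c has_vector_derivative v) (at 0)"
  shows "c t = geo P v t"
proof -
  obtain c1 c2 where c1: "\<And>t. (c has_vector_derivative c1 t) (at t)"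
    and c2: "\<And>t. (c1 has_vector_derivative c2 t) (at t)"
    using g smooth_on_UNIV_derivatives[of c] by (auto simp: geodesic_def)
  have cM: "c t \<in> M" for t using g by (auto simp: geodesic_def)
  have "vector_derivative c (at t) = c1 t" for t using vector_derivative_at[OF c1] .
  then have tan: "tangential M (c t) (c2 t) = 0" for t
    using g vector_derivative_at[OF c2] by (simp add: geodesic_def)
  have t1: "c1 t \<in> tspace (c t)" for t
    by (rule velocity_in_tspace[OF c1 open_UNIV]) (auto simp: cM)
  have a1: "adj (c1 t) = c1 t" for t using t1 by (simp add: tspace_def)
  have "((\<lambda>t. adj (c1 t)) has_vector_derivative adj (c2 t)) (at t)" for t by (rule has_vd_adj[OF c2])
  then have a2: "adj (c2 t) = c2 t" for t
    unfolding a1 using c2 vector_derivative_unique_at by blast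
  have n: "c2 t \<cdot> refl_of (c t) = refl_of (c t) \<cdot> c2 t" for t
    using tan tangential_eq_0_iff[OF cM] normal_iff_commutes[OF cM a2] by blast
  define k where "k t = c1 t \<cdot> c t - c t \<cdot> c1 t" for t
  have "(k has_vector_derivative 0) (at t)" for t
  proof -
    have "(k has_vector_derivative (c1 t \<cdot> c1 t + c2 t \<cdot> c t) - (c t \<cdot> c2 t + c1 t \<cdot> c1 t)) (at t)"
      unfolding k_def by (intro has_vector_derivative_diff has_vd_mul c1 c2)
    moreover have "c2 t \<cdot> c t - c t \<cdot> c2 t = 0" unfolding commutator_refl[of "c2 t" "c t"] by (simp add: n)
    ultimately show ?thesis by (simp add: algebra_simps)
  qed
  then have k0: "k t = k 0" for t using has_vd_zero_eq by blast
  have c10: "c1 0 = v" using c1 cv vector_derivative_unique_at by blast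
  define w where "w = v \<cdot> refl_of P"
  have kR: "k t = c1 t \<cdot> refl_of (c t)" for t
    unfolding k_def commutator_refl[of "c1 t" "c t"] using t1[of t]
    by (intro half_diff_anti) (simp add: tspace_def)
  have w: "adj w = - w" unfolding w_def using P v by (rule skew_tspace)
  have kw: "c1 t \<cdot> refl_of (c t) = w" for t using k0[of t] unfolding kR by (simp add: c0 c10 w_def)
  have cw: "w \<cdot> c t - c t \<cdot> w = c1 t" for t
    using tspace_commutator[OF cM t1, of t] by (simp add: kw)
  define E where "E = expo w"
  have dE: "(E has_vector_derivative w \<cdot> E t) (at t)" for t by (simp add: E_def expo_deriv[OF w])
  \<comment> \<open>In the frame rotating with \<open>E\<close>, the equation
    \<open>c' = w c - c w\<close> becomes constancy.\<close>
  have "((\<lambda>t. adj (E t) \<cdot> c t \<cdot> E t) has_vector_derivative 0) (at t)" for t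
  proof -
    have "((\<lambda>t. adj (E t) \<cdot> c t \<cdot> E t) has_vector_derivative
       adj (E t) \<cdot> c t \<cdot> (w \<cdot> E t) + (adj (E t) \<cdot> c1 t + adj (w \<cdot> E t) \<cdot> c t) \<cdot> E t) (at t)"
      by (intro has_vd_mul has_vd_adj dE c1)
    moreover have "adj (E t) \<cdot> c t \<cdot> (w \<cdot> E t) + (adj (E t) \<cdot> c1 t + adj (w \<cdot> E t) \<cdot> c t) \<cdot> E t = 0"
      unfolding cw[symmetric] by (simp add: alg_simps w)
    ultimately show ?thesis by simp
  qed
  then have "adj (E t) \<cdot> c t \<cdot> E t = adj (E 0) \<cdot> c 0 \<cdot> E 0"
    by (rule has_vd_zero_eq)
  then have F: "adj (E t) \<cdot> c t \<cdot> E t = P" by (simp add: E_def expo_0[OF w] c0)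
  have EE: "E t \<cdot> adj (E t) = one" by (simp add: E_def expo_mul_adj_expo[OF w])
  have "E t \<cdot> (adj (E t) \<cdot> c t \<cdot> E t) \<cdot> adj (E t) = E t \<cdot> adj (E t) \<cdot> c t \<cdot> (E t \<cdot> adj (E t))"
    by (simp only: mul_assoc)
  then show ?thesis unfolding F EE by (simp add: geo_def E_def w_def)
qed

lemma riem_exp_eq:
  assumes P: "P \<in> M" and v: "v \<in> tspace P"
  shows "riem_exp M P v = geo P v 1"
  unfolding riem_exp_def
proof (rule the_equality)
  have "(geo P v has_vector_derivative v) (at 0)"
    using geo_deriv[OF P v, of 0] by (simp add: geo_0[OF P v] tspace_commutator[OF P v])
  then show "\<exists>c. geodesic M c \<and> c 0 = P \<and> (c has_vector_derivative v) (at 0) \<and> c 1 = geo P v 1"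
    using geodesic_geo[OF P v] geo_0[OF P v] by blast
next
  fix q assume "\<exists>c. geodesic M c \<and> c 0 = P \<and> (c has_vector_derivative v) (at 0) \<and> c 1 = q"
  then obtain c where "geodesic M c" "c 0 = P" "(c has_vector_derivative v) (at 0)" "c 1 = q" by blast
  then show "q = geo P v 1" using geodesic_unique[OF P v, of c 1] by simp
qed

end

section \<open>Length of curves\<close>

lemma riem_dist_le_speed:
  fixes g :: "real \<Rightarrow> 'a::euclidean_space"
  assumes d: "\<And>t. (g has_vector_derivative g' t) (at t)" and cont: "continuous_on UNIV g'"
    and gM: "\<And>t. g t \<in> M" and L: "\<And>t. norm (g' t) \<le> L"
  shows "riem_dist M (g 0) (g 1) \<le> L"
proof -
  have "g C1_differentiable_on {0..1}"
    unfolding C1_differentiable_on_def using d continuous_on_subset[OF cont subset_UNIV] by blast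
  then have v: "valid_path g" unfolding valid_path_def by (rule C1_differentiable_imp_piecewise)
  have vd: "vector_derivative g (at t within {0..1}) = g' t" if "t \<in> {0..1}" for t
    using vector_derivative_at_within_ivl[OF d] that by auto
  have cn: "continuous_on {0..1} (\<lambda>t. norm (g' t))"
    using cont by (intro continuous_on_norm) (rule continuous_on_subset, auto)
  define l where "l = integral {0..1} (\<lambda>t. norm (g' t))"
  have i: "((\<lambda>t. norm (g' t)) has_integral l) {0..1}"
    unfolding l_def using integrable_continuous_interval[OF cn] by (rule integrable_integral)
  have "((\<lambda>t. norm (vector_derivative g (at t within {0..1}))) has_integral l) {0..1}"
    by (rule has_integral_eq[OF _ i]) (simp add: vd)
  moreover have "((\<lambda>t::real. L) has_integral L) {0..1}" using has_integral_const_real[of L 0 1] by simp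
  then have "l \<le> L" using has_integral_le[OF i] L by blast
  moreover have "path_image g \<subseteq> M" using gM by (auto simp: path_image_def)
  ultimately have "l \<in> {l. \<exists>h. valid_path h \<and> path_image h \<subseteq> M \<and> pathstart h = g 0 \<and> pathfinish h = g 1 \<and>
           ((\<lambda>t. norm (vector_derivative h (at t within {0..1}))) has_integral l) {0..1}}" (is "l \<in> ?A")
    using v by (auto simp: pathstart_def pathfinish_def)
  \<comment> \<open>The infimum bounds its members only for a set bounded below; here 0
    serves.\<close>
  moreover have "bdd_below ?A"
    by (rule bdd_belowI[of _ 0]) (auto intro: has_integral_nonneg)
  ultimately have "Inf ?A \<le> l" by (rule cInf_lower)
  then show ?thesis using \<open>l \<le> L\<close> by (simp add: riem_dist_def)
qed

text \<open>The factor \<open>c < 1\<close> keeps the argument of the arc cosine inside its domain of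
  differentiability.\<close>

lemma arccos_inner_deriv_bound:
  fixes f :: "real \<Rightarrow> 'a::euclidean_space"
  assumes d: "(f has_vector_derivative f') (at t)" and f: "norm (f t) = 1" "f t \<bullet> f' = 0"
    and b: "norm b = 1" and c: "0 \<le> c" "c < 1"
  obtains e where "((\<lambda>s. arccos (c * (b \<bullet> f s))) has_vector_derivative e) (at t)" "\<bar>e\<bar> \<le> norm f'"
proof -
  define u where "u = b \<bullet> f t"
  have u1: "\<bar>u\<bar> \<le> 1" unfolding u_def using Cauchy_Schwarz_ineq2[of b "f t"] b f by simp
  have cu: "\<bar>c * u\<bar> < 1"
  proof -
    have "\<bar>c * u\<bar> = c * \<bar>u\<bar>" using c by (simp add: abs_mult)
    also have "\<dots> \<le> c * 1" using u1 c by (intro mult_left_mono) auto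
    finally show ?thesis using c by simp
  qed
  define s where "s = sqrt (1 - (c * u)\<^sup>2)"
  have "(c * u)\<^sup>2 < 1" using cu by (simp add: abs_square_less_1)
  then have s: "s > 0" "s\<^sup>2 = 1 - (c * u)\<^sup>2" by (auto simp: s_def)
  have "((\<lambda>s. c * (b \<bullet> f s)) has_vector_derivative c * (b \<bullet> f')) (at t)"
    by (rule bounded_linear.has_vector_derivative[OF _ d, of "\<lambda>x. c * (b \<bullet> x)"])
      (intro bounded_linear_const_mult bounded_linear_inner_right)
  then have du: "((\<lambda>s. c * (b \<bullet> f s)) has_real_derivative c * (b \<bullet> f')) (at t)"
    by (simp only: has_real_derivative_iff_has_vector_derivative)
  have "DERIV arccos (c * (b \<bullet> f t)) :> inverse (- s)"
    unfolding s_def u_def using cu by (intro DERIV_arccos) (auto simp: u_def abs_less_iff)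
  from DERIV_chain2[OF this du]
  have D: "((\<lambda>s. arccos (c * (b \<bullet> f s))) has_vector_derivative inverse (- s) * (c * (b \<bullet> f'))) (at t)"
    by (simp only: has_real_derivative_iff_has_vector_derivative)
  \<comment> \<open>As \<open>f'\<close> is orthogonal to \<open>f t\<close>, the vector
    \<open>b\<close> may be replaced by its component orthogonal to \<open>f t\<close>, whose
    squared norm is 1 - u^2. This is exactly what compensates the derivative of the arc
    cosine.\<close>
  have "b \<bullet> f' = (b - u *\<^sub>R f t) \<bullet> f'" using f by (simp add: inner_diff_left)
  then have "(b \<bullet> f')\<^sup>2 \<le> ((b - u *\<^sub>R f t) \<bullet> (b - u *\<^sub>R f t)) * (f' \<bullet> f')"
    by (simp only: Cauchy_Schwarz_ineq)
  also have "(b - u *\<^sub>R f t) \<bullet> (b - u *\<^sub>R f t) = 1 - u\<^sup>2"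
  proof -
    have "b \<bullet> b = 1" "f t \<bullet> f t = 1" using b f(1) by (simp_all add: dot_square_norm)
    then show ?thesis
      by (simp add: inner_diff_left inner_diff_right inner_commute[of "f t" b] u_def[symmetric] power2_eq_square)
  qed
  finally have bf: "(b \<bullet> f')\<^sup>2 \<le> (1 - u\<^sup>2) * (norm f')\<^sup>2" by (simp add: dot_square_norm)
  have c2: "c\<^sup>2 \<le> 1" using c by (simp add: power_le_one)
  have "(c * (b \<bullet> f'))\<^sup>2 \<le> c\<^sup>2 * ((1 - u\<^sup>2) * (norm f')\<^sup>2)"
    using bf by (simp add: power_mult_distrib mult_left_mono)
  also have "\<dots> = (c\<^sup>2 - (c * u)\<^sup>2) * (norm f')\<^sup>2" by (simp add: power_mult_distrib algebra_simps)
  also have "\<dots> \<le> s\<^sup>2 * (norm f')\<^sup>2" unfolding s(2) using c2 by (intro mult_right_mono) auto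
  finally have "(c * (b \<bullet> f'))\<^sup>2 \<le> (s * norm f')\<^sup>2" by (simp add: power_mult_distrib)
  then have "\<bar>c * (b \<bullet> f')\<bar> \<le> \<bar>s * norm f'\<bar>" by (simp only: abs_le_square_iff)
  then have "\<bar>c * (b \<bullet> f')\<bar> \<le> s * norm f'" using s by simp
  then have "\<bar>inverse (- s) * (c * (b \<bullet> f'))\<bar> \<le> norm f'"
    using s(1) by (simp add: abs_mult divide_simps mult.commute)
  then show ?thesis using that D by blast
qed

section \<open>Upper and lower bounds for the distance\<close>

context projection_space
begin

text \<open>With \<open>X\<close> written as half of a reflection plus the unit, the commutator is
  half of a difference of two elements of norm \<open>norm k\<close>. This yields the constant 1,
  where bounding the two products with \<open>X\<close> separately would give 2.\<close>

lemma norm_commutator_le: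
  assumes "X \<in> M"
  shows "norm (k \<cdot> X - X \<cdot> k) \<le> norm k"
proof -
  let ?R = "refl_of X"
  have "norm (k \<cdot> X - X \<cdot> k) = (1/2) * norm (k \<cdot> ?R - ?R \<cdot> k)"
    unfolding commutator_refl[of k X] by simp
  also have "\<dots> \<le> (1/2) * (norm (k \<cdot> ?R) + norm (?R \<cdot> k))"
    using norm_triangle_ineq4[of "k \<cdot> ?R" "?R \<cdot> k"] by simp
  also have "norm (k \<cdot> ?R) = norm k"
    by (rule norm_mul_coisometry) (simp add: adj_refl_of[OF assms] refl_of_sq[OF assms])
  also have "norm (?R \<cdot> k) = norm k"
    by (rule norm_isometry_mul) (simp add: adj_refl_of[OF assms] refl_of_sq[OF assms])
  finally show ?thesis by simp
qed

text \<open>This is where nonnegative curvature enters.\<close>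

lemma riem_dist_geo_le:
  assumes X: "X \<in> M" and u: "u \<in> tspace X" and v: "v \<in> tspace X"
  shows "riem_dist M (geo X u 1) (geo X v 1) \<le> norm (u - v)"
proof -
  define a where "a = u \<cdot> refl_of X"
  define b where "b = v \<cdot> refl_of X"
  have a: "adj a = - a" unfolding a_def using X u by (rule skew_tspace)
  have b: "adj b = - b" unfolding b_def using X v by (rule skew_tspace)
  \<comment> \<open>\<open>E\<close> runs backwards, so that \<open>U\<close> leads from exp a to
    exp b. Each exponential commutes with its generator, hence in the derivative of \<open>U\<close>
    the generators meet between the factors as \<open>b - a\<close>.\<close>
  define E where "E t = expo a (1 - t)" for t
  define F where "F = expo b"
  define U where "U t = F t \<cdot> E t" for t
  define U' where "U' t = F t \<cdot> (b - a) \<cdot> E t" for t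
  have dF: "(F has_vector_derivative b \<cdot> F t) (at t)" for t unfolding F_def by (rule expo_deriv[OF b])
  have dE: "(E has_vector_derivative - (a \<cdot> E t)) (at t)" for t
  proof -
    have "((\<lambda>s. 1 - s) has_vector_derivative - 1) (at t)"
      by (auto intro!: derivative_eq_intros)
    from vector_diff_chain_at[OF this expo_deriv[OF a]] show ?thesis by (simp add: o_def E_def[abs_def])
  qed
  have FF: "adj (F t) \<cdot> F t = one" for t by (simp add: F_def adj_expo_mul_expo[OF b])
  have EE: "adj (E t) \<cdot> E t = one" "E t \<cdot> adj (E t) = one" for t
    by (simp_all add: E_def adj_expo_mul_expo[OF a] expo_mul_adj_expo[OF a])
  have bF: "b \<cdot> F t = F t \<cdot> b" for t by (simp add: F_def expo_commute[OF b])
  have UU: "adj (U t) \<cdot> U t = one" for t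
  proof -
    have "adj (U t) \<cdot> U t = adj (E t) \<cdot> (adj (F t) \<cdot> F t) \<cdot> E t" by (simp only: U_def adj_mul mul_assoc)
    then show ?thesis by (simp add: FF EE)
  qed
  have dU: "(U has_vector_derivative U' t) (at t)" for t
  proof -
    have "(U has_vector_derivative F t \<cdot> - (a \<cdot> E t) + b \<cdot> F t \<cdot> E t) (at t)"
      unfolding U_def[abs_def] by (rule has_vd_mul[OF dF dE])
    moreover have "F t \<cdot> - (a \<cdot> E t) + b \<cdot> F t \<cdot> E t = U' t"
      by (simp only: bF U'_def) (simp add: alg_simps)
    ultimately show ?thesis by simp
  qed
  define g where "g t = U t \<cdot> X \<cdot> adj (U t)" for t
  define g' where "g' t = U t \<cdot> X \<cdot> adj (U' t) + U' t \<cdot> X \<cdot> adj (U t)" for t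
  have dg: "(g has_vector_derivative g' t) (at t)" for t
    unfolding g_def[abs_def] g'_def by (rule has_vd_mul[OF has_vd_mul_right[OF dU] has_vd_adj[OF dU]])
  have contF: "continuous_on UNIV F" and contE: "continuous_on UNIV E"
    using dF dE has_vector_derivative_continuous by (meson continuous_at_imp_continuous_on)+
  have contU: "continuous_on UNIV U" and contU': "continuous_on UNIV U'"
    unfolding U_def[abs_def] U'_def[abs_def]
    by (intro mul.continuous_on contF contE continuous_on_const)+
  have cont: "continuous_on UNIV g'"
    unfolding g'_def[abs_def]
    by (intro continuous_on_add mul.continuous_on contU contU' continuous_on_const
        bounded_linear.continuous_on[OF bounded_linear_adj])
  have gM: "g t \<in> M" for t unfolding g_def by (rule M_conj[OF X UU])
  have "norm (g' t) \<le> norm (u - v)" for t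
  proof -
    \<comment> \<open>The velocity pulled back by the unitary \<open>U t\<close> is a commutator
      with the fixed projection \<open>X\<close>; \<open>k\<close> is a unitary conjugate of
      \<open>b - a\<close> and has the same norm.\<close>
    define k where "k = adj (E t) \<cdot> (b - a) \<cdot> E t"
    have "U t \<cdot> k = F t \<cdot> (E t \<cdot> adj (E t)) \<cdot> (b - a) \<cdot> E t"
      by (simp only: U_def k_def mul_assoc)
    then have Uk: "U' t = U t \<cdot> k" by (simp add: EE U'_def)
    have adjk: "adj k = - k" by (simp add: k_def alg_simps a b)
    have "g' t = U t \<cdot> (k \<cdot> X - X \<cdot> k) \<cdot> adj (U t)"
      by (simp add: g'_def Uk adj_mul[of "U t" k] adjk mul.minus_left mul.minus_right mul.diff_left
          mul.diff_right mul_assoc)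
    then have "norm (g' t) = norm (k \<cdot> X - X \<cdot> k)"
      using isometry_imp_coisometry[OF UU]
      by (simp add: norm_isometry_mul[OF UU] norm_mul_coisometry[of "adj (U t)"] UU)
    also have "\<dots> \<le> norm k" by (rule norm_commutator_le[OF X])
    also have "\<dots> = norm (b - a)"
      unfolding k_def using EE
      by (simp add: norm_mul_coisometry[of "E t"] norm_isometry_mul[of "adj (E t)"])
    also have "b - a = (v - u) \<cdot> refl_of X" by (simp add: a_def b_def mul.diff_left)
    also have "norm \<dots> = norm (u - v)" by (simp add: norm_tspace[OF X] norm_minus_commute)
    finally show ?thesis .
  qed
  from riem_dist_le_speed[OF dg cont gM this]
  have "riem_dist M (g 0) (g 1) \<le> norm (u - v)" .
  moreover have "g 0 = geo X u 1" by (simp add: g_def U_def E_def F_def b geo_def a_def)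
  moreover have "g 1 = geo X v 1" by (simp add: g_def U_def E_def F_def a geo_def b_def)
  ultimately show ?thesis by simp
qed

lemma sum_norm_mul_orthonormal:
  assumes B: "finite B" "pairwise orthogonal B" "span B = UNIV" "\<And>b. b \<in> B \<Longrightarrow> norm b = 1"
  shows "(\<Sum>b\<in>B. (norm (x \<cdot> b))\<^sup>2) = \<kappa> * (norm x)\<^sup>2"
  using sum_norm_orthonormal_eq_Basis[OF B inner_mul_left, of x] sum_Basis_mul by simp

text \<open>A curve from \<open>P\<close> to \<open>Q\<close> moves each vector \<open>S b\<close> along a curve on the unit sphere whose
  length is at least the angle between its ends; these angles add up, by Cauchy-Schwarz, to
  \<open>norm w\<close>.\<close>

lemma length_ge_norm_log:
  assumes P: "P \<in> M" and Q: "Q \<in> M" and w: "adj w = - w"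
    and B: "finite B" "pairwise orthogonal B" "span B = UNIV" "\<And>b. b \<in> B \<Longrightarrow> norm b = 1"
    and lam: "\<And>b. b \<in> B \<Longrightarrow> b \<bullet> (refl_of Q \<cdot> refl_of P \<cdot> b) = lam b"
    and ww: "\<And>b. b \<in> B \<Longrightarrow> w \<cdot> (w \<cdot> b) = - ((arccos (lam b) / 2)\<^sup>2 *\<^sub>R b)"
    and g: "valid_path g" "path_image g \<subseteq> M" "pathstart g = P" "pathfinish g = Q"
    and l: "((\<lambda>t. norm (vector_derivative g (at t within {0..1}))) has_integral l) {0..1}"
  shows "norm w \<le> l"
proof -
  let ?S = "refl_of P"
  define r where "r b = arccos (lam b) / 2" for b
  have lam1: "\<bar>lam b\<bar> \<le> 1" if "b \<in> B" for b
  proof -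
    have "norm (refl_of Q \<cdot> ?S \<cdot> b) = 1"
      using B(4)[OF that]
      by (simp add: mul_assoc norm_isometry_mul adj_refl_of[OF P] adj_refl_of[OF Q] refl_of_sq[OF P] refl_of_sq[OF Q])
    then show ?thesis
      using Cauchy_Schwarz_ineq2[of b "refl_of Q \<cdot> ?S \<cdot> b"] B(4)[OF that] lam[OF that] by simp
  qed
  have r0: "r b \<ge> 0" if "b \<in> B" for b using lam1[OF that] by (simp add: r_def arccos_lbound abs_le_iff)
  \<comment> \<open>\<open>r b\<close> is the norm of \<open>w \<cdot> b\<close>, half the angle
    through which \<open>b\<close> is turned in the end; the squares add up to a Hilbert-Schmidt
    norm.\<close>
  have sumr: "(\<Sum>b\<in>B. (r b)\<^sup>2) = \<kappa> * (norm w)\<^sup>2"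
  proof -
    have "(norm (w \<cdot> b))\<^sup>2 = (r b)\<^sup>2" if "b \<in> B" for b
    proof -
      have "b \<bullet> b = 1" using B(4)[OF that] by (simp add: dot_square_norm)
      then show ?thesis
        by (simp add: power2_norm_eq_inner inner_mul_left w mul.minus_left ww[OF that] r_def)
    qed
    then show ?thesis using sum_norm_mul_orthonormal[OF B, of w] by simp
  qed
  obtain K where K: "finite K" "g C1_differentiable_on ({0..1} - K)" and cg: "continuous_on {0..1} g"
    using g(1) by (auto simp: valid_path_def piecewise_C1_differentiable_on_def)
  then obtain D where D: "\<And>t. t \<in> {0..1} - K \<Longrightarrow> (g has_vector_derivative D t) (at t)"
    unfolding C1_differentiable_on_def by blast
  have gM: "g t \<in> M" if "t \<in> {0..1}" for t using g(2) that by (auto simp: path_image_def)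
  have g01: "g 0 = P" "g 1 = Q" using g by (auto simp: pathstart_def pathfinish_def)
  define f where "f b t = refl_of (g t) \<cdot> ?S \<cdot> b" for b t
  define f' where "f' b t = 2 *\<^sub>R (D t \<cdot> (?S \<cdot> b))" for b t
  have nf: "norm (f b t) = 1" if "b \<in> B" "t \<in> {0..1}" for b t
    using B(4)[OF that(1)] gM[OF that(2)]
    by (simp add: f_def mul_assoc norm_isometry_mul adj_refl_of[OF P] refl_of_sq[OF P] adj_refl_of refl_of_sq)
  have df: "(f b has_vector_derivative f' b t) (at t)" if "t \<in> {0..1} - K" for b t
  proof -
    have "((\<lambda>t. refl_of (g t)) has_vector_derivative 2 *\<^sub>R D t) (at t)"
      unfolding refl_of_def
      using has_vector_derivative_diff[OF bounded_linear.has_vector_derivative[OF bounded_linear_scaleR_right D[OF that]]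
         has_vector_derivative_const] by simp
    from has_vd_mul_right[OF has_vd_mul_right[OF this]] show ?thesis
      by (simp add: f_def[abs_def] f'_def mul.scaleR_left mul_assoc)
  qed
  have ff': "f b t \<bullet> f' b t = 0" if "t \<in> {0<..<1} - K" for b t
  proof -
    let ?R = "refl_of (g t)" and ?y = "?S \<cdot> b"
    have gt: "g t \<in> M" using gM[of t] that by auto
    have "D t \<in> tspace (g t)"
    proof (rule velocity_in_tspace)
      show "(g has_vector_derivative D t) (at t)" using D that by auto
      show "open {0<..<1::real}" "t \<in> {0<..<1}" using that by auto
      show "g s \<in> M" if "s \<in> {0<..<1}" for s using gM[of s] that by auto
    qed
    then have Dt: "adj (D t) = D t" "D t \<cdot> ?R = - (?R \<cdot> D t)" by (auto simp: tspace_def)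
    have "(?R \<cdot> ?y) \<bullet> (D t \<cdot> ?y) = (D t \<cdot> ?R \<cdot> ?y) \<bullet> ?y"
      using inner_mul_left[of "D t" "?R \<cdot> ?y" ?y] by (simp add: Dt(1) mul_assoc)
    also have "\<dots> = - ((?R \<cdot> (D t \<cdot> ?y)) \<bullet> ?y)" by (simp only: Dt(2) mul.minus_left inner_minus_left mul_assoc)
    also have "(?R \<cdot> (D t \<cdot> ?y)) \<bullet> ?y = (D t \<cdot> ?y) \<bullet> (?R \<cdot> ?y)"
      by (simp only: inner_mul_left[of ?R] adj_refl_of[OF gt])
    finally have "(?R \<cdot> ?y) \<bullet> (D t \<cdot> ?y) = - ((?R \<cdot> ?y) \<bullet> (D t \<cdot> ?y))" by (simp only: inner_commute)
    then show ?thesis by (simp add: f_def f'_def mul_assoc)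
  qed
  \<comment> \<open>The weights \<open>2 * r b\<close> are the final angles themselves. As
    \<open>c\<close> tends to 1 the left side therefore tends to the sum of their squares, which is
    quadratic in \<open>norm w\<close>, against a right side linear in
    \<open>norm w\<close>.\<close>
  have key: "(\<Sum>b\<in>B. 2 * r b * (arccos (c * lam b) - arccos c)) \<le> 4 * \<kappa> * norm w * l"
    if c: "0 < c" "c < 1" for c
  proof -
    define h where "h b t = arccos (c * (b \<bullet> f b t))" for b t
    have "\<exists>e. t \<in> {0<..<1} - K \<longrightarrow> (h b has_vector_derivative e) (at t) \<and> \<bar>e\<bar> \<le> norm (f' b t)"
      if b: "b \<in> B" for b t
    proof (cases "t \<in> {0<..<1} - K")
      case t: True
      have t': "t \<in> {0..1} - K" "t \<in> {0..1}" using t by auto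
      obtain e where "(h b has_vector_derivative e) (at t)" "\<bar>e\<bar> \<le> norm (f' b t)"
        unfolding h_def
        by (rule arccos_inner_deriv_bound[OF df[OF t'(1)] nf[OF b t'(2)] ff'[OF t] B(4)[OF b]]) (use c in auto)
      then show ?thesis by blast
    qed blast
    then obtain e where e: "\<And>b t. b \<in> B \<Longrightarrow> t \<in> {0<..<1} - K \<Longrightarrow> (h b has_vector_derivative e b t) (at t)"
      and e': "\<And>b t. b \<in> B \<Longrightarrow> t \<in> {0<..<1} - K \<Longrightarrow> \<bar>e b t\<bar> \<le> norm (f' b t)" by metis
    define H where "H t = (\<Sum>b\<in>B. 2 * r b * h b t)" for t
    \<comment> \<open>The value 0 on the exceptional set keeps the pointwise estimate below valid
      for every \<open>t\<close>.\<close>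
    define H' where "H' t = (if t \<in> {0<..<1} - K then \<Sum>b\<in>B. 2 * r b * e b t else 0)" for t
    have "(H' has_integral H 1 - H 0) {0..1}"
    proof (rule fundamental_theorem_of_calculus_interior_strong[OF K(1)])
      show "(H has_vector_derivative H' t) (at t)" if "t \<in> {0<..<1} - K" for t
      proof -
        have "(H has_vector_derivative (\<Sum>b\<in>B. 2 * r b * e b t)) (at t)"
          unfolding H_def[abs_def]
          by (intro has_vector_derivative_sum has_vector_derivative_mult_right e that)
        then show ?thesis using that by (simp add: H'_def)
      qed
      have cf: "continuous_on {0..1} (f b)" for b
        unfolding f_def[abs_def] refl_of_def
        by (intro mul.continuous_on continuous_intros cg)
      have "continuous_on {0..1} (h b)" if b: "b \<in> B" for b
        unfolding h_def[abs_def]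
      proof (rule continuous_on_arccos)
        show "continuous_on {0..1} (\<lambda>t. c * (b \<bullet> f b t))" by (intro continuous_intros cf)
        show "\<forall>t\<in>{0..1}. - 1 \<le> c * (b \<bullet> f b t) \<and> c * (b \<bullet> f b t) \<le> 1"
        proof
          fix t :: real assume t: "t \<in> {0..1}"
          have "\<bar>b \<bullet> f b t\<bar> \<le> 1" using Cauchy_Schwarz_ineq2[of b "f b t"] nf[OF b t] B(4)[OF b] by simp
          then have "\<bar>c * (b \<bullet> f b t)\<bar> \<le> 1" using c by (simp add: abs_mult mult_le_one)
          then show "- 1 \<le> c * (b \<bullet> f b t) \<and> c * (b \<bullet> f b t) \<le> 1" by (simp add: abs_le_iff)
        qed
      qed
      then show "continuous_on {0..1} H" unfolding H_def[abs_def] by (intro continuous_intros)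
    qed auto
    moreover have "((\<lambda>t. (4 * \<kappa> * norm w) * norm (vector_derivative g (at t within {0..1})))
        has_integral (4 * \<kappa> * norm w) * l) {0..1}"
      by (rule has_integral_mult_right[OF l])
    moreover have "H' t \<le> (4 * \<kappa> * norm w) * norm (vector_derivative g (at t within {0..1}))" for t
    proof (cases "t \<in> {0<..<1} - K")
      case t: True
      have vd: "vector_derivative g (at t within {0..1}) = D t"
        using vector_derivative_at_within_ivl[OF D] t by auto
      have "H' t = (\<Sum>b\<in>B. 2 * r b * e b t)" using t by (simp add: H'_def)
      also have "\<dots> \<le> (\<Sum>b\<in>B. (2 * r b) * norm (f' b t))"
        using e'[OF _ t] r0 by (intro sum_mono mult_left_mono) (auto simp: abs_le_iff)
      also have "\<dots> \<le> sqrt (\<Sum>b\<in>B. (2 * r b)\<^sup>2) * sqrt (\<Sum>b\<in>B. (norm (f' b t))\<^sup>2)"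
        using L2_set_mult_ineq[of "\<lambda>b. 2 * r b" "\<lambda>b. norm (f' b t)" B] r0
        by (simp add: L2_set_def)
      also have "(\<Sum>b\<in>B. (2 * r b)\<^sup>2) = 4 * (\<kappa> * (norm w)\<^sup>2)"
        by (simp add: power_mult_distrib sumr flip: sum_distrib_left)
      also have "(\<Sum>b\<in>B. (norm (f' b t))\<^sup>2) = 4 * (\<kappa> * (norm (D t))\<^sup>2)"
        using sum_norm_mul_orthonormal[OF B, of "D t \<cdot> ?S"]
        by (simp add: f'_def power_mult_distrib mul_assoc norm_tspace[OF P] flip: sum_distrib_left)
      also have "sqrt (4 * (\<kappa> * (norm w)\<^sup>2)) * sqrt (4 * (\<kappa> * (norm (D t))\<^sup>2)) = 4 * \<kappa> * norm w * norm (D t)"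
        using kappa_pos by (simp add: real_sqrt_mult)
      finally show ?thesis by (simp only: vd)
    next
      case False
      then have "H' t = 0" by (simp only: H'_def if_False)
      then show ?thesis using kappa_pos by simp
    qed
    ultimately have "H 1 - H 0 \<le> (4 * \<kappa> * norm w) * l" by (rule has_integral_le)
    moreover have "H 1 - H 0 = (\<Sum>b\<in>B. 2 * r b * (arccos (c * lam b) - arccos c))"
      unfolding H_def sum_subtractf[symmetric]
    proof (intro sum.cong refl)
      fix b assume b: "b \<in> B"
      have "b \<bullet> f b 0 = 1" using B(4)[OF b]
        by (simp add: f_def g01 refl_of_sq[OF P] dot_square_norm)
      moreover have "b \<bullet> f b 1 = lam b" using lam[OF b] by (simp add: f_def g01)
      ultimately show "2 * r b * h b 1 - 2 * r b * h b 0 = 2 * r b * (arccos (c * lam b) - arccos c)"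
        by (simp add: h_def right_diff_distrib)
    qed
    ultimately show ?thesis by simp
  qed
  define G where "G c = (\<Sum>b\<in>B. 2 * r b * (arccos (c * lam b) - arccos c))" for c
  \<comment> \<open>The arc cosine is continuous up to the ends of its interval, so the estimate
    survives the limit in \<open>c\<close>.\<close>
  have "G 1 \<le> 4 * \<kappa> * norm w * l"
  proof (rule continuous_le_on_closure[where S = "{0<..<1::real}" and f = G and x = 1])
    have cl: "closure {0<..<1::real} = {0..1}" by simp
    show "1 \<in> closure {0<..<1::real}" by simp
    have "\<forall>c\<in>{0..1}. - 1 \<le> c * lam b \<and> c * lam b \<le> 1" if b: "b \<in> B" for b
    proof
      fix c :: real assume "c \<in> {0..1}"
      then have "\<bar>c * lam b\<bar> \<le> 1" using lam1[OF b] by (simp add: abs_mult mult_le_one)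
      then show "- 1 \<le> c * lam b \<and> c * lam b \<le> 1" by (simp add: abs_le_iff)
    qed
    then show "continuous_on (closure {0<..<1}) G"
      unfolding cl G_def[abs_def] by (intro continuous_intros) auto
    show "G c \<le> 4 * \<kappa> * norm w * l" if "c \<in> {0<..<1}" for c
      using key[of c] that by (simp add: G_def)
  qed
  moreover have "G 1 = 4 * (\<Sum>b\<in>B. (r b)\<^sup>2)"
    by (simp add: G_def r_def sum_distrib_left power2_eq_square)
  ultimately have "4 * (\<kappa> * (norm w)\<^sup>2) \<le> 4 * \<kappa> * norm w * l" by (simp only: sumr)
  then have "(4 * \<kappa>) * (norm w * norm w) \<le> (4 * \<kappa>) * (norm w * l)"
    by (simp only: power2_eq_square mult.assoc)
  then have le: "norm w * norm w \<le> norm w * l"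
    using kappa_pos by (simp only: mult_le_cancel_left_pos[of "4 * \<kappa>"] mult_pos_pos zero_less_numeral)
  show ?thesis
  proof (cases "norm w = 0")
    case True
    then show ?thesis using has_integral_nonneg[OF l] by simp
  next
    case False
    then show ?thesis using le by simp
  qed
qed

end

section \<open>Minimal geodesics\<close>

context projection_space
begin

text \<open>The skew logarithm of \<open>TS\<close>: \<open>C\<close> is the cosine of twice the principal angles. Where \<open>C\<close>
  is not \<open>-1\<close> the logarithm is a function of \<open>C\<close> times the sine part \<open>N\<close>; on the eigenspace of
  \<open>-1\<close> any partial isometry between the ranges of the two projections will do, and one exists because the
  traces agree.\<close>

lemma skew_log_exists:
  assumes P: "P \<in> M" and Q: "Q \<in> M"
  defines "S \<equiv> refl_of P" and "T \<equiv> refl_of Q"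
  defines "C \<equiv> (1/2) *\<^sub>R (T \<cdot> S + S \<cdot> T)"
  obtains w where "adj w = - w" "S \<cdot> w = - (w \<cdot> S)" "expo w 2 = T \<cdot> S"
    "\<And>x l. C \<cdot> x = l *\<^sub>R x \<Longrightarrow> w \<cdot> (w \<cdot> x) = - ((arccos l / 2)\<^sup>2 *\<^sub>R x)"
proof -
  have SS: "S \<cdot> S = one" and TT: "T \<cdot> T = one" and adjS: "adj S = S" and adjT: "adj T = T"
    using refl_of_sq adj_refl_of P Q by (simp_all add: S_def T_def)
  have SSx: "S \<cdot> (S \<cdot> x) = x" and TTx: "T \<cdot> (T \<cdot> x) = x" for x
    using refl_of_sq' P Q by (simp_all add: S_def T_def)
  \<comment> \<open>The unitary \<open>T \<cdot> S\<close> splits into its self-adjoint part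
    \<open>C\<close> and its skew part \<open>N\<close>, the cosine and sine of the doubled angles.
    They commute, and \<open>NN\<close> is the Pythagorean identity with the sign due to
    skewness.\<close>
  define N where "N = (1/2) *\<^sub>R (T \<cdot> S - S \<cdot> T)"
  have adjC: "adj C = C" by (simp add: C_def alg_simps adjS adjT add.commute)
  have adjN: "adj N = - N"
    by (simp add: N_def alg_simps adjS adjT flip: scaleR_minus_right)
  have CN: "C + N = T \<cdot> S"
    by (simp add: C_def N_def scaleR_2[symmetric] flip: scaleR_right_distrib)
  have SC: "C \<cdot> S = S \<cdot> C" and TC: "C \<cdot> T = T \<cdot> C"
    by (simp_all add: C_def alg_simps SS TT SSx TTx add.commute)
  have SN: "S \<cdot> N = - (N \<cdot> S)"
    by (simp add: N_def alg_simps SS TT SSx TTx flip: scaleR_minus_right)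
  have NC: "C \<cdot> N = N \<cdot> C"
    by (simp add: N_def C_def alg_simps SS TT SSx TTx algebra_simps)
  have NN: "N \<cdot> N = C \<cdot> C - one"
  proof -
    have "N \<cdot> N = (1/4) *\<^sub>R (T \<cdot> (S \<cdot> (T \<cdot> S)) + S \<cdot> (T \<cdot> (S \<cdot> T)) - one - one)"
      by (simp add: N_def alg_simps SS TT SSx TTx algebra_simps)
    moreover have "C \<cdot> C = (1/4) *\<^sub>R (T \<cdot> (S \<cdot> (T \<cdot> S)) + S \<cdot> (T \<cdot> (S \<cdot> T)) + one + one)"
      by (simp add: C_def alg_simps SS TT SSx TTx algebra_simps)
    moreover have "(1/4) *\<^sub>R (x - one - one) = (1/4) *\<^sub>R (x + one + one) - one" for x
    proof -
      have "(1/4) *\<^sub>R (x + one + one) - (1/4) *\<^sub>R (x - one - one) = (1/4) *\<^sub>R (4 *\<^sub>R one)"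
        unfolding scaleR_diff_right[symmetric]
        by (rule arg_cong[where f = "\<lambda>y. (1/4) *\<^sub>R y"]) (simp add: scaleR_left_distrib[of 2 2, simplified] scaleR_2)
      then show ?thesis by (simp add: algebra_simps)
    qed
    ultimately show ?thesis by simp
  qed
  obtain \<Lambda> p where sp: "spectral_resolution C \<Lambda> p" using spectral_resolution_exists[OF adjC] .
  note fin = spectral_resolution_finite[OF sp] and sum1 = spectral_resolution_sum[OF sp]
  have p0: "p l \<noteq> 0" and Cp: "C \<cdot> p l = l *\<^sub>R p l" and adjp: "adj (p l) = p l" and pp: "p l \<cdot> p l = p l"
    and pcomm: "C \<cdot> y = y \<cdot> C \<Longrightarrow> p l \<cdot> y = y \<cdot> p l" if "l \<in> \<Lambda>" for l y
    using spectral_resolutionD(1-5)[OF sp that] by blast+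
  have ortho: "p l \<cdot> p m = 0" if "l \<in> \<Lambda>" "m \<in> \<Lambda>" "l \<noteq> m" for l m
    using spectral_resolutionD(6)[OF sp that(1) that(2) that(3)] .
  have NNp: "N \<cdot> (N \<cdot> p l) = (l\<^sup>2 - 1) *\<^sub>R p l" if "l \<in> \<Lambda>" for l
  proof -
    have "N \<cdot> (N \<cdot> p l) = C \<cdot> (C \<cdot> p l) - p l"
      using arg_cong[OF NN, of "\<lambda>x. x \<cdot> p l"] by (simp add: mul_assoc mul.diff_left)
    then show ?thesis by (simp add: Cp[OF that] mul.scaleR_right power2_eq_square scaleR_diff_left)
  qed
  have nNp: "(norm (N \<cdot> p l))\<^sup>2 = (1 - l\<^sup>2) * (norm (p l))\<^sup>2" if "l \<in> \<Lambda>" for l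
  proof -
    have "(norm (N \<cdot> p l))\<^sup>2 = - (p l \<bullet> (N \<cdot> (N \<cdot> p l)))"
      by (simp add: power2_norm_eq_inner inner_mul_left adjN mul.minus_left)
    also have "\<dots> = (1 - l\<^sup>2) * (norm (p l))\<^sup>2"
      by (simp add: NNp[OF that] power2_norm_eq_inner left_diff_distrib)
    finally show ?thesis .
  qed
  have l1: "\<bar>l\<bar> \<le> 1" if "l \<in> \<Lambda>" for l
  proof -
    have "0 \<le> (1 - l\<^sup>2) * (norm (p l))\<^sup>2" unfolding nNp[OF that, symmetric] by simp
    moreover have "(norm (p l))\<^sup>2 > 0" using p0[OF that] by simp
    ultimately have "l\<^sup>2 \<le> 1" by (simp add: zero_le_mult_iff)
    then show ?thesis by (simp add: abs_square_le_1)
  qed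
  have Np0: "N \<cdot> p l = 0" if "l \<in> \<Lambda>" "l\<^sup>2 = 1" for l
    using nNp[OF that(1)] that(2) by simp
  \<comment> \<open>The spectral projection at angle pi, where the sine part vanishes and gives no
    direction to rotate in.\<close>
  define e where "e = (if -1 \<in> \<Lambda> then p (-1) else 0)"
  have ee: "e \<cdot> e = e" and adje: "adj e = e" and Ce: "C \<cdot> e = - e" and Ne: "N \<cdot> e = 0"
    using pp[of "-1"] adjp[of "-1"] Cp[of "-1"] Np0[of "-1"] by (auto simp: e_def adj.zero)
  have ecomm: "e \<cdot> y = y \<cdot> e" if "C \<cdot> y = y \<cdot> C" for y
    using pcomm[of "-1" y, OF _ that] by (auto simp: e_def)
  have ep: "e \<cdot> p l = (if l = -1 then e else 0)" if "l \<in> \<Lambda>" for l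
    using that pp ortho[of "-1" l] by (auto simp: e_def)
  have eS: "e \<cdot> S = S \<cdot> e" and eT: "e \<cdot> T = T \<cdot> e" using ecomm SC TC by auto
  \<comment> \<open>On the range of \<open>e\<close> the product \<open>T \<cdot> S\<close> is -1,
    so \<open>T\<close> and \<open>S\<close> are opposite there.\<close>
  have Te: "T \<cdot> e = - (S \<cdot> e)"
  proof -
    have "(C + N) \<cdot> (S \<cdot> e) = T \<cdot> S \<cdot> (S \<cdot> e)" by (simp only: CN)
    also have "\<dots> = T \<cdot> e" by (simp add: mul_assoc SSx)
    finally have "T \<cdot> e = C \<cdot> S \<cdot> e + N \<cdot> S \<cdot> e" by (simp add: mul.add_left mul_assoc)
    also have "C \<cdot> S \<cdot> e = - (S \<cdot> e)" by (simp add: SC mul_assoc Ce mul.minus_right)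
    also have "N \<cdot> S \<cdot> e = 0"
    proof -
      have "N \<cdot> S = - (S \<cdot> N)" by (simp add: SN)
      then show ?thesis by (simp add: mul_assoc mul.minus_left Ne)
    qed
    finally show ?thesis by simp
  qed
  \<comment> \<open>The sum \<open>R\<close> of the reflections intertwines \<open>S\<close> and
    \<open>T\<close>, and its square \<open>2 + 2 C\<close> acts on the eigenspace of
    \<open>l\<close> as a nonzero scalar away from -1. Cyclicity of the trace then moves
    \<open>R\<close> around.\<close>
  have trace_eq: "one \<bullet> (T \<cdot> p l) = one \<bullet> (S \<cdot> p l)" if l: "l \<in> \<Lambda>" "l \<noteq> -1" for l
  proof -
    define R where "R = S + T"
    have TR: "T \<cdot> R = R \<cdot> S" by (simp add: R_def alg_simps SS TT add.commute)
    have CR: "C \<cdot> R = R \<cdot> C" by (simp add: R_def mul.add_left mul.add_right SC TC)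
    have "R \<cdot> R = 2 *\<^sub>R one + 2 *\<^sub>R C"
      by (simp add: R_def C_def alg_simps SS TT scaleR_2)
    then have "R \<cdot> R \<cdot> p l = (2 *\<^sub>R one + 2 *\<^sub>R C) \<cdot> p l" by (simp only:)
    then have RRp: "R \<cdot> (R \<cdot> p l) = (2 * (1 + l)) *\<^sub>R p l"
      by (simp add: mul_assoc mul.add_left mul.scaleR_left Cp[OF l(1)] scaleR_left_distrib)
    have "(2 * (1 + l)) * (one \<bullet> (T \<cdot> p l)) = one \<bullet> (T \<cdot> (R \<cdot> (R \<cdot> p l)))"
      by (simp add: RRp mul.scaleR_right)
    also have "T \<cdot> (R \<cdot> (R \<cdot> p l)) = R \<cdot> S \<cdot> (R \<cdot> p l)"
      using TR by (metis mul_assoc)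
    also have "one \<bullet> \<dots> = one \<bullet> (S \<cdot> (R \<cdot> p l) \<cdot> R)"
      by (metis one_inner_commute mul_assoc)
    also have "S \<cdot> (R \<cdot> p l) \<cdot> R = S \<cdot> (R \<cdot> (R \<cdot> p l))"
      by (simp add: mul_assoc pcomm[OF l(1) CR])
    also have "one \<bullet> \<dots> = (2 * (1 + l)) * (one \<bullet> (S \<cdot> p l))"
      by (simp add: RRp mul.scaleR_right)
    finally show ?thesis using l(2) by simp
  qed
  \<comment> \<open>The total traces of \<open>S\<close> and \<open>T\<close> agree, and so do their
    parts away from -1. What remains has equal traces and opposite signs.\<close>
  have trSe: "one \<bullet> (S \<cdot> e) = 0"
  proof (cases "-1 \<in> \<Lambda>")
    case True
    have split: "one \<bullet> X = one \<bullet> (X \<cdot> e) + (\<Sum>l\<in>\<Lambda> - {-1}. one \<bullet> (X \<cdot> p l))" for X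
    proof -
      have "one \<bullet> X = one \<bullet> (X \<cdot> (\<Sum>l\<in>\<Lambda>. p l))" by (simp add: sum1)
      also have "\<dots> = (\<Sum>l\<in>\<Lambda>. one \<bullet> (X \<cdot> p l))" by (simp only: mul.sum_right inner_sum_right)
      also have "\<dots> = one \<bullet> (X \<cdot> p (-1)) + (\<Sum>l\<in>\<Lambda> - {-1}. one \<bullet> (X \<cdot> p l))"
        by (rule sum.remove[OF fin True])
      finally show ?thesis using True by (simp add: e_def)
    qed
    have "one \<bullet> T = one \<bullet> S"
      using M_trace[OF P Q] by (simp add: S_def T_def refl_of_def inner_diff_right)
    moreover have "(\<Sum>l\<in>\<Lambda> - {-1}. one \<bullet> (T \<cdot> p l)) = (\<Sum>l\<in>\<Lambda> - {-1}. one \<bullet> (S \<cdot> p l))"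
      by (rule sum.cong) (auto intro: trace_eq)
    ultimately have "one \<bullet> (T \<cdot> e) = one \<bullet> (S \<cdot> e)" using split[of T] split[of S] by simp
    then show ?thesis by (simp add: Te)
  next
    case False
    then show ?thesis by (simp add: e_def)
  qed
  \<comment> \<open>The parts of \<open>e\<close> inside the range of \<open>P\<close> and inside
    its complement; by \<open>trSe\<close> their traces agree.\<close>
  define e1 where "e1 = P \<cdot> e"
  define e2 where "e2 = e - e1"
  have e1: "e1 = (1/2) *\<^sub>R (S \<cdot> e + e)"
    unfolding e1_def by (subst proj_refl_of[of P]) (simp add: S_def alg_simps)
  have e2: "e2 = (1/2) *\<^sub>R (e - S \<cdot> e)"
  proof -
    have "e = (1/2) *\<^sub>R (e + e)" by (simp add: scaleR_2[symmetric])
    then show ?thesis unfolding e2_def e1 scaleR_right_distrib scaleR_diff_right by (simp add: algebra_simps)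
  qed
  have Se: "S \<cdot> e1 = e1" "e1 \<cdot> S = e1" "S \<cdot> e2 = - e2" "e2 \<cdot> S = - e2"
    unfolding e1 e2 by (simp_all add: alg_simps SSx SS eS algebra_simps)
  have adje1: "adj e1 = e1" unfolding e1 by (simp add: alg_simps adjS adje eS)
  have eSe: "e \<cdot> (S \<cdot> e) = S \<cdot> e" by (metis eS ee mul_assoc)
  have ee1: "e \<cdot> e1 = e1" unfolding e1 by (simp add: alg_simps ee eSe)
  have e1e: "e1 \<cdot> e = e1" unfolding e1 by (simp add: alg_simps ee)
  have "projection P" by (rule M_projection[OF P])
  then have e1e1: "e1 \<cdot> e1 = e1"
    using ee1 by (simp add: e1_def mul_assoc projection_def) (metis mul_assoc)
  have pr1: "projection e1" using e1e1 adje1 by (simp add: projection_def)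
  have pr2: "projection e2"
    by (simp add: projection_def e2_def alg_simps ee ee1 e1e e1e1 adje adje1)
  have "one \<bullet> e1 = one \<bullet> e2"
    unfolding e1 e2 by (simp add: inner_add_right inner_diff_right trSe)
  then obtain Z where Z: "adj Z \<cdot> Z = e1" "Z \<cdot> adj Z = e2" "Z \<cdot> e1 = Z" "e2 \<cdot> Z = Z"
    using partial_isometry_exists[OF pr1 pr2] by blast
  have Z': "e1 \<cdot> adj Z = adj Z" "adj Z \<cdot> e2 = adj Z"
    using arg_cong[OF Z(3), of adj] arg_cong[OF Z(4), of adj] pr1 pr2
    by (simp_all add: adj_mul projection_def)
  have e12: "e1 \<cdot> e2 = 0" "e2 \<cdot> e1 = 0" by (simp_all add: e2_def alg_simps e1e ee1 e1e1)
  have ZZ: "Z \<cdot> Z = 0" "adj Z \<cdot> adj Z = 0"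
  proof -
    have "Z \<cdot> Z = Z \<cdot> e1 \<cdot> (e2 \<cdot> Z)" by (simp only: Z(3,4))
    also have "\<dots> = Z \<cdot> (e1 \<cdot> e2) \<cdot> Z" by (simp only: mul_assoc)
    finally show zz: "Z \<cdot> Z = 0" by (simp add: e12)
    show "adj Z \<cdot> adj Z = 0" using arg_cong[OF zz, of adj] by (simp add: adj_mul adj.zero)
  qed
  \<comment> \<open>A rotation by a right angle exchanging \<open>e1\<close> and \<open>e2\<close>:
    skew, of square \<open>- e\<close>, and anticommuting with \<open>S\<close>.\<close>
  define Y where "Y = Z - adj Z"
  have YY: "Y \<cdot> Y = - e"
    by (simp add: Y_def alg_simps ZZ Z(1,2) e2_def)
  have e2e: "e \<cdot> e2 = e2" "e2 \<cdot> e = e2" by (simp_all add: e2_def alg_simps ee ee1 e1e)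
  have Ye: "Y \<cdot> e = Y" and eY: "e \<cdot> Y = Y"
  proof -
    have "Z \<cdot> e = Z" using Z(3) e1e by (metis mul_assoc)
    moreover have "adj Z \<cdot> e = adj Z" using Z'(2) e2e by (metis mul_assoc)
    ultimately show "Y \<cdot> e = Y" by (simp add: Y_def mul.diff_left)
    have "e \<cdot> Z = Z" using Z(4) e2e by (metis mul_assoc)
    moreover have "e \<cdot> adj Z = adj Z" using Z'(1) ee1 by (metis mul_assoc)
    ultimately show "e \<cdot> Y = Y" by (simp add: Y_def mul.diff_right)
  qed
  have SY: "S \<cdot> Y = - (Y \<cdot> S)"
  proof -
    have "S \<cdot> Z = - Z" using Z(4) Se(3) by (metis mul_assoc mul.minus_left)
    moreover have "Z \<cdot> S = Z" using Z(3) Se(2) by (metis mul_assoc)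
    moreover have "S \<cdot> adj Z = adj Z" using Z'(1) Se(1) by (metis mul_assoc)
    moreover have "adj Z \<cdot> S = - adj Z" using Z'(2) Se(4) by (metis mul_assoc mul.minus_right)
    ultimately show ?thesis by (simp add: Y_def mul.diff_left mul.diff_right)
  qed
  have adjY: "adj Y = - Y" by (simp add: Y_def adj.diff)
  define r where "r l = arccos l / 2" for l :: real
  \<comment> \<open>The angle divided by its sine. At -1 and 1 the sine part \<open>N\<close> kills
    the eigenspace, so the value 0 is consistent; at -1 the term with \<open>Y\<close> takes
    over.\<close>
  define g where "g l = (if l\<^sup>2 = 1 then 0 else r l / sqrt (1 - l\<^sup>2))" for l
  define G where "G = (\<Sum>l\<in>\<Lambda>. g l *\<^sub>R p l)"
  define w where "w = N \<cdot> G + (pi / 2) *\<^sub>R Y"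
  have Gcomm: "G \<cdot> y = y \<cdot> G" if "C \<cdot> y = y \<cdot> C" for y
    unfolding G_def mul.sum_left mul.sum_right
    by (intro sum.cong refl) (simp add: mul.scaleR_left mul.scaleR_right pcomm[OF _ that])
  have adjG: "adj G = G" by (simp add: G_def adj.sum adj.scale adjp)
  have Gp: "G \<cdot> p l = g l *\<^sub>R p l" if l: "l \<in> \<Lambda>" for l
  proof -
    have "G \<cdot> p l = (\<Sum>m\<in>\<Lambda>. g m *\<^sub>R (p m \<cdot> p l))" by (simp add: G_def mul.sum_left mul.scaleR_left)
    also have "\<dots> = g l *\<^sub>R (p l \<cdot> p l) + (\<Sum>m\<in>\<Lambda> - {l}. g m *\<^sub>R (p m \<cdot> p l))"
      by (rule sum.remove[OF fin l])
    also have "(\<Sum>m\<in>\<Lambda> - {l}. g m *\<^sub>R (p m \<cdot> p l)) = 0"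
      using ortho[OF _ l] by (intro sum.neutral) auto
    finally show ?thesis by (simp add: pp[OF l])
  qed
  have adjw: "adj w = - w"
    by (simp add: w_def adj.add adj.scale adjY adj_mul adjN adjG mul.minus_right Gcomm[OF NC])
  have Sw: "S \<cdot> w = - (w \<cdot> S)"
  proof -
    have "S \<cdot> (N \<cdot> G) = - (N \<cdot> (S \<cdot> G))" using SN by (metis mul_assoc mul.minus_left)
    also have "S \<cdot> G = G \<cdot> S" using Gcomm[OF SC] by simp
    finally show ?thesis by (simp add: w_def mul.add_left mul.add_right mul.scaleR_left mul.scaleR_right SY mul_assoc)
  qed
  have wp: "w \<cdot> p l = g l *\<^sub>R (N \<cdot> p l) + (if l = -1 then (pi / 2) *\<^sub>R Y else 0)" if l: "l \<in> \<Lambda>" for l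
  proof -
    have "Y \<cdot> p l = Y \<cdot> (e \<cdot> p l)" using Ye by (metis mul_assoc)
    then have "Y \<cdot> p l = (if l = -1 then Y else 0)" by (simp add: ep[OF l] Ye)
    then show ?thesis by (simp add: w_def mul.add_left mul.scaleR_left mul_assoc Gp[OF l] mul.scaleR_right)
  qed
  have wwp: "w \<cdot> (w \<cdot> p l) = - ((r l)\<^sup>2 *\<^sub>R p l)" if l: "l \<in> \<Lambda>" for l
  proof -
    \<comment> \<open>At -1 the square comes from \<open>YY\<close>, at 1 both the angle and
      \<open>w \<cdot> p l\<close> are zero, and elsewhere it comes from \<open>NNp\<close>.\<close>
    consider "l = -1" | "l = 1" | "l\<^sup>2 \<noteq> 1" by (metis power2_eq_1_iff)
    then show ?thesis
    proof cases
      case 1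
      have pe: "p l = e" using l 1 by (simp add: e_def)
      have "w \<cdot> e = (pi / 2) *\<^sub>R Y" using wp[OF l, unfolded pe] 1 by (simp add: g_def)
      with eY have "w \<cdot> Y = (pi / 2) *\<^sub>R (Y \<cdot> Y)" by (metis mul_assoc mul.scaleR_left)
      moreover have rl: "r l = pi / 2" using 1 by (simp add: r_def)
      ultimately show ?thesis unfolding pe rl using \<open>w \<cdot> e = (pi / 2) *\<^sub>R Y\<close>
        by (simp add: mul.scaleR_right YY power2_eq_square)
    next
      case 2
      then show ?thesis using wp[OF l] by (simp add: g_def r_def)
    next
      case 3
      then have l': "l \<noteq> -1" by auto
      have w1: "w \<cdot> p l = g l *\<^sub>R (N \<cdot> p l)" using wp[OF l] l' by simp
      have pN: "N \<cdot> p l = p l \<cdot> N" using pcomm[OF l NC] by simp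
      have "w \<cdot> (N \<cdot> p l) = (w \<cdot> p l) \<cdot> N" by (simp add: pN mul_assoc)
      also have "\<dots> = g l *\<^sub>R (N \<cdot> (p l \<cdot> N))" by (simp add: w1 mul.scaleR_left mul_assoc)
      also have "\<dots> = (g l * (l\<^sup>2 - 1)) *\<^sub>R p l" by (simp add: pN[symmetric] NNp[OF l])
      finally have "w \<cdot> (w \<cdot> p l) = (g l * (g l * (l\<^sup>2 - 1))) *\<^sub>R p l" by (simp add: w1 mul.scaleR_right)
      moreover have "g l * (g l * (l\<^sup>2 - 1)) = - (r l)\<^sup>2"
      proof -
        have "l\<^sup>2 < 1" using l1[OF l] 3 by (simp add: abs_square_le_1 less_le)
        then show ?thesis using 3 by (simp add: g_def power2_eq_square[of "r l"] divide_simps) (simp add: algebra_simps)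
      qed
      ultimately show ?thesis by simp
    qed
  qed
  have "expo w 2 = (\<Sum>l\<in>\<Lambda>. cos (2 * r l) *\<^sub>R p l + (sin (2 * r l) / r l) *\<^sub>R (w \<cdot> p l))"
    using expo_spectral[OF adjw fin sum1 wwp] .
  also have "\<dots> = (\<Sum>l\<in>\<Lambda>. (C + N) \<cdot> p l)"
  proof (intro sum.cong refl)
    fix l assume l: "l \<in> \<Lambda>"
    have cos: "cos (2 * r l) = l" using l1[OF l] by (simp add: r_def abs_le_iff)
    have sin: "sin (2 * r l) = sqrt (1 - l\<^sup>2)" using l1[OF l] by (simp add: r_def sin_arccos_abs)
    \<comment> \<open>The factor \<open>sin (2 * r l) / r l\<close> is the reciprocal of
      \<open>g l\<close> unless the eigenvalue is -1 or 1; there the sine and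
      \<open>N \<cdot> p l\<close> both vanish.\<close>
    have "(sin (2 * r l) / r l) *\<^sub>R (w \<cdot> p l) = N \<cdot> p l"
    proof (cases "l\<^sup>2 = 1")
      case True
      then show ?thesis using Np0[OF l True] by (simp add: sin)
    next
      case False
      have "l\<^sup>2 < 1" using l1[OF l] False by (simp add: abs_square_le_1 less_le)
      then have "l < 1" "sqrt (1 - l\<^sup>2) > 0" by (auto simp: abs_square_less_1)
      then have "r l \<noteq> 0" using l1[OF l] arccos_eq_0_iff[of l] by (simp add: r_def)
      moreover have "w \<cdot> p l = g l *\<^sub>R (N \<cdot> p l)" using wp[OF l] False by auto
      ultimately show ?thesis using \<open>sqrt (1 - l\<^sup>2) > 0\<close> False by (simp add: sin g_def)
    qed
    then show "cos (2 * r l) *\<^sub>R p l + (sin (2 * r l) / r l) *\<^sub>R (w \<cdot> p l) = (C + N) \<cdot> p l"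
      by (simp add: cos Cp[OF l] mul.add_left)
  qed
  also have "\<dots> = T \<cdot> S" by (simp only: mul.sum_right[symmetric] sum1 mul_one CN)
  finally have ex: "expo w 2 = T \<cdot> S" .
  \<comment> \<open>The length estimate uses an orthonormal basis of eigenvectors of
    \<open>C\<close>, so the formula on the \<open>p l\<close> is extended to every
    eigenvector.\<close>
  have wwx: "w \<cdot> (w \<cdot> x) = - ((arccos m / 2)\<^sup>2 *\<^sub>R x)" if x: "C \<cdot> x = m *\<^sub>R x" for x m
  proof -
    have px: "p l \<cdot> x = 0" if "l \<in> \<Lambda>" "l \<noteq> m" for l
    proof -
      have "l *\<^sub>R (p l \<cdot> x) = p l \<cdot> C \<cdot> x"
        using Cp[OF that(1)] pcomm[OF that(1), of C] by (simp add: mul.scaleR_left)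
      also have "\<dots> = m *\<^sub>R (p l \<cdot> x)" by (simp add: mul_assoc x mul.scaleR_right)
      finally show ?thesis using that(2) by simp
    qed
    have "x = (\<Sum>l\<in>\<Lambda>. p l) \<cdot> x" by (simp add: sum1)
    then have x_sum: "x = (\<Sum>l\<in>\<Lambda>. p l \<cdot> x)" by (simp only: mul.sum_left)
    have "w \<cdot> (w \<cdot> x) = (\<Sum>l\<in>\<Lambda>. w \<cdot> (w \<cdot> (p l \<cdot> x)))"
      by (subst x_sum) (simp only: mul.sum_right)
    also have "\<dots> = (\<Sum>l\<in>\<Lambda>. - ((r m)\<^sup>2 *\<^sub>R (p l \<cdot> x)))"
    proof (intro sum.cong refl)
      fix l assume l: "l \<in> \<Lambda>"
      show "w \<cdot> (w \<cdot> (p l \<cdot> x)) = - ((r m)\<^sup>2 *\<^sub>R (p l \<cdot> x))"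
      proof (cases "l = m")
        case True
        have "w \<cdot> (w \<cdot> (p l \<cdot> x)) = w \<cdot> (w \<cdot> p l) \<cdot> x" by (simp only: mul_assoc)
        then show ?thesis unfolding wwp[OF l] by (simp add: mul.minus_left mul.scaleR_left True)
      qed (simp add: px[OF l])
    qed
    also have "\<dots> = - ((r m)\<^sup>2 *\<^sub>R (\<Sum>l\<in>\<Lambda>. p l \<cdot> x))" by (simp add: sum_negf scaleR_sum_right)
    finally show ?thesis by (simp only: x_sum[symmetric] r_def)
  qed
  show ?thesis by (rule that[OF adjw Sw ex wwx])
qed

text \<open>The reflection at time 1 is E S E* with E the exponential of w. Anticommutation turns it
  into E E S = T S S = T. Minimality combines \<open>length_ge_norm_log\<close> in an eigenbasis of
  \<open>C\<close> with the expansion bound \<open>riem_dist_geo_le\<close> against the zero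
  vector.\<close>

lemma minimal_geodesic_exists:
  assumes P: "P \<in> M" and Q: "Q \<in> M"
  obtains v where "v \<in> tspace P" "geo P v 1 = Q" "norm v = riem_dist M P Q"
proof -
  define S where "S = refl_of P"
  define T where "T = refl_of Q"
  define C where "C = (1/2) *\<^sub>R (T \<cdot> S + S \<cdot> T)"
  obtain w where w: "adj w = - w" "S \<cdot> w = - (w \<cdot> S)" "expo w 2 = T \<cdot> S"
    and ww: "\<And>x l. C \<cdot> x = l *\<^sub>R x \<Longrightarrow> w \<cdot> (w \<cdot> x) = - ((arccos l / 2)\<^sup>2 *\<^sub>R x)"
    using skew_log_exists[OF P Q] unfolding C_def S_def T_def by blast
  have SS: "S \<cdot> S = one" and adjS: "adj S = S" and adjT: "adj T = T"
    using refl_of_sq adj_refl_of P Q by (simp_all add: S_def T_def)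
  define v where "v = w \<cdot> S"
  have vS: "v \<cdot> S = w" by (simp add: v_def mul_assoc SS)
  have Sv: "S \<cdot> v = - w"
    unfolding v_def using w(2) by (metis mul_assoc mul.minus_left vS v_def)
  have v: "v \<in> tspace P"
    using w(2) by (simp add: tspace_def S_def[symmetric] vS Sv) (simp add: v_def adj_mul adjS w(1) mul.minus_right)
  have nv: "norm v = norm w"
    unfolding v_def by (rule norm_mul_coisometry) (simp add: adjS SS)
  have geo: "geo P v 1 = Q"
  proof -
    let ?E = "expo w 1"
    have "refl_of (geo P v 1) = ?E \<cdot> S \<cdot> adj ?E"
      unfolding geo_def S_def[symmetric] vS
      unfolding S_def by (rule refl_of_conj[OF adj_expo_mul_expo[OF w(1)]])
    also have "adj ?E = S \<cdot> ?E \<cdot> S" by (rule expo_anticommute[OF w(1) SS w(2), symmetric])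
    also have "?E \<cdot> S \<cdot> (S \<cdot> ?E \<cdot> S) = ?E \<cdot> (S \<cdot> S) \<cdot> ?E \<cdot> S" by (simp only: mul_assoc)
    also have "\<dots> = expo w (1 + 1) \<cdot> S" by (simp only: SS mul_one expo_add[OF w(1)])
    also have "\<dots> = T" by (simp add: w(3) mul_assoc SS)
    finally show ?thesis using proj_refl_of[of "geo P v 1"] proj_refl_of[of Q] by (simp add: T_def)
  qed
  have adjC: "adj C = C" by (simp add: C_def alg_simps adjS adjT add.commute)
  obtain B lam where B: "finite B" "pairwise orthogonal B" "span B = UNIV" "\<And>b. b \<in> B \<Longrightarrow> norm b = 1"
    and lam: "\<And>b. b \<in> B \<Longrightarrow> C \<cdot> b = lam b *\<^sub>R b"
    using symmetric_eigenbasis[OF linear_mul_left, of C] adjC by (metis inner_mul_left)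
  \<comment> \<open>The quadratic form of \<open>T \<cdot> S\<close> sees only its self-adjoint part
    \<open>C\<close>.\<close>
  have lam': "b \<bullet> (T \<cdot> S \<cdot> b) = lam b" if b: "b \<in> B" for b
  proof -
    have "b \<bullet> (S \<cdot> T \<cdot> b) = (T \<cdot> S \<cdot> b) \<bullet> b"
      using inner_mul_left[of "T \<cdot> S" b b] by (simp add: adj_mul adjS adjT)
    then have "b \<bullet> (S \<cdot> T \<cdot> b) = b \<bullet> (T \<cdot> S \<cdot> b)" by (simp only: inner_commute)
    then have "b \<bullet> (C \<cdot> b) = b \<bullet> (T \<cdot> S \<cdot> b)"
      by (simp add: C_def mul.scaleR_left mul.add_left inner_add_right)
    then show ?thesis using lam[OF b] B(4)[OF b] by (simp add: dot_square_norm)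
  qed
  \<comment> \<open>Passing a lower bound to the infimum requires an admissible curve; the geodesic
    just built is one.\<close>
  have "norm w \<le> riem_dist M P Q"
    unfolding riem_dist_def
  proof (rule cInf_greatest)
    define g where "g = geo P v"
    define d where "d t = w \<cdot> g t - g t \<cdot> w" for t
    have gd: "(g has_vector_derivative d t) (at t)" for t
      using geo_deriv[OF P v] by (simp add: g_def d_def S_def[symmetric] vS)
    have cg: "continuous_on UNIV g"
      using gd has_vector_derivative_continuous by (meson continuous_at_imp_continuous_on)
    have cd: "continuous_on UNIV d"
      unfolding d_def[abs_def] by (intro continuous_on_diff mul.continuous_on cg continuous_on_const)
    have "g C1_differentiable_on {0..1}"
      unfolding C1_differentiable_on_def using gd continuous_on_subset[OF cd subset_UNIV] by blast
    then have "valid_path g" unfolding valid_path_def by (rule C1_differentiable_imp_piecewise)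
    moreover have "path_image g \<subseteq> M" using geo_in_M[OF P v] by (auto simp: path_image_def g_def)
    moreover have "pathstart g = P" "pathfinish g = Q"
      by (simp_all add: pathstart_def pathfinish_def g_def geo_0[OF P v] geo)
    moreover have "(\<lambda>t. norm (vector_derivative g (at t within {0..1}))) integrable_on {0..1}"
    proof (rule integrable_eq)
      show "(\<lambda>t. norm (d t)) integrable_on {0..1}"
        using cd by (intro integrable_continuous_interval continuous_on_norm) (rule continuous_on_subset, auto)
      show "norm (d t) = norm (vector_derivative g (at t within {0..1}))" if "t \<in> {0..1}" for t
        using vector_derivative_at_within_ivl[OF gd] that by auto
    qed
    ultimately show "{l. \<exists>g. valid_path g \<and> path_image g \<subseteq> M \<and> pathstart g = P \<and> pathfinish g = Q \<and>
           ((\<lambda>t. norm (vector_derivative g (at t within {0..1}))) has_integral l) {0..1}} \<noteq> {}"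
      unfolding integrable_on_def by blast
  next
    fix l assume "l \<in> {l. \<exists>g. valid_path g \<and> path_image g \<subseteq> M \<and> pathstart g = P \<and> pathfinish g = Q \<and>
           ((\<lambda>t. norm (vector_derivative g (at t within {0..1}))) has_integral l) {0..1}}"
    then obtain g where "valid_path g" "path_image g \<subseteq> M" "pathstart g = P" "pathfinish g = Q"
      "((\<lambda>t. norm (vector_derivative g (at t within {0..1}))) has_integral l) {0..1}" by blast
    then show "norm w \<le> l"
      using length_ge_norm_log[OF P Q w(1) B lam'[unfolded S_def T_def] ww[OF lam]] by blast
  qed
  moreover have "riem_dist M P Q \<le> norm v"
  proof -
    have "0 \<in> tspace P" by (rule subspace_0[OF subspace_tspace])
    moreover have "geo P 0 1 = P" using expo_scale[OF w(1), of 0 1] by (simp add: geo_def w(1))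
    ultimately show ?thesis using riem_dist_geo_le[OF P _ v, of 0] by (simp add: geo)
  qed
  ultimately show ?thesis using that v geo nv by simp
qed

end

section \<open>The comparison inequality\<close>

context projection_space
begin

lemma geo_zero_vector:
  assumes "P \<in> M"
  shows "geo P 0 1 = P"
proof -
  have "adj 0 = - 0" by (simp add: adj.zero)
  from expo_scale[OF this, of 0 1] expo_0[OF this] have "expo 0 1 = one" by simp
  then show ?thesis by (simp add: geo_def)
qed

lemma riem_dist_nonneg:
  assumes "P \<in> M" "Q \<in> M"
  shows "0 \<le> riem_dist M P Q"
proof -
  obtain v where "v \<in> tspace P" "geo P v 1 = Q" and v: "norm v = riem_dist M P Q"
    using minimal_geodesic_exists[OF assms] .
  show ?thesis unfolding v[symmetric] by (rule norm_ge_zero)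
qed

text \<open>Both points are lifted by minimal geodesics to the tangent space at \<open>X\<close>,
  where the norm satisfies the triangle inequality. Both distances on the right start at
  \<open>X\<close>, so that symmetry can be deduced from this form.\<close>

lemma riem_dist_triangle_from:
  assumes X: "X \<in> M" and P: "P \<in> M" and Q: "Q \<in> M"
  shows "riem_dist M P Q \<le> riem_dist M X P + riem_dist M X Q"
proof -
  obtain u where u: "u \<in> tspace X" "geo X u 1 = P" "norm u = riem_dist M X P"
    using minimal_geodesic_exists[OF X P] .
  obtain v where v: "v \<in> tspace X" "geo X v 1 = Q" "norm v = riem_dist M X Q"
    using minimal_geodesic_exists[OF X Q] .
  have "riem_dist M P Q \<le> norm (u - v)" using riem_dist_geo_le[OF X u(1) v(1)] by (simp only: u v)
  also have "\<dots> \<le> norm u + norm v" by (rule norm_triangle_ineq4)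
  finally show ?thesis by (simp only: u v)
qed

lemma riem_dist_self:
  assumes "P \<in> M"
  shows "riem_dist M P P = 0"
proof -
  have "0 \<in> tspace P" by (rule subspace_0[OF subspace_tspace])
  then have "riem_dist M P P \<le> 0"
    using riem_dist_geo_le[OF assms, of 0 0] by (simp add: geo_zero_vector[OF assms])
  then show ?thesis using riem_dist_nonneg[OF assms assms] by simp
qed

lemma riem_dist_sym:
  assumes "P \<in> M" "Q \<in> M"
  shows "riem_dist M P Q = riem_dist M Q P"
  using riem_dist_triangle_from[OF assms(1,2,1)] riem_dist_triangle_from[OF assms(2,1,2)]
  by (simp add: riem_dist_self[OF assms(1)] riem_dist_self[OF assms(2)])

section \<open>Comparison along a geodesic\<close>

lemma geo_scaleR:
  assumes "P \<in> M" "v \<in> tspace P"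
  shows "geo P (s *\<^sub>R v) 1 = geo P v s"
  using expo_scale[OF skew_tspace[OF assms], of s 1] by (simp add: geo_def mul.scaleR_left)

text \<open>The generator \<open>w\<close> is unchanged along the geodesic, so the velocity at the
  new point is \<open>w\<close> times the reflection there, with the same norm.\<close>

lemma geo_restart:
  assumes P: "P \<in> M" and v: "v \<in> tspace P"
  obtains v' where "v' \<in> tspace (geo P v t)" "norm v' = norm v"
    "\<And>h. geo (geo P v t) (h *\<^sub>R v') 1 = geo P v (t + h)"
proof -
  define w where "w = v \<cdot> refl_of P"
  define X where "X = geo P v t"
  define R where "R = refl_of X"
  have w: "adj w = - w" unfolding w_def using P v by (rule skew_tspace)
  have X: "X \<in> M" unfolding X_def by (rule geo_in_M[OF P v])
  have RR: "R \<cdot> R = one" and adjR: "adj R = R" using refl_of_sq[OF X] adj_refl_of[OF X] by (simp_all add: R_def)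
  have wR: "w \<cdot> R = - (R \<cdot> w)" using expo_tspace_commute[OF P v] by (simp add: w_def R_def X_def)
  define v' where "v' = w \<cdot> R"
  have v'R: "v' \<cdot> R = w" by (simp add: v'_def mul_assoc RR)
  have "R \<cdot> v' = - w"
  proof -
    have "R \<cdot> v' = R \<cdot> w \<cdot> R" by (simp add: v'_def mul_assoc)
    also have "R \<cdot> w = - (w \<cdot> R)" by (simp add: wR)
    finally show ?thesis by (simp add: mul.minus_left mul_assoc RR)
  qed
  moreover have "adj v' = v'" by (simp add: v'_def adj_mul w adjR mul.minus_right) (simp add: wR)
  ultimately have v': "v' \<in> tspace X" by (simp add: tspace_def R_def[symmetric] v'R)
  have "norm v' = norm v"
    unfolding v'_def using norm_tspace[OF P, of v] by (simp add: norm_mul_coisometry adjR RR w_def)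
  moreover have "geo X (h *\<^sub>R v') 1 = geo P v (t + h)" for h
  proof -
    have "geo X (h *\<^sub>R v') 1 = expo w h \<cdot> X \<cdot> adj (expo w h)"
      unfolding geo_scaleR[OF X v'] by (simp add: geo_def R_def[symmetric] v'R)
    also have "\<dots> = expo w h \<cdot> (expo w t \<cdot> P \<cdot> adj (expo w t)) \<cdot> adj (expo w h)"
      by (simp only: X_def geo_def w_def)
    also have "expo w h \<cdot> (expo w t \<cdot> P \<cdot> adj (expo w t)) \<cdot> adj (expo w h)
        = (expo w h \<cdot> expo w t) \<cdot> P \<cdot> adj (expo w h \<cdot> expo w t)"
      by (simp only: adj_mul mul_assoc)
    also have "expo w h \<cdot> expo w t = expo w (t + h)" by (simp only: expo_add[OF w, symmetric] add.commute)
    finally show ?thesis by (simp only: geo_def w_def)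
  qed
  ultimately show ?thesis using that v' by (simp only: X_def)
qed

text \<open>Stewart's formula holds as an inequality: compare the two hinges at the point of the
  geodesic that share a minimal geodesic to \<open>Q\<close>; the terms with the angles cancel.\<close>

lemma stewart_inequality:
  assumes P: "P \<in> M" and v: "v \<in> tspace P" and Q: "Q \<in> M" and t: "0 \<le> t" "t \<le> 1"
  shows "(1 - t) * (riem_dist M P Q)\<^sup>2 + t * (riem_dist M (geo P v 1) Q)\<^sup>2 - t * (1 - t) * (norm v)\<^sup>2
    \<le> (riem_dist M (geo P v t) Q)\<^sup>2"
proof -
  define X where "X = geo P v t"
  have X: "X \<in> M" unfolding X_def by (rule geo_in_M[OF P v])
  obtain v' where v': "v' \<in> tspace X" "norm v' = norm v"
    and shift: "\<And>h. geo X (h *\<^sub>R v') 1 = geo P v (t + h)"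
    using geo_restart[OF P v, of t] unfolding X_def by blast
  obtain w where w: "w \<in> tspace X" "geo X w 1 = Q" "norm w = riem_dist M X Q"
    using minimal_geodesic_exists[OF X Q] .
  have le: "riem_dist M (geo P v (t + h)) Q \<le> norm (h *\<^sub>R v' - w)" for h
    using riem_dist_geo_le[OF X subspace_scale[OF subspace_tspace v'(1)] w(1), of h] by (simp only: shift w(2))
  have sq: "(riem_dist M (geo P v (t + h)) Q)\<^sup>2 \<le> h\<^sup>2 * (norm v)\<^sup>2 - 2 * h * (v' \<bullet> w) + (norm w)\<^sup>2" for h
  proof -
    have "(riem_dist M (geo P v (t + h)) Q)\<^sup>2 \<le> (norm (h *\<^sub>R v' - w))\<^sup>2"
      by (rule power_mono[OF le riem_dist_nonneg[OF geo_in_M[OF P v] Q]])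
    also have "\<dots> = h\<^sup>2 * (norm v')\<^sup>2 - 2 * h * (v' \<bullet> w) + (norm w)\<^sup>2"
      unfolding power2_norm_eq_inner
      by (simp add: inner_diff_left inner_diff_right inner_commute[of w v'] power2_eq_square[of h]
          algebra_simps)
    finally show ?thesis by (simp only: v'(2))
  qed
  have 0: "(riem_dist M P Q)\<^sup>2 \<le> t\<^sup>2 * (norm v)\<^sup>2 + 2 * t * (v' \<bullet> w) + (norm w)\<^sup>2"
    using sq[of "- t"] by (simp add: geo_0[OF P v])
  have 1: "(riem_dist M (geo P v 1) Q)\<^sup>2 \<le> (1 - t)\<^sup>2 * (norm v)\<^sup>2 - 2 * (1 - t) * (v' \<bullet> w) + (norm w)\<^sup>2"
    using sq[of "1 - t"] by simp
  \<comment> \<open>The shifts \<open>- t\<close> and \<open>1 - t\<close> carry the weights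
    \<open>1 - t\<close> and \<open>t\<close>, for which the terms in \<open>v' \<bullet> w\<close>
    cancel.\<close>
  have "(1 - t) * (riem_dist M P Q)\<^sup>2 + t * (riem_dist M (geo P v 1) Q)\<^sup>2
      \<le> (1 - t) * (t\<^sup>2 * (norm v)\<^sup>2 + 2 * t * (v' \<bullet> w) + (norm w)\<^sup>2)
        + t * ((1 - t)\<^sup>2 * (norm v)\<^sup>2 - 2 * (1 - t) * (v' \<bullet> w) + (norm w)\<^sup>2)"
    by (intro add_mono mult_left_mono 0 1) (use t in auto)
  also have "\<dots> = t * (1 - t) * (norm v)\<^sup>2 + (norm w)\<^sup>2"
    by (simp add: power2_eq_square algebra_simps)
  finally show ?thesis by (simp add: w(3) X_def)
qed

text \<open>Stewart's inequality is applied to the side from \<open>A\<close> to \<open>C\<close>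
  seen from \<open>X\<close>, then to the side from \<open>A\<close> to \<open>B\<close> seen from
  \<open>C\<close>, which bounds the distance of \<open>C\<close> and \<open>X\<close> in the
  former. Once the distance of \<open>A\<close> and \<open>X\<close> is at least
  \<open>t * norm b\<close>, everything cancels except the square of
  \<open>t * riem_dist M B C\<close>.\<close>

lemma riem_dist_geo_ge:
  assumes A: "A \<in> M" and b: "b \<in> tspace A" "norm b = riem_dist M A (geo A b 1)"
    and c: "c \<in> tspace A" "norm c = riem_dist M A (geo A c 1)" and t: "0 \<le> t" "t \<le> 1"
  shows "t * riem_dist M (geo A b 1) (geo A c 1) \<le> riem_dist M (geo A b t) (geo A c t)"
proof -
  define B where "B = geo A b 1"
  define C where "C = geo A c 1"
  define X where "X = geo A b t"
  define Y where "Y = geo A c t"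
  have BM: "B \<in> M" and CM: "C \<in> M" and XM: "X \<in> M" and YM: "Y \<in> M"
    unfolding B_def C_def X_def Y_def using geo_in_M[OF A] b(1) c(1) by blast+
  have s1: "(1 - t) * (riem_dist M A X)\<^sup>2 + t * (riem_dist M C X)\<^sup>2 - t * (1 - t) * (norm c)\<^sup>2
      \<le> (riem_dist M Y X)\<^sup>2"
    using stewart_inequality[OF A c(1) XM t] unfolding C_def Y_def .
  have s2: "(1 - t) * (riem_dist M A C)\<^sup>2 + t * (riem_dist M B C)\<^sup>2 - t * (1 - t) * (norm b)\<^sup>2
      \<le> (riem_dist M X C)\<^sup>2"
    using stewart_inequality[OF A b(1) CM t] unfolding B_def X_def .
  \<comment> \<open>An initial piece of a minimal geodesic is minimal: the rest has length at most
    \<open>(1 - t) * norm b\<close>, and a shorter way to \<open>X\<close> would shorten the way to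
    \<open>B\<close>.\<close>
  have AX: "t * norm b \<le> riem_dist M A X"
  proof -
    obtain b' where b': "b' \<in> tspace X" "norm b' = norm b"
      and shift: "\<And>h. geo X (h *\<^sub>R b') 1 = geo A b (t + h)"
      using geo_restart[OF A b(1), of t] unfolding X_def by blast
    have "geo X ((1 - t) *\<^sub>R b') 1 = B" using shift[of "1 - t"] by (simp add: B_def)
    moreover have "geo X (0 *\<^sub>R b') 1 = X" using shift[of 0] by (simp add: X_def)
    ultimately have "riem_dist M X B \<le> norm (0 *\<^sub>R b' - (1 - t) *\<^sub>R b')"
      using riem_dist_geo_le[OF XM subspace_scale[OF subspace_tspace b'(1), of 0]
          subspace_scale[OF subspace_tspace b'(1), of "1 - t"]] by simp
    then have "riem_dist M X B \<le> (1 - t) * norm b" using t b'(2) by simp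
    moreover have "riem_dist M A B \<le> riem_dist M X A + riem_dist M X B"
      by (rule riem_dist_triangle_from[OF XM A BM])
    ultimately show ?thesis
      using b(2) riem_dist_sym[OF XM A] by (simp add: B_def[symmetric] algebra_simps)
  qed
  have AX2: "(1 - t) * (t * norm b)\<^sup>2 \<le> (1 - t) * (riem_dist M A X)\<^sup>2"
    using t AX by (intro mult_left_mono power_mono) auto
  have s2': "t * ((1 - t) * (norm c)\<^sup>2 + t * (riem_dist M B C)\<^sup>2 - t * (1 - t) * (norm b)\<^sup>2)
      \<le> t * (riem_dist M C X)\<^sup>2"
    using s2 t c(2) riem_dist_sym[OF CM XM] by (intro mult_left_mono) (auto simp: C_def)
  have "(t * riem_dist M B C)\<^sup>2 = (1 - t) * (t * norm b)\<^sup>2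
      + t * ((1 - t) * (norm c)\<^sup>2 + t * (riem_dist M B C)\<^sup>2 - t * (1 - t) * (norm b)\<^sup>2)
      - t * (1 - t) * (norm c)\<^sup>2"
    by (simp add: power2_eq_square algebra_simps)
  also have "\<dots> \<le> (riem_dist M Y X)\<^sup>2" using AX2 s2' s1 by linarith
  finally have "t * riem_dist M B C \<le> riem_dist M Y X"
    by (rule power2_le_imp_le) (rule riem_dist_nonneg[OF YM XM])
  then show ?thesis using riem_dist_sym[OF YM XM] by (simp add: B_def C_def X_def Y_def)
qed

text \<open>The minimal initial vector fits the description defining \<open>riem_log\<close>. Any
  other candidate lies with it in a ball on which the exponential map is injective, because both
  norms are below the injectivity radius.\<close>

lemma riem_log_minimal:
  assumes A: "A \<in> M" and B: "B \<in> M" and inj: "ereal (riem_dist M A B) < inj_radius M"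
  shows "riem_log M A B \<in> tspace A" "geo A (riem_log M A B) 1 = B"
    "norm (riem_log M A B) = riem_dist M A B"
proof -
  obtain v where v: "v \<in> tspace A" "geo A v 1 = B" "norm v = riem_dist M A B"
    using minimal_geodesic_exists[OF A B] .
  have "riem_log M A B = v"
    unfolding riem_log_def tangent_space_eq[OF A]
  proof (rule the_equality)
    show "v \<in> tspace A \<and> ereal (norm v) < inj_radius M \<and> riem_exp M A v = B"
      using v inj by (simp add: riem_exp_eq[OF A])
  next
    fix u assume u: "u \<in> tspace A \<and> ereal (norm u) < inj_radius M \<and> riem_exp M A u = B"
    have "inj_radius M \<le> inj_radius_at M A" unfolding inj_radius_def by (rule INF_lower[OF A])
    then have "ereal (max (norm u) (norm v)) < inj_radius_at M A"
      using u v(3) inj by (auto simp: max_def intro: less_le_trans)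
    then obtain R where R: "diffeo_onto_image (tspace A \<inter> ball 0 R) (riem_exp M A)"
       "max (norm u) (norm v) < R"
      unfolding inj_radius_at_def less_SUP_iff tangent_space_eq[OF A] by auto
    then have "inj_on (riem_exp M A) (tspace A \<inter> ball 0 R)" by (simp add: diffeo_onto_image_def)
    moreover have "riem_exp M A u = riem_exp M A v" using u v by (simp add: riem_exp_eq[OF A])
    moreover have "u \<in> tspace A \<inter> ball 0 R" "v \<in> tspace A \<inter> ball 0 R" using u v R by auto
    ultimately show "u = v" by (rule inj_onD)
  qed
  then show "riem_log M A B \<in> tspace A" "geo A (riem_log M A B) 1 = B"
    "norm (riem_log M A B) = riem_dist M A B" using v by simp_all
qed

theorem geom_mean_expands:
  assumes P: "P \<in> M" and s: "ereal s < convexity_bound M"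
    and A: "A \<in> riem_ball M P s" and B: "B \<in> riem_ball M P s" and C: "C \<in> riem_ball M P s"
    and t: "t \<in> {0..1}"
  shows "riem_dist M (geom_mean M t A B) (geom_mean M t A C) \<ge> t * riem_dist M B C"
proof -
  have s': "ereal s < inj_radius M / 2" using s by (simp add: convexity_bound_def)
  have AM: "A \<in> M" using A by (simp add: riem_ball_def)
  \<comment> \<open>This is where half the injectivity radius is needed: the triangle inequality
    through the centre doubles \<open>s\<close>.\<close>
  have inj: "ereal (riem_dist M A D) < inj_radius M" if D: "D \<in> riem_ball M P s" for D
  proof -
    have "riem_dist M A D \<le> riem_dist M P A + riem_dist M P D"
      using D A by (intro riem_dist_triangle_from P) (auto simp: riem_ball_def)
    also have "\<dots> < 2 * s" using A D by (simp add: riem_ball_def)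
    finally show ?thesis using s' by (cases "inj_radius M") auto
  qed
  have mean: "geom_mean M t A D = geo A (riem_log M A D) t" if D: "D \<in> riem_ball M P s" for D
  proof -
    have "D \<in> M" using D by (simp add: riem_ball_def)
    then have v: "riem_log M A D \<in> tspace A" using riem_log_minimal(1)[OF AM _ inj[OF D]] by blast
    then show ?thesis
      unfolding geom_mean_def
      by (subst riem_exp_eq[OF AM subspace_scale[OF subspace_tspace v]]) (rule geo_scaleR[OF AM v])
  qed
  have BM: "B \<in> M" and CM: "C \<in> M" using B C by (auto simp: riem_ball_def)
  note b = riem_log_minimal[OF AM BM inj[OF B]] and c = riem_log_minimal[OF AM CM inj[OF C]]
  have "t * riem_dist M (geo A (riem_log M A B) 1) (geo A (riem_log M A C) 1)
      \<le> riem_dist M (geo A (riem_log M A B) t) (geo A (riem_log M A C) t)"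
    by (rule riem_dist_geo_ge[OF AM b(1) _ c(1)]) (use b c t in simp_all)
  then show ?thesis by (simp only: mean[OF B] mean[OF C] b(2) c(2))
qed

end

section \<open>Matrices\<close>

text \<open>With a basis chosen among the rows, the matrix factors through coordinates on its row
  space. Idempotence gives each basis vector the diagonal contribution 1, so the trace counts the
  basis.\<close>

lemma trace_idempotent:
  fixes A :: "'f::field^'n^'n"
  assumes A: "A ** A = A"
  shows "trace A = of_nat (rank A)"
proof -
  obtain B where B: "B \<subseteq> rows A" "vec.independent B" "rows A \<subseteq> vec.span B" "card B = vec.dim (rows A)"
    using vec.basis_exists by blast
  have fin: "finite B" using B(2) vec.independent_bound_general vec.finiteI_independent by blast
  define y where "y i b = vec.representation B (A $ i) b" for i b
  have row: "A $ i \<in> vec.span B" for i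
    using B(3) by (auto simp: rows_def row_def vec_nth_inverse)
  have Ai: "(\<Sum>b\<in>B. y i b *s b) = A $ i" for i
    unfolding y_def by (rule vec.sum_representation_eq[OF B(2) row fin order_refl])
  \<comment> \<open>The vector \<open>b\<close> is a row of \<open>A\<close>, so
    \<open>A ** A = A\<close> expresses it through all rows with its own entries as coefficients;
    comparing coordinates at \<open>b\<close> gives the claim.\<close>
  have coeff: "(\<Sum>i\<in>UNIV. b $ i * y i b) = 1" if b: "b \<in> B" for b
  proof -
    obtain j where j: "b = A $ j" using B(1) b by (auto simp: rows_def row_def vec_nth_inverse)
    have "(\<Sum>i\<in>UNIV. A $ j $ i *s A $ i) = (A ** A) $ j"
      by (simp add: vec_eq_iff matrix_matrix_mult_def)
    then have bA: "(\<Sum>i\<in>UNIV. b $ i *s A $ i) = b" by (simp add: A j)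
    have "vec.representation B (\<Sum>i\<in>UNIV. b $ i *s A $ i) b = (\<Sum>i\<in>UNIV. b $ i * y i b)"
      using vec.representation_sum[OF B(2), of UNIV "\<lambda>i. b $ i *s A $ i"]
        vec.representation_scale[OF B(2) row] vec.span_scale[OF row]
      by (simp add: y_def)
    then show ?thesis using vec.representation_basis[OF B(2) b] by (simp add: bA)
  qed
  have "trace A = (\<Sum>i\<in>UNIV. (\<Sum>b\<in>B. y i b *s b) $ i)" by (simp add: trace_def Ai)
  also have "\<dots> = (\<Sum>b\<in>B. \<Sum>i\<in>UNIV. b $ i * y i b)"
    by (simp add: mult.commute) (rule sum.swap)
  also have "\<dots> = of_nat (card B)" by (simp add: coeff)
  finally show ?thesis by (simp add: B(4) row_rank_def_gen)
qed

lemma sum_Basis_vec: "(\<Sum>b\<in>(Basis :: ('b::euclidean_space^'n) set). f b) = (\<Sum>i\<in>UNIV. \<Sum>u\<in>Basis. f (axis i u))"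
proof -
  let ?h = "\<lambda>x. axis (fst x) (snd x) :: 'b^'n"
  have eq: "(Basis :: ('b^'n) set) = ?h ` (UNIV \<times> Basis)"
    by (force simp: Basis_vec_def)
  have inj: "inj_on ?h (UNIV \<times> Basis)"
    by (auto simp: inj_on_def axis_eq_axis)
  show ?thesis
    unfolding eq sum.reindex[OF inj] by (simp add: sum.cartesian_product split_def)
qed

lemma matrix_mult_nth: "(A ** B) $ i $ j = (\<Sum>k\<in>UNIV. A $ i $ k * B $ k $ j)"
  by (simp add: matrix_matrix_mult_def)

lemma norm_vec_sq: "(norm (x :: 'b::real_inner^'n))\<^sup>2 = (\<Sum>i\<in>UNIV. (norm (x $ i))\<^sup>2)"
  by (simp add: power2_norm_eq_inner inner_vec_def)

text \<open>Instantiated by the identity on the reals and by complex conjugation, so that one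
  computation serves both fields.\<close>

locale field_conjugation =
  fixes cj :: "'f::{euclidean_space, real_normed_field} \<Rightarrow> 'f"
  assumes linear_cj: "linear cj"
    and cj_cj: "cj (cj a) = a"
    and cj_mult: "cj (a * b) = cj a * cj b"
    and inner_mult: "(a * b) \<bullet> c = b \<bullet> (cj a * c)"
begin

definition adjoint_matrix :: "'f^'n^'n \<Rightarrow> 'f^'n^'n" where
  "adjoint_matrix A = map_matrix cj (transpose A)"

lemma adjoint_matrix_nth: "adjoint_matrix A $ i $ j = cj (A $ j $ i)"
  by (simp add: adjoint_matrix_def transpose_def)

lemma cj_sum: "cj (sum f S) = (\<Sum>i\<in>S. cj (f i))"
  by (rule linear_sum[OF linear_cj])

lemma star_algebra_matrix:
  "star_algebra ((**) :: 'f^'n^'n \<Rightarrow> 'f^'n^'n \<Rightarrow> 'f^'n^'n) (mat 1) adjoint_matrix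
     (real CARD('n) * real DIM('f))"
proof (rule star_algebra.intro)
  show "bounded_bilinear ((**) :: 'f^'n^'n \<Rightarrow> 'f^'n^'n \<Rightarrow> 'f^'n^'n)"
    unfolding bilinear_conv_bounded_bilinear[symmetric] bilinear_def
  proof (intro conjI allI linearI)
    fix x y z :: "'f^'n^'n" and r :: real
    show "x ** (y + z) = x ** y + x ** z" by (rule matrix_add_ldistrib)
    show "(x + y) ** z = x ** z + y ** z" by (simp add: vec_eq_iff matrix_matrix_mult_def distrib_right sum.distrib)
    show "x ** (r *\<^sub>R y) = r *\<^sub>R (x ** y)"
      by (simp add: vec_eq_iff matrix_matrix_mult_def scaleR_sum_right)
    show "(r *\<^sub>R x) ** y = r *\<^sub>R (x ** y)"
      by (simp add: vec_eq_iff matrix_matrix_mult_def scaleR_sum_right)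
  qed
  fix x y z :: "'f^'n^'n"
  show "x ** y ** z = x ** (y ** z)" by (simp only: matrix_mul_assoc)
  show "mat 1 ** x = x" "x ** mat 1 = x" by simp_all
  show "linear (adjoint_matrix :: 'f^'n^'n \<Rightarrow> 'f^'n^'n)"
    by (rule linearI) (simp_all add: vec_eq_iff adjoint_matrix_nth linear_add[OF linear_cj] linear_cmul[OF linear_cj])
  show "adjoint_matrix (adjoint_matrix x) = x" by (simp add: vec_eq_iff adjoint_matrix_nth cj_cj)
  show "adjoint_matrix (x ** y) = adjoint_matrix y ** adjoint_matrix x"
    by (simp add: vec_eq_iff adjoint_matrix_nth matrix_matrix_mult_def cj_sum cj_mult mult.commute)
  show "(x ** y) \<bullet> z = y \<bullet> (adjoint_matrix x ** z)"
  proof -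
    have "(x ** y) \<bullet> z = (\<Sum>i\<in>UNIV. \<Sum>j\<in>UNIV. \<Sum>k\<in>UNIV. (y $ k $ j) \<bullet> (cj (x $ i $ k) * z $ i $ j))"
      by (simp add: inner_vec_def matrix_matrix_mult_def inner_sum_left inner_mult)
    also have "\<dots> = (\<Sum>j\<in>UNIV. \<Sum>i\<in>UNIV. \<Sum>k\<in>UNIV. (y $ k $ j) \<bullet> (cj (x $ i $ k) * z $ i $ j))"
      by (rule sum.swap)
    also have "\<dots> = (\<Sum>j\<in>UNIV. \<Sum>k\<in>UNIV. \<Sum>i\<in>UNIV. (y $ k $ j) \<bullet> (cj (x $ i $ k) * z $ i $ j))"
      by (intro sum.cong refl sum.swap)
    also have "\<dots> = (\<Sum>k\<in>UNIV. \<Sum>j\<in>UNIV. \<Sum>i\<in>UNIV. (y $ k $ j) \<bullet> (cj (x $ i $ k) * z $ i $ j))"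
      by (rule sum.swap)
    also have "\<dots> = y \<bullet> (adjoint_matrix x ** z)"
      by (simp add: inner_vec_def matrix_matrix_mult_def adjoint_matrix_nth inner_sum_right)
    finally show ?thesis .
  qed
  show "(x ** y) \<bullet> z = x \<bullet> (z ** adjoint_matrix y)"
  proof -
    have "(a * b) \<bullet> c = a \<bullet> (c * cj b)" for a b c
      by (metis inner_mult mult.commute)
    then have "(x ** y) \<bullet> z = (\<Sum>i\<in>UNIV. \<Sum>j\<in>UNIV. \<Sum>k\<in>UNIV. (x $ i $ k) \<bullet> (z $ i $ j * cj (y $ k $ j)))"
      by (simp add: inner_vec_def matrix_matrix_mult_def inner_sum_left)
    also have "\<dots> = (\<Sum>i\<in>UNIV. \<Sum>k\<in>UNIV. \<Sum>j\<in>UNIV. (x $ i $ k) \<bullet> (z $ i $ j * cj (y $ k $ j)))"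
      by (intro sum.cong refl sum.swap)
    also have "\<dots> = x \<bullet> (z ** adjoint_matrix y)"
      by (simp add: inner_vec_def matrix_matrix_mult_def adjoint_matrix_nth inner_sum_right)
    finally show ?thesis .
  qed
  show "x = 0 \<or> y = 0" if h: "\<And>z. x ** z ** y = 0"
  proof (rule ccontr)
    assume "\<not> (x = 0 \<or> y = 0)"
    then obtain a b c d where ne: "x $ a $ b \<noteq> 0" "y $ c $ d \<noteq> 0" by (auto simp: vec_eq_iff)
    \<comment> \<open>The matrix unit at (b, c) isolates the product of two nonzero entries.\<close>
    let ?z = "axis b (axis c 1) :: 'f^'n^'n"
    have 1: "(x ** ?z) $ a $ k = (if k = c then x $ a $ b else 0)" for k
    proof -
      have "(x ** ?z) $ a $ k = (\<Sum>m\<in>UNIV. if m = b then (if k = c then x $ a $ b else 0) else 0)"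
        unfolding matrix_mult_nth by (intro sum.cong refl) (simp add: axis_def)
      then show ?thesis by simp
    qed
    have "(x ** ?z ** y) $ a $ d = (\<Sum>k\<in>UNIV. (if k = c then x $ a $ b else 0) * y $ k $ d)"
      by (subst matrix_mult_nth) (simp only: 1)
    also have "\<dots> = (\<Sum>k\<in>UNIV. if k = c then x $ a $ b * y $ c $ d else 0)"
      by (intro sum.cong refl) simp
    finally have "(x ** ?z ** y) $ a $ d = x $ a $ b * y $ c $ d" by simp
    then show False using h[of ?z] ne by simp
  qed
  show "0 < real CARD('n) * real DIM('f)" by simp
  show "(\<Sum>b\<in>(Basis :: ('f^'n^'n) set). (norm (x ** b))\<^sup>2) = real CARD('n) * real DIM('f) * (norm x)\<^sup>2"
  proof -
    \<comment> \<open>Multiplying by a basis matrix moves column \<open>i\<close> of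
      \<open>x\<close> to column \<open>j\<close>, up to a scalar of norm 1. Each column is thus
      counted once for every \<open>j\<close> and every basis element of the field.\<close>
    have e: "(norm (x ** axis i (axis j u)))\<^sup>2 = (\<Sum>r\<in>UNIV. (norm (x $ r $ i))\<^sup>2)" if u: "u \<in> Basis" for i j and u :: 'f
    proof -
      have nth: "(x ** axis i (axis j u)) $ r $ s = (if s = j then x $ r $ i * u else 0)" for r s
      proof -
        have "(x ** axis i (axis j u)) $ r $ s = (\<Sum>m\<in>UNIV. if m = i then (if s = j then x $ r $ i * u else 0) else 0)"
          unfolding matrix_mult_nth by (intro sum.cong refl) (simp add: axis_def)
        then show ?thesis by simp
      qed
      have "(norm (x ** axis i (axis j u)))\<^sup>2
          = (\<Sum>r\<in>UNIV. \<Sum>s\<in>UNIV. if s = j then (norm (x $ r $ i))\<^sup>2 else 0)"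
        unfolding norm_vec_sq nth by (intro sum.cong refl) (simp add: norm_mult norm_Basis[OF u])
      then show ?thesis by simp
    qed
    have "(\<Sum>b\<in>(Basis :: ('f^'n^'n) set). (norm (x ** b))\<^sup>2)
        = (\<Sum>i\<in>UNIV. \<Sum>j\<in>(UNIV::'n set). \<Sum>u\<in>(Basis::'f set). \<Sum>r\<in>UNIV. (norm (x $ r $ i))\<^sup>2)"
      unfolding sum_Basis_vec by (simp only: e cong: sum.cong)
    also have "\<dots> = real CARD('n) * real DIM('f) * (\<Sum>i\<in>UNIV. \<Sum>r\<in>UNIV. (norm (x $ r $ i))\<^sup>2)"
      by (simp add: sum_distrib_left mult.assoc)
    also have "(\<Sum>i\<in>UNIV. \<Sum>r\<in>UNIV. (norm (x $ r $ i))\<^sup>2) = (norm x)\<^sup>2"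
      unfolding norm_vec_sq by (rule sum.swap)
    finally show ?thesis .
  qed
qed

text \<open>For idempotents trace and rank determine each other, the field being of characteristic
  0. Conjugation preserves the trace by cyclicity, hence also the rank.\<close>

lemma projection_space_Gr:
  "projection_space ((**) :: 'f^'n^'n \<Rightarrow> 'f^'n^'n \<Rightarrow> 'f^'n^'n) (mat 1) adjoint_matrix
     (real CARD('n) * real DIM('f)) {P. P ** P = P \<and> adjoint_matrix P = P \<and> rank P = k}"
proof -
  interpret star_algebra "(**) :: 'f^'n^'n \<Rightarrow> 'f^'n^'n \<Rightarrow> 'f^'n^'n" "mat 1" adjoint_matrix
    "real CARD('n) * real DIM('f)" by (rule star_algebra_matrix)
  show ?thesis
  proof
    fix P Q :: "'f^'n^'n"
    assume P: "P \<in> {P. P ** P = P \<and> adjoint_matrix P = P \<and> rank P = k}"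
    then show "projection P" by (simp add: projection_def)
    {
      fix u :: "'f^'n^'n" assume u: "adjoint_matrix u ** u = mat 1"
      let ?Q = "u ** P ** adjoint_matrix u"
      have "?Q ** ?Q = u ** P ** (adjoint_matrix u ** u) ** P ** adjoint_matrix u"
        by (simp only: matrix_mul_assoc)
      also have "\<dots> = u ** (P ** P) ** adjoint_matrix u" by (simp only: u mul_one mul_assoc)
      finally have QQ: "?Q ** ?Q = ?Q" using P by simp
      have "trace ?Q = trace (adjoint_matrix u ** u ** P)"
        using trace_mul_sym[of "u ** P" "adjoint_matrix u"] by (simp only: mul_assoc)
      then have "(of_nat (rank ?Q) :: 'f) = of_nat (rank P)"
        using trace_idempotent[OF QQ] trace_idempotent[of P] P u by simp
      then have "rank ?Q = rank P" by simp
      moreover have "adjoint_matrix ?Q = ?Q" using P by (simp add: adj_mul mul_assoc)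
      ultimately show "?Q \<in> {P. P ** P = P \<and> adjoint_matrix P = P \<and> rank P = k}" using QQ P by simp
    }
    have tr: "mat 1 \<bullet> X = 1 \<bullet> trace X" for X :: "'f^'n^'n"
    proof -
      have "(mat 1 :: 'f^'n^'n) \<bullet> X = (\<Sum>i\<in>UNIV. \<Sum>j\<in>UNIV. if j = i then 1 \<bullet> X $ i $ j else 0)"
        unfolding inner_vec_def by (intro sum.cong refl) (simp add: mat_def)
      then show ?thesis by (simp add: trace_def inner_sum_right)
    qed
    assume "Q \<in> {P. P ** P = P \<and> adjoint_matrix P = P \<and> rank P = k}"
    then show "mat 1 \<bullet> P = mat 1 \<bullet> Q"
      using P trace_idempotent[of P] trace_idempotent[of Q] by (simp add: tr)
  qed
qed

end

lemma projection_space_Gr_real: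
  "projection_space ((**) :: real^'n^'n \<Rightarrow> real^'n^'n \<Rightarrow> real^'n^'n) (mat 1) transpose
     (real CARD('n)) (Gr_real k)"
proof -
  interpret field_conjugation "\<lambda>a::real. a" by unfold_locales (auto simp: linear_id[unfolded id_def])
  have "adjoint_matrix = (transpose :: real^'n^'n \<Rightarrow> real^'n^'n)"
    by (rule ext) (simp add: vec_eq_iff adjoint_matrix_nth transpose_def)
  then show ?thesis using projection_space_Gr[where ?'n = 'n, of k] by (simp add: Gr_real_def)
qed

lemma projection_space_Gr_complex:
  "projection_space ((**) :: complex^'n^'n \<Rightarrow> complex^'n^'n \<Rightarrow> complex^'n^'n) (mat 1)
     (\<lambda>A. map_matrix cnj (transpose A)) (2 * real CARD('n)) (Gr_complex k)"
proof -
  interpret field_conjugation cnj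
  proof (rule field_conjugation.intro)
    show "linear cnj" by (rule bounded_linear.linear[OF bounded_linear_cnj])
    show "(a * b) \<bullet> c = b \<bullet> (cnj a * c)" for a b c :: complex
      by (simp add: inner_complex_def algebra_simps)
  qed auto
  have "adjoint_matrix = (\<lambda>A::complex^'n^'n. map_matrix cnj (transpose A))"
    by (rule ext) (simp add: adjoint_matrix_def)
  then show ?thesis using projection_space_Gr[where ?'n = 'n, of k] by (simp add: Gr_complex_def mult.commute)
qed

theorem theorem3p2:
  fixes k :: nat
  shows
    "(\<forall>(P :: real^'n^'n) \<in> Gr_real k. \<forall>s. ereal s < convexity_bound (Gr_real k :: (real^'n^'n) set) \<longrightarrow>
       (\<forall>A \<in> riem_ball (Gr_real k) P s. \<forall>B \<in> riem_ball (Gr_real k) P s.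
        \<forall>C \<in> riem_ball (Gr_real k) P s. \<forall>t \<in> {0..1}.
          riem_dist (Gr_real k) (geom_mean (Gr_real k) t A B) (geom_mean (Gr_real k) t A C)
            \<ge> t * riem_dist (Gr_real k) B C)) \<and>
     (\<forall>(P :: complex^'n^'n) \<in> Gr_complex k. \<forall>s. ereal s < convexity_bound (Gr_complex k :: (complex^'n^'n) set) \<longrightarrow>
       (\<forall>A \<in> riem_ball (Gr_complex k) P s. \<forall>B \<in> riem_ball (Gr_complex k) P s.
        \<forall>C \<in> riem_ball (Gr_complex k) P s. \<forall>t \<in> {0..1}.
          riem_dist (Gr_complex k) (geom_mean (Gr_complex k) t A B) (geom_mean (Gr_complex k) t A C)
            \<ge> t * riem_dist (Gr_complex k) B C))"
  using projection_space.geom_mean_expands[OF projection_space_Gr_real[of k]]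
    projection_space.geom_mean_expands[OF projection_space_Gr_complex[of k]]
  by (intro conjI ballI allI impI) blast+

end
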